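(* Let $(M^n,g)$ be a Riemannian spin manifold with a metric connection $\nabla$ with skew-symmetric torsion $\mathrm{T}$, and let $\Omega$ be the Casimir operator of the triple $(M^n,g,\nabla)$. Then every $\nabla$-parallel spinor field lies in the kernel of $\Omega$: if $\psi$ is a spinor field with $\nabla\psi=0$, then $\Omega\psi=0$.
   Context: Clifford multiplication satisfies $X\cdot X=-g(X,X)$; $S$ is the complex spinor bundle, and a form acts on spinors by Clifford multiplication, where $e_{i_1}\wedge\dots\wedge e_{i_p}$ acts as $e_{i_1}\cdots e_{i_p}$ for an orthonormal frame $e_1,\dots,e_n$. A metric connection with skew-symmetric torsion given by the $3$-form $\mathrm{T}$ is $\nabla_XY=\nabla^g_XY+\tfrac12\mathrm{T}(X,Y,-)$ ($\nabla^g$ is the Levi-Civita connection and the $1$-form $\mathrm{T}(X,Y,-)$ is identified with a vector via $g$); it lifts to spinors as $\nabla_X\psi=\nabla^g_X\psi+\tfrac14(X\lrcorner\mathrm{T})\cdot\psi$. Let $D^g$ be the Riemannian Dirac operator and $D^{1/3}=D^g+\tfrac14\mathrm{T}$ (the Dirac operator of the connection with torsion $\mathrm{T}/3$). Put $\sigma_{\mathrm{T}}=\tfrac12\sum_k(e_k\lrcorner\mathrm{T})\wedge(e_k\lrcorner\mathrm{T})$, $\|\mathrm{T}\|^2=\sum_{i<j<k}\mathrm{T}(e_i,e_j,e_k)^2$, $\delta(\mathrm{T})=-\sum_k e_k\lrcorner\nabla^g_{e_k}\mathrm{T}$, let $\mathrm{Scal}^g$ be the Riemannian scalar curvature, $\mathrm{Scal}=\mathrm{Scal}^g-\tfrac32\|\mathrm{T}\|^2$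 the scalar curvature of $\nabla$, and $\Delta_{\mathrm{T}}=\nabla^*\nabla$ the spinor Laplacian of $\nabla$. The Casimir operator of $(M^n,g,\nabla)$ is the operator on spinor fields $$\Omega=(D^{1/3})^2+\tfrac18(d\mathrm{T}-2\sigma_{\mathrm{T}})+\tfrac14\delta(\mathrm{T})-\tfrac18\mathrm{Scal}^g-\tfrac1{16}\|\mathrm{T}\|^2=\Delta_{\mathrm{T}}+\tfrac18\big(3\,d\mathrm{T}-2\sigma_{\mathrm{T}}+2\,\delta(\mathrm{T})+\mathrm{Scal}\big).$$ *)

theory Defs
  imports "HOL-Analysis.Analysis"
begin

section \<open>Smooth manifolds\<close>

primrec Ck_on :: "nat \<Rightarrow> (real^'n) set \<Rightarrow> (real^'n \<Rightarrow> 'b::real_normed_vector) \<Rightarrow> bool" where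
  "Ck_on 0 S f \<longleftrightarrow> continuous_on S f"
| "Ck_on (Suc k) S f \<longleftrightarrow>
     (\<forall>x\<in>S. f differentiable (at x)) \<and> (\<forall>v. Ck_on k S (\<lambda>x. frechet_derivative f (at x) v))"

text \<open>Only used for open \<open>S\<close>.\<close>

definition smooth_on :: "(real^'n) set \<Rightarrow> (real^'n \<Rightarrow> 'b::real_normed_vector) \<Rightarrow> bool" where
  "smooth_on S f \<longleftrightarrow> (\<forall>k. Ck_on k S f)"

text \<open>A chart is a pair of its domain and its coordinate map.  The dimension of the manifold is
  \<open>CARD('n)\<close>.\<close>

type_synonym ('a, 'n) chart = "'a set \<times> ('a \<Rightarrow> real^'n)"

abbreviation chart_inv :: "('a, 'n::finite) chart \<Rightarrow> real^'n \<Rightarrow> 'a" where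
  "chart_inv c \<equiv> inv_into (fst c) (snd c)"

definition smooth_in :: "('a, 'n::finite) chart \<Rightarrow> 'a set \<Rightarrow> ('a \<Rightarrow> 'b::real_normed_vector) \<Rightarrow> bool" where
  "smooth_in c U f \<longleftrightarrow> smooth_on (snd c ` (fst c \<inter> U)) (f \<circ> chart_inv c)"

text \<open>\<open>pd c f p v\<close> is the derivative of \<open>f\<close> at \<open>p\<close> in the direction of the tangent vector whose
  component vector in the chart \<open>c\<close> is \<open>v\<close>.\<close>

definition pd :: "('a, 'n::finite) chart \<Rightarrow> ('a \<Rightarrow> 'b::real_normed_vector) \<Rightarrow> 'a \<Rightarrow> real^'n \<Rightarrow> 'b" where
  "pd c f p v = frechet_derivative (f \<circ> chart_inv c) (at (snd c p)) v"

definition smooth_manifold :: "'a topology \<Rightarrow> ('a, 'n::finite) chart set \<Rightarrow> bool" where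
  "smooth_manifold X A \<longleftrightarrow>
     Hausdorff_space X \<and> second_countable X \<and>
     (\<Union>c\<in>A. fst c) = topspace X \<and>
     (\<forall>c\<in>A. openin X (fst c) \<and> open (snd c ` fst c) \<and>
        homeomorphic_map (subtopology X (fst c)) (top_of_set (snd c ` fst c)) (snd c)) \<and>
     (\<forall>c\<in>A. \<forall>d\<in>A. smooth_in c (fst d) (snd d))"


section \<open>Tensor fields\<close>

text \<open>A tensor field is given by its components in every chart.  The components in two charts
  \<open>c\<close>, \<open>d\<close> are related by the Jacobian \<open>pd c (snd d) p\<close> of the coordinate change.\<close>

type_synonym ('a, 'n) vector_field = "('a, 'n) chart \<Rightarrow> 'a \<Rightarrow> real^'n"
type_synonym ('a, 'n) bilinear_field = "('a, 'n) chart \<Rightarrow> 'a \<Rightarrow> real^'n \<Rightarrow> real^'n \<Rightarrow> real"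
type_synonym ('a, 'n) trilinear_field = "('a, 'n) chart \<Rightarrow> 'a \<Rightarrow> real^'n \<Rightarrow> real^'n \<Rightarrow> real^'n \<Rightarrow> real"

definition vector_field_on ::
    "('a, 'n::finite) chart set \<Rightarrow> 'a set \<Rightarrow> ('a, 'n) vector_field \<Rightarrow> bool" where
  "vector_field_on A U Y \<longleftrightarrow>
     (\<forall>c\<in>A. smooth_in c U (Y c)) \<and>
     (\<forall>c\<in>A. \<forall>d\<in>A. \<forall>p\<in>fst c \<inter> fst d \<inter> U. Y d p = pd c (snd d) p (Y c p))"

definition inner_product :: "(real^'n \<Rightarrow> real^'n \<Rightarrow> real) \<Rightarrow> bool" where
  "inner_product b \<longleftrightarrow>
     bilinear b \<and> (\<forall>v w. b v w = b w v) \<and> (\<forall>v. v \<noteq> 0 \<longrightarrow> b v v > 0)"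

definition riemannian_metric ::
    "('a, 'n::finite) chart set \<Rightarrow> ('a, 'n) bilinear_field \<Rightarrow> bool" where
  "riemannian_metric A g \<longleftrightarrow>
     (\<forall>c\<in>A. \<forall>p\<in>fst c. inner_product (g c p)) \<and>
     (\<forall>c\<in>A. \<forall>v w. smooth_in c (fst c) (\<lambda>p. g c p v w)) \<and>
     (\<forall>c\<in>A. \<forall>d\<in>A. \<forall>p\<in>fst c \<inter> fst d. \<forall>v w.
        g c p v w = g d p (pd c (snd d) p v) (pd c (snd d) p w))"

definition alternating3 :: "(real^'n \<Rightarrow> real^'n \<Rightarrow> real^'n \<Rightarrow> real) \<Rightarrow> bool" where
  "alternating3 t \<longleftrightarrow>
     (\<forall>v w. linear (\<lambda>u. t u v w) \<and> linear (\<lambda>u. t v u w) \<and> linear (\<lambda>u. t v w u)) \<and>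
     (\<forall>v w. t v v w = 0 \<and> t v w w = 0)"

definition three_form ::
    "('a, 'n::finite) chart set \<Rightarrow> ('a, 'n) trilinear_field \<Rightarrow> bool" where
  "three_form A T \<longleftrightarrow>
     (\<forall>c\<in>A. \<forall>p\<in>fst c. alternating3 (T c p)) \<and>
     (\<forall>c\<in>A. \<forall>u v w. smooth_in c (fst c) (\<lambda>p. T c p u v w)) \<and>
     (\<forall>c\<in>A. \<forall>d\<in>A. \<forall>p\<in>fst c \<inter> fst d. \<forall>u v w.
        T c p u v w = T d p (pd c (snd d) p u) (pd c (snd d) p v) (pd c (snd d) p w))"


section \<open>Connections and curvature in a chart\<close>

text \<open>The vector identified via the inner product \<open>b\<close> with the linear form \<open>\<alpha>\<close>.\<close>

definition sharp :: "(real^'n \<Rightarrow> real^'n \<Rightarrow> real) \<Rightarrow> (real^'n \<Rightarrow> real) \<Rightarrow> real^'n" where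
  "sharp b \<alpha> = (THE x. \<forall>u. b x u = \<alpha> u)"

definition christoffel ::
    "('a, 'n::finite) chart \<Rightarrow> ('a, 'n) bilinear_field \<Rightarrow> 'a \<Rightarrow> real^'n \<Rightarrow> real^'n \<Rightarrow> real^'n" where
  "christoffel c g p v w = sharp (g c p) (\<lambda>u.
     (pd c (\<lambda>q. g c q w u) p v + pd c (\<lambda>q. g c q v u) p w - pd c (\<lambda>q. g c q v w) p u) / 2)"

text \<open>\<open>levi_civita c g Y p v\<close> and \<open>torsion_connection c g T Y p v\<close> are the components in the chart
  \<open>c\<close> of the covariant derivatives of \<open>Y\<close> at \<open>p\<close> in the direction \<open>v\<close>.\<close>

definition levi_civita ::
    "('a, 'n::finite) chart \<Rightarrow> ('a, 'n) bilinear_field \<Rightarrow> ('a, 'n) vector_field \<Rightarrow> 'a \<Rightarrow> real^'n \<Rightarrow> real^'n"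
  where "levi_civita c g Y p v = pd c (Y c) p v + christoffel c g p v (Y c p)"

definition torsion_connection ::
    "('a, 'n::finite) chart \<Rightarrow> ('a, 'n) bilinear_field \<Rightarrow> ('a, 'n) trilinear_field \<Rightarrow>
      ('a, 'n) vector_field \<Rightarrow> 'a \<Rightarrow> real^'n \<Rightarrow> real^'n" where
  "torsion_connection c g T Y p v =
     levi_civita c g Y p v + (1/2) *\<^sub>R sharp (g c p) (T c p v (Y c p))"

text \<open>\<open>R(x,y)z\<close> with the sign convention \<open>[\<nabla>\<^sub>x,\<nabla>\<^sub>y] - \<nabla>\<^bsub>[x,y]\<^esub>\<close>, evaluated on coordinate
  vector fields.\<close>

definition riemann ::
    "('a, 'n::finite) chart \<Rightarrow> ('a, 'n) bilinear_field \<Rightarrow> 'a \<Rightarrow> real^'n \<Rightarrow> real^'n \<Rightarrow> real^'n \<Rightarrow> real^'n"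
  where
  "riemann c g p x y z =
     pd c (\<lambda>q. christoffel c g q y z) p x - pd c (\<lambda>q. christoffel c g q x z) p y
     + christoffel c g p x (christoffel c g p y z) - christoffel c g p y (christoffel c g p x z)"

text \<open>In the following \<open>E\<close> is an orthonormal basis of the tangent space at \<open>p\<close>.\<close>

definition scal_g ::
    "('a, 'n::finite) chart \<Rightarrow> ('a, 'n) bilinear_field \<Rightarrow> ('n \<Rightarrow> real^'n) \<Rightarrow> 'a \<Rightarrow> real" where
  "scal_g c g E p = (\<Sum>i\<in>UNIV. \<Sum>j\<in>UNIV. g c p (riemann c g p (E i) (E j) (E j)) (E i))"


section \<open>Forms derived from the torsion form\<close>

text \<open>Conventions: the wedge product of two-forms is the sum over \<open>(2,2)\<close>-shuffles and the exterior
  derivative has no numerical prefactor, so that \<open>e\<^sub>i \<and> e\<^sub>j\<close> takes the value 1 on \<open>(e\<^sub>i, e\<^sub>j)\<close>.\<close>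

definition wedge22 ::
    "('v \<Rightarrow> 'v \<Rightarrow> real) \<Rightarrow> ('v \<Rightarrow> 'v \<Rightarrow> real) \<Rightarrow> 'v \<Rightarrow> 'v \<Rightarrow> 'v \<Rightarrow> 'v \<Rightarrow> real" where
  "wedge22 \<alpha> \<beta> x y z w =
     \<alpha> x y * \<beta> z w - \<alpha> x z * \<beta> y w + \<alpha> x w * \<beta> y z
     + \<alpha> y z * \<beta> x w - \<alpha> y w * \<beta> x z + \<alpha> z w * \<beta> x y"

definition sigma_T :: "('n::finite \<Rightarrow> 'v) \<Rightarrow> ('v \<Rightarrow> 'v \<Rightarrow> 'v \<Rightarrow> real) \<Rightarrow> 'v \<Rightarrow> 'v \<Rightarrow> 'v \<Rightarrow> 'v \<Rightarrow> real" where
  "sigma_T E t x y z w = (1/2) * (\<Sum>k\<in>UNIV. wedge22 (t (E k)) (t (E k)) x y z w)"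

text \<open>The factor \<open>1/6\<close> turns the sum over all triples of indices into the one over \<open>i < j < k\<close>.\<close>

definition norm_T_sq :: "('n::finite \<Rightarrow> 'v) \<Rightarrow> ('v \<Rightarrow> 'v \<Rightarrow> 'v \<Rightarrow> real) \<Rightarrow> real" where
  "norm_T_sq E t = (1/6) * (\<Sum>i\<in>UNIV. \<Sum>j\<in>UNIV. \<Sum>k\<in>UNIV. (t (E i) (E j) (E k))\<^sup>2)"

definition ext_deriv ::
    "('a, 'n::finite) chart \<Rightarrow> ('a, 'n) trilinear_field \<Rightarrow> 'a \<Rightarrow>
      real^'n \<Rightarrow> real^'n \<Rightarrow> real^'n \<Rightarrow> real^'n \<Rightarrow> real" where
  "ext_deriv c T p x y z w =
     pd c (\<lambda>q. T c q y z w) p x - pd c (\<lambda>q. T c q x z w) p y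
     + pd c (\<lambda>q. T c q x y w) p z - pd c (\<lambda>q. T c q x y z) p w"

definition cov_deriv3 ::
    "('a, 'n::finite) chart \<Rightarrow> ('a, 'n) bilinear_field \<Rightarrow> ('a, 'n) trilinear_field \<Rightarrow> 'a \<Rightarrow>
      real^'n \<Rightarrow> real^'n \<Rightarrow> real^'n \<Rightarrow> real^'n \<Rightarrow> real" where
  "cov_deriv3 c g T p v x y z =
     pd c (\<lambda>q. T c q x y z) p v - T c p (christoffel c g p v x) y z
     - T c p x (christoffel c g p v y) z - T c p x y (christoffel c g p v z)"

definition codiff ::
    "('a, 'n::finite) chart \<Rightarrow> ('a, 'n) bilinear_field \<Rightarrow> ('a, 'n) trilinear_field \<Rightarrow>
      ('n \<Rightarrow> real^'n) \<Rightarrow> 'a \<Rightarrow> real^'n \<Rightarrow> real^'n \<Rightarrow> real" where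
  "codiff c g T E p x y = - (\<Sum>k\<in>UNIV. cov_deriv3 c g T p (E k) (E k) x y)"


section \<open>Clifford algebra and spin structures\<close>

text \<open>\<open>\<gamma> i\<close> is the action of the \<open>i\<close>-th standard basis vector on the complex spinor module.  By its
  dimension the module is irreducible; in odd dimensions either of the two irreducible Clifford
  modules is allowed.\<close>

definition spinor_module :: "('n::finite \<Rightarrow> complex^'d^'d) \<Rightarrow> bool" where
  "spinor_module \<gamma> \<longleftrightarrow>
     CARD('d) = 2 ^ (CARD('n) div 2) \<and>
     (\<forall>i j. \<gamma> i ** \<gamma> j + \<gamma> j ** \<gamma> i = (if i = j then - 2 *\<^sub>R mat 1 else 0))"

definition cliff1 :: "('n::finite \<Rightarrow> complex^'d^'d) \<Rightarrow> real^'n \<Rightarrow> complex^'d^'d" where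
  "cliff1 \<gamma> v = (\<Sum>i\<in>UNIV. (v $ i) *\<^sub>R \<gamma> i)"

text \<open>Action of a \<open>p\<close>-form, given an orthonormal basis \<open>E\<close>: for alternating \<open>\<omega>\<close> the sum of
  \<open>\<omega>(e\<^sub>i\<^sub>1, \<dots>, e\<^sub>i\<^sub>p) e\<^sub>i\<^sub>1 \<cdots> e\<^sub>i\<^sub>p\<close> over increasing indices is \<open>1/p!\<close> times the sum over all indices.\<close>

definition cliff2 ::
    "('n::finite \<Rightarrow> complex^'d^'d) \<Rightarrow> ('n \<Rightarrow> 'v) \<Rightarrow> ('v \<Rightarrow> 'v \<Rightarrow> real) \<Rightarrow> complex^'d^'d" where
  "cliff2 \<gamma> E \<omega> = (1/2) *\<^sub>R (\<Sum>i\<in>UNIV. \<Sum>j\<in>UNIV. \<omega> (E i) (E j) *\<^sub>R (\<gamma> i ** \<gamma> j))"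

definition cliff3 ::
    "('n::finite \<Rightarrow> complex^'d^'d) \<Rightarrow> ('n \<Rightarrow> 'v) \<Rightarrow> ('v \<Rightarrow> 'v \<Rightarrow> 'v \<Rightarrow> real) \<Rightarrow> complex^'d^'d" where
  "cliff3 \<gamma> E \<omega> = (1/6) *\<^sub>R (\<Sum>i\<in>UNIV. \<Sum>j\<in>UNIV. \<Sum>k\<in>UNIV.
     \<omega> (E i) (E j) (E k) *\<^sub>R (\<gamma> i ** \<gamma> j ** \<gamma> k))"

definition cliff4 ::
    "('n::finite \<Rightarrow> complex^'d^'d) \<Rightarrow> ('n \<Rightarrow> 'v) \<Rightarrow> ('v \<Rightarrow> 'v \<Rightarrow> 'v \<Rightarrow> 'v \<Rightarrow> real) \<Rightarrow> complex^'d^'d"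
  where
  "cliff4 \<gamma> E \<omega> = (1/24) *\<^sub>R (\<Sum>i\<in>UNIV. \<Sum>j\<in>UNIV. \<Sum>k\<in>UNIV. \<Sum>l\<in>UNIV.
     \<omega> (E i) (E j) (E k) (E l) *\<^sub>R (\<gamma> i ** \<gamma> j ** \<gamma> k ** \<gamma> l))"

text \<open>The complex spin representation is faithful on \<open>Spin(n)\<close>, so the group is identified with its
  image in the matrices.\<close>

definition spin_group :: "('n::finite \<Rightarrow> complex^'d^'d) \<Rightarrow> (complex^'d^'d) set" where
  "spin_group \<gamma> = {foldr (\<lambda>v m. cliff1 \<gamma> v ** m) vs (mat 1) | vs.
     even (length vs) \<and> (\<forall>v\<in>set vs. norm v = 1)}"

text \<open>The two-fold covering \<open>Spin(n) \<rightarrow> SO(n)\<close>, \<open>u v u\<^sup>-\<^sup>1 = \<lambda>(u) v\<close>.\<close>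

definition spin_cover :: "('n::finite \<Rightarrow> complex^'d^'d) \<Rightarrow> complex^'d^'d \<Rightarrow> real^'n^'n" where
  "spin_cover \<gamma> u = (THE R. \<forall>v. u ** cliff1 \<gamma> v = cliff1 \<gamma> (R *v v) ** u)"

text \<open>A spin structure, given as a lift to \<open>Spin(n)\<close> of the cocycle of the orthonormal frame bundle:
  \<open>(W j)\<^sub>j\<close> is an open cover, \<open>e j\<close> is an orthonormal frame over \<open>W j\<close>, and \<open>s j k\<close> lifts the
  transition function between the frames \<open>e j\<close> and \<open>e k\<close>.\<close>

definition spin_structure ::
    "'a topology \<Rightarrow> ('a, 'n::finite) chart set \<Rightarrow> ('a, 'n) bilinear_field \<Rightarrow> ('n \<Rightarrow> complex^'d^'d) \<Rightarrow>
      'j set \<Rightarrow> ('j \<Rightarrow> 'a set) \<Rightarrow> ('j \<Rightarrow> 'n \<Rightarrow> ('a, 'n) vector_field) \<Rightarrow>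
      ('j \<Rightarrow> 'j \<Rightarrow> 'a \<Rightarrow> complex^'d^'d) \<Rightarrow> bool" where
  "spin_structure X A g \<gamma> J W e s \<longleftrightarrow>
     (\<Union>j\<in>J. W j) = topspace X \<and> (\<forall>j\<in>J. openin X (W j)) \<and>
     (\<forall>j\<in>J. \<forall>i. vector_field_on A (W j) (e j i)) \<and>
     (\<forall>j\<in>J. \<forall>c\<in>A. \<forall>p\<in>fst c \<inter> W j. \<forall>i k.
        g c p (e j i c p) (e j k c p) = (if i = k then 1 else 0)) \<and>
     (\<forall>j\<in>J. \<forall>k\<in>J. \<forall>c\<in>A. smooth_in c (W j \<inter> W k) (s j k)) \<and>
     (\<forall>j\<in>J. \<forall>k\<in>J. \<forall>p\<in>W j \<inter> W k. s j k p \<in> spin_group \<gamma>) \<and>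
     (\<forall>j\<in>J. \<forall>k\<in>J. \<forall>c\<in>A. \<forall>p\<in>fst c \<inter> W j \<inter> W k. \<forall>i.
        e k i c p = (\<Sum>l\<in>UNIV. (spin_cover \<gamma> (s j k p) $ l $ i) *\<^sub>R e j l c p)) \<and>
     (\<forall>j\<in>J. \<forall>k\<in>J. \<forall>l\<in>J. \<forall>p\<in>W j \<inter> W k \<inter> W l. s j k p ** s k l p = s j l p)"

text \<open>Smooth sections of the associated spinor bundle, given by their local representatives.\<close>

definition spinor_field ::
    "('a, 'n::finite) chart set \<Rightarrow> 'j set \<Rightarrow> ('j \<Rightarrow> 'a set) \<Rightarrow> ('j \<Rightarrow> 'j \<Rightarrow> 'a \<Rightarrow> complex^'d^'d) \<Rightarrow>
      ('j \<Rightarrow> 'a \<Rightarrow> complex^'d) \<Rightarrow> bool" where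
  "spinor_field A J W s \<psi> \<longleftrightarrow>
     (\<forall>j\<in>J. \<forall>c\<in>A. smooth_in c (W j) (\<psi> j)) \<and>
     (\<forall>j\<in>J. \<forall>k\<in>J. \<forall>p\<in>W j \<inter> W k. \<psi> j p = s j k p *v \<psi> k p)"


section \<open>Operators on spinor fields\<close>

text \<open>The operators below act on the local representative \<open>\<psi>\<close> of a spinor field with respect to a
  spin frame \<open>e\<close>, computed in a chart \<open>c\<close>.\<close>

text \<open>Spinor lift of a metric connection \<open>\<nabla>\<close> of the tangent bundle:
  \<open>\<nabla>\<^sub>v \<psi> = v(\<psi>) + 1/2 \<Sum>\<^bsub>i<j\<^esub> g(\<nabla>\<^sub>v e\<^sub>i, e\<^sub>j) e\<^sub>i e\<^sub>j \<psi>\<close>.\<close>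

definition spin_lift ::
    "('a, 'n::finite) chart \<Rightarrow> ('a, 'n) bilinear_field \<Rightarrow> ('n \<Rightarrow> complex^'d^'d) \<Rightarrow>
      ('n \<Rightarrow> ('a, 'n) vector_field) \<Rightarrow> (('a, 'n) vector_field \<Rightarrow> 'a \<Rightarrow> real^'n \<Rightarrow> real^'n) \<Rightarrow>
      ('a \<Rightarrow> complex^'d) \<Rightarrow> 'a \<Rightarrow> real^'n \<Rightarrow> complex^'d" where
  "spin_lift c g \<gamma> e nab \<psi> p v =
     pd c \<psi> p v + (1/4) *\<^sub>R (\<Sum>i\<in>UNIV. \<Sum>j\<in>UNIV.
       g c p (nab (e i) p v) (e j c p) *\<^sub>R ((\<gamma> i ** \<gamma> j) *v \<psi> p))"

definition spin_levi_civita ::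
    "('a, 'n::finite) chart \<Rightarrow> ('a, 'n) bilinear_field \<Rightarrow> ('n \<Rightarrow> complex^'d^'d) \<Rightarrow>
      ('n \<Rightarrow> ('a, 'n) vector_field) \<Rightarrow> ('a \<Rightarrow> complex^'d) \<Rightarrow> 'a \<Rightarrow> real^'n \<Rightarrow> complex^'d" where
  "spin_levi_civita c g \<gamma> e = spin_lift c g \<gamma> e (levi_civita c g)"

definition spin_torsion ::
    "('a, 'n::finite) chart \<Rightarrow> ('a, 'n) bilinear_field \<Rightarrow> ('a, 'n) trilinear_field \<Rightarrow>
      ('n \<Rightarrow> complex^'d^'d) \<Rightarrow> ('n \<Rightarrow> ('a, 'n) vector_field) \<Rightarrow>
      ('a \<Rightarrow> complex^'d) \<Rightarrow> 'a \<Rightarrow> real^'n \<Rightarrow> complex^'d" where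
  "spin_torsion c g T \<gamma> e = spin_lift c g \<gamma> e (torsion_connection c g T)"

definition dirac_g ::
    "('a, 'n::finite) chart \<Rightarrow> ('a, 'n) bilinear_field \<Rightarrow> ('n \<Rightarrow> complex^'d^'d) \<Rightarrow>
      ('n \<Rightarrow> ('a, 'n) vector_field) \<Rightarrow> ('a \<Rightarrow> complex^'d) \<Rightarrow> 'a \<Rightarrow> complex^'d" where
  "dirac_g c g \<gamma> e \<psi> p = (\<Sum>i\<in>UNIV. \<gamma> i *v spin_levi_civita c g \<gamma> e \<psi> p (e i c p))"

definition dirac_third ::
    "('a, 'n::finite) chart \<Rightarrow> ('a, 'n) bilinear_field \<Rightarrow> ('a, 'n) trilinear_field \<Rightarrow>
      ('n \<Rightarrow> complex^'d^'d) \<Rightarrow> ('n \<Rightarrow> ('a, 'n) vector_field) \<Rightarrow>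
      ('a \<Rightarrow> complex^'d) \<Rightarrow> 'a \<Rightarrow> complex^'d" where
  "dirac_third c g T \<gamma> e \<psi> p =
     dirac_g c g \<gamma> e \<psi> p + (1/4) *\<^sub>R (cliff3 \<gamma> (\<lambda>i. e i c p) (T c p) *v \<psi> p)"

definition casimir ::
    "('a, 'n::finite) chart \<Rightarrow> ('a, 'n) bilinear_field \<Rightarrow> ('a, 'n) trilinear_field \<Rightarrow>
      ('n \<Rightarrow> complex^'d^'d) \<Rightarrow> ('n \<Rightarrow> ('a, 'n) vector_field) \<Rightarrow>
      ('a \<Rightarrow> complex^'d) \<Rightarrow> 'a \<Rightarrow> complex^'d" where
  "casimir c g T \<gamma> e \<psi> p =
     (let E = (\<lambda>i. e i c p) in
       dirac_third c g T \<gamma> e (dirac_third c g T \<gamma> e \<psi>) p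
       + (1/8) *\<^sub>R (cliff4 \<gamma> E (\<lambda>x y z w. ext_deriv c T p x y z w - 2 * sigma_T E (T c p) x y z w)
                  *v \<psi> p)
       + (1/4) *\<^sub>R (cliff2 \<gamma> E (codiff c g T E p) *v \<psi> p)
       - (1/8 * scal_g c g E p) *\<^sub>R \<psi> p
       - (1/16 * norm_T_sq E (T c p)) *\<^sub>R \<psi> p)"


section \<open>The spinor lift of the connection with torsion\<close>

lemma sharp_eq:
  assumes ip: "inner_product b" and lin: "linear \<alpha>"
  shows "b (sharp b \<alpha>) u = \<alpha> u"
proof -
  have bil: "bilinear b" and pos: "\<And>v. v \<noteq> 0 \<Longrightarrow> b v v > 0"
    using ip by (auto simp: inner_product_def)
  have lin_r: "linear (b x)" and lin_l: "linear (\<lambda>x. b x u)" for x u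
    using bil by (auto simp: bilinear_def)
  define f where "f x = (\<chi> i. b x (axis i 1))" for x
  have f_lin: "linear f"
    by (rule linearI) (auto simp: f_def vec_eq_iff bilinear_ladd[OF bil] bilinear_lmul[OF bil])
  have ext: "l = l'" if "linear l" "linear l'" "\<And>i. l (axis i 1) = l' (axis i 1)"
    for l l' :: "real^'a \<Rightarrow> real"
    by (rule linear_eq_stdbasis[OF that(1,2)]) (use that(3) in \<open>auto simp: Basis_vec_def\<close>)
  have "inj f"
  proof (subst linear_injective_0[OF f_lin], intro allI impI)
    fix x assume "f x = 0"
    then have "b x (axis i 1) = 0" for i
      by (auto simp: f_def vec_eq_iff)
    then have "b x = (\<lambda>_. 0)"
      by (intro ext lin_r) (auto intro: linearI)
    then show "x = 0"
      using pos[of x] by auto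
  qed
  then have "surj f"
    by (rule linear_injective_imp_surjective[OF f_lin]) simp
  then obtain x where "f x = (\<chi> i. \<alpha> (axis i 1))"
    by (metis surjD)
  then have x: "b x = \<alpha>"
    by (intro ext lin_r lin) (auto simp: f_def vec_eq_iff)
  have "y = x" if "\<forall>u. b y u = \<alpha> u" for y
  proof (rule ccontr)
    assume "y \<noteq> x"
    then have "b (y - x) (y - x) > 0"
      using pos[of "y - x"] by simp
    moreover have "b (y - x) (y - x) = 0"
      using that x by (simp add: bilinear_lsub[OF bil])
    ultimately show False by simp
  qed
  then have "sharp b \<alpha> = x"
    unfolding sharp_def by (intro the_equality) (auto simp: x)
  then show ?thesis
    by (simp add: x)
qed

lemma scaleR_matrix_vector: "(r *\<^sub>R M) *v x = r *\<^sub>R (M *v x)"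
  for M :: "complex^'n^'m"
  by (simp add: vec_eq_iff matrix_vector_mult_def scaleR_sum_right)

lemma sum_matrix_vector: "(\<Sum>i\<in>S. M i) *v x = (\<Sum>i\<in>S. M i *v x)"
  for M :: "'b \<Rightarrow> complex^'n^'m"
  by (induction S rule: infinite_finite_induct) (auto simp: matrix_vector_mult_add_rdistrib)

lemma spin_torsion_eq:
  assumes "inner_product (g c p)" and "alternating3 (T c p)"
  shows "spin_torsion c g T \<gamma> e \<psi> p v =
    spin_levi_civita c g \<gamma> e \<psi> p v + (1/4) *\<^sub>R (cliff2 \<gamma> (\<lambda>i. e i c p) (T c p v) *v \<psi> p)"
proof -
  have bil: "bilinear (g c p)"
    using assms(1) by (simp add: inner_product_def)
  have "linear (T c p v w)" for w
    using assms(2) by (simp add: alternating3_def)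
  then have *: "g c p (torsion_connection c g T (e i) p v) (e j c p) =
      g c p (levi_civita c g (e i) p v) (e j c p) + (1/2) * T c p v (e i c p) (e j c p)" for i j
    by (simp add: torsion_connection_def bilinear_ladd[OF bil] bilinear_lmul[OF bil]
        sharp_eq[OF assms(1)])
  show ?thesis
    unfolding spin_torsion_def spin_levi_civita_def spin_lift_def cliff2_def *
    by (simp add: scaleR_matrix_vector sum_matrix_vector scaleR_add_left sum.distrib scaleR_add_right
        scaleR_sum_right algebra_simps)
qed

end

theory Submission
  imports Defs
begin

text \<open>On a parallel spinor field \<open>\<psi>\<close> the Casimir operator is of order zero, and the element of the Clifford algebra
  through which it acts is a contraction of the curvature of \<open>\<nabla>\<close>, which annihilates \<open>\<psi>\<close>.

  In detail, let \<open>e\<^sub>a\<close> be an orthonormal frame and \<open>\<omega>\<^sub>a = e\<^sub>a \<lrcorner> T\<close>.  From \<open>\<nabla>\<psi> = 0\<close> one has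
  \<open>\<nabla>\<^sup>g\<^sub>a \<psi> = -(1/4) \<omega>\<^sub>a \<psi>\<close>, and \<open>\<Sum>\<^sub>a e\<^sub>a \<omega>\<^sub>a = 3T\<close> gives \<open>D\<^sup>1\<^sup>/\<^sup>3 \<psi> = -(1/2) T \<psi>\<close> (\<open>dirac_one_third_psi\<close>).
  A second application of the operator yields
  \<open>(D\<^sup>1\<^sup>/\<^sup>3)\<^sup>2 \<psi> = (-(1/2) \<Sum>\<^sub>a e\<^sub>a \<nabla>\<^sub>aT + (1/8) \<Sum>\<^sub>a e\<^sub>a T \<omega>\<^sub>a - (1/8) T\<^sup>2) \<psi>\<close>
  (\<open>dirac_one_third_squared_psi\<close>), so that \<open>\<Omega>\<psi> = C\<psi>\<close> with a field \<open>C\<close> of elements of the Clifford algebra.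
  The first sum is \<open>dT + \<delta>T\<close> (\<open>sum_cl3_eq_cl4_cl2\<close>), and the other terms are reduced to \<open>\<sigma>\<^sub>T\<close> and \<open>\<parallel>T\<parallel>\<^sup>2\<close> by the identities
  \<open>\<Sum>\<^sub>a e\<^sub>a T \<omega>\<^sub>a = -3T\<^sup>2 - 2 \<Sum>\<^sub>a \<omega>\<^sub>a\<^sup>2\<close>,
  \<open>T\<^sup>2 = -2\<sigma>\<^sub>T + \<parallel>T\<parallel>\<^sup>2\<close> and \<open>\<Sum>\<^sub>a \<omega>\<^sub>a\<^sup>2 = 2\<sigma>\<^sub>T - 3\<parallel>T\<parallel>\<^sup>2\<close> (\<open>sum_gamma_cl3_cl2\<close>,
  \<open>cl3_square\<close>, \<open>sum_cl2_squares\<close>).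

  On the other hand, the symmetry of second derivatives applied to \<open>\<nabla>\<psi> = 0\<close> shows that the curvature \<open>R\<close>
  of the spinor connection satisfies \<open>R(e\<^sub>a, e\<^sub>b) \<psi> = 0\<close> (\<open>curvature_annihilates\<close>).  It consists of the
  Riemannian curvature, of the antisymmetrised covariant derivative of \<open>T\<close>, and of the
  commutator \<open>[\<omega>\<^sub>a, \<omega>\<^sub>b]\<close> (\<open>curvature_with_torsion\<close>).  In the contraction \<open>\<Sum> e\<^sub>a e\<^sub>b R(e\<^sub>a, e\<^sub>b)\<close> the first part gives half the
  Riemannian scalar curvature by the Bianchi identity (\<open>lichnerowicz_contraction\<close>), and the whole sum is
  \<open>(1/2) (3dT - 2\<sigma>\<^sub>T + 2\<delta>T + Scal)\<close>.  This is \<open>-4C\<close> (\<open>casimir_eq_curvature_contraction\<close>), hence \<open>C\<psi> = 0\<close>.\<close>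

section \<open>Clifford algebra\<close>

definition cl2 :: "('n::finite \<Rightarrow> 'r::real_algebra_1) \<Rightarrow> ('n \<Rightarrow> 'n \<Rightarrow> real) \<Rightarrow> 'r" where
  "cl2 \<gamma> w = (1/2) *\<^sub>R (\<Sum>i\<in>UNIV. \<Sum>j\<in>UNIV. w i j *\<^sub>R (\<gamma> i * \<gamma> j))"

definition cl3 :: "('n::finite \<Rightarrow> 'r::real_algebra_1) \<Rightarrow> ('n \<Rightarrow> 'n \<Rightarrow> 'n \<Rightarrow> real) \<Rightarrow> 'r" where
  "cl3 \<gamma> w = (1/6) *\<^sub>R (\<Sum>i\<in>UNIV. \<Sum>j\<in>UNIV. \<Sum>k\<in>UNIV. w i j k *\<^sub>R (\<gamma> i * \<gamma> j * \<gamma> k))"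

definition cl4 :: "('n::finite \<Rightarrow> 'r::real_algebra_1) \<Rightarrow> ('n \<Rightarrow> 'n \<Rightarrow> 'n \<Rightarrow> 'n \<Rightarrow> real) \<Rightarrow> 'r" where
  "cl4 \<gamma> w = (1/24) *\<^sub>R (\<Sum>i\<in>UNIV. \<Sum>j\<in>UNIV. \<Sum>k\<in>UNIV. \<Sum>l\<in>UNIV.
     w i j k l *\<^sub>R (\<gamma> i * \<gamma> j * \<gamma> k * \<gamma> l))"

definition skew :: "('n \<Rightarrow> 'n \<Rightarrow> real) \<Rightarrow> bool" where
  "skew a \<longleftrightarrow> (\<forall>i j. a i j = - a j i)"

text \<open>Only the two transpositions are recorded; they generate all permutations of the indices.\<close>

definition skew3 :: "('n \<Rightarrow> 'n \<Rightarrow> 'n \<Rightarrow> real) \<Rightarrow> bool" where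
  "skew3 t \<longleftrightarrow> (\<forall>i j k. t i j k = - t j i k \<and> t i j k = - t i k j)"

lemma skewD: "skew a \<Longrightarrow> a i j = - a j i"
  unfolding skew_def by blast

lemma skew3D: assumes "skew3 t" shows "t i j k = - t j i k" "t i j k = - t i k j" "t i j k = t j k i"
proof -
  show *: "t i j k = - t j i k" "t i j k = - t i k j" for i j k
    using assms unfolding skew3_def by blast+
  show "t i j k = t j k i"
    using *(1)[of i j k] *(2)[of j i k] by simp
qed

lemma skew3_skew: "skew3 t \<Longrightarrow> skew (t a)"
  unfolding skew_def skew3_def by blast

text \<open>Real-linear identities between products in an algebra are checked after applying an arbitrary
  linear functional, where they become linear arithmetic over the reals.  Functionals separate
  points because a nonzero vector extends to a basis.\<close>

lemma eq_by_functionals: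
  fixes x y :: "'v::real_vector"
  assumes "\<And>f :: 'v \<Rightarrow> real. linear f \<Longrightarrow> f x = f y"
  shows "x = y"
proof (rule ccontr)
  assume "x \<noteq> y"
  then have "independent {x - y}"
    by simp
  from linear_independent_extend[OF this, of "\<lambda>_. 1::real"]
  obtain f :: "'v \<Rightarrow> real" where f: "linear f" "f (x - y) = 1"
    by auto
  then show False
    using assms[OF f(1)] linear_diff[OF f(1), of x y] by simp
qed

lemmas functional = linear_add linear_diff linear_neg linear_cmul linear_0

lemma sum_if_const: "(\<Sum>j\<in>S. if P then f j else 0) = (if P then sum f S else (0::'b::comm_monoid_add))"
  by simp

lemma scaleR_if: "r *\<^sub>R (if P then x else 0) = (if P then r *\<^sub>R x else (0::'b::real_vector))"
  by simp

lemma mult_if_right: "x * (if P then y else 0) = (if P then x * y else (0::'b::semiring_0))"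
  by simp

lemma mult_if_left: "(if P then y else 0) * x = (if P then y * x else (0::'b::semiring_0))"
  by simp

text \<open>These rules move a Kronecker delta outwards until the sum over its index collapses.\<close>

lemmas delta_simps = scaleR_if mult_if_right mult_if_left sum_if_const

text \<open>Index renaming in multiple sums: the last summation variable is moved to the front.\<close>

lemma sum_swap3:
  "(\<Sum>i\<in>UNIV. \<Sum>j\<in>UNIV. \<Sum>k\<in>UNIV. f i j k) = (\<Sum>k\<in>UNIV. \<Sum>i\<in>UNIV. \<Sum>j\<in>UNIV. f i j k)"
  for f :: "'n::finite \<Rightarrow> 'n \<Rightarrow> 'n \<Rightarrow> 'b::comm_monoid_add"
proof -
  have "(\<Sum>i\<in>UNIV. \<Sum>j\<in>UNIV. \<Sum>k\<in>UNIV. f i j k) = (\<Sum>i\<in>UNIV. \<Sum>k\<in>UNIV. \<Sum>j\<in>UNIV. f i j k)"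
    by (intro sum.cong refl sum.swap)
  also have "\<dots> = (\<Sum>k\<in>UNIV. \<Sum>i\<in>UNIV. \<Sum>j\<in>UNIV. f i j k)"
    by (rule sum.swap)
  finally show ?thesis .
qed

lemma sum_swap4:
  "(\<Sum>i\<in>UNIV. \<Sum>j\<in>UNIV. \<Sum>k\<in>UNIV. \<Sum>l\<in>UNIV. f i j k l) =
   (\<Sum>l\<in>UNIV. \<Sum>i\<in>UNIV. \<Sum>j\<in>UNIV. \<Sum>k\<in>UNIV. f i j k l)"
  for f :: "'n::finite \<Rightarrow> 'n \<Rightarrow> 'n \<Rightarrow> 'n \<Rightarrow> 'b::comm_monoid_add"
proof -
  have "(\<Sum>i\<in>UNIV. \<Sum>j\<in>UNIV. \<Sum>k\<in>UNIV. \<Sum>l\<in>UNIV. f i j k l) =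
        (\<Sum>i\<in>UNIV. \<Sum>l\<in>UNIV. \<Sum>j\<in>UNIV. \<Sum>k\<in>UNIV. f i j k l)"
    by (intro sum.cong refl sum_swap3)
  also have "\<dots> = (\<Sum>l\<in>UNIV. \<Sum>i\<in>UNIV. \<Sum>j\<in>UNIV. \<Sum>k\<in>UNIV. f i j k l)"
    by (rule sum.swap)
  finally show ?thesis .
qed

lemma sum_swap5:
  "(\<Sum>i\<in>UNIV. \<Sum>j\<in>UNIV. \<Sum>k\<in>UNIV. \<Sum>l\<in>UNIV. \<Sum>m\<in>UNIV. f i j k l m) =
   (\<Sum>m\<in>UNIV. \<Sum>i\<in>UNIV. \<Sum>j\<in>UNIV. \<Sum>k\<in>UNIV. \<Sum>l\<in>UNIV. f i j k l m)"
  for f :: "'n::finite \<Rightarrow> 'n \<Rightarrow> 'n \<Rightarrow> 'n \<Rightarrow> 'n \<Rightarrow> 'b::comm_monoid_add"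
proof -
  have "(\<Sum>i\<in>UNIV. \<Sum>j\<in>UNIV. \<Sum>k\<in>UNIV. \<Sum>l\<in>UNIV. \<Sum>m\<in>UNIV. f i j k l m) =
        (\<Sum>i\<in>UNIV. \<Sum>m\<in>UNIV. \<Sum>j\<in>UNIV. \<Sum>k\<in>UNIV. \<Sum>l\<in>UNIV. f i j k l m)"
    by (intro sum.cong refl sum_swap4)
  also have "\<dots> = (\<Sum>m\<in>UNIV. \<Sum>i\<in>UNIV. \<Sum>j\<in>UNIV. \<Sum>k\<in>UNIV. \<Sum>l\<in>UNIV. f i j k l m)"
    by (rule sum.swap)
  finally show ?thesis .
qed

lemma double_sum_eq_cl2: "(\<Sum>i\<in>UNIV. \<Sum>j\<in>UNIV. w i j *\<^sub>R (\<gamma> i * \<gamma> j)) = 2 *\<^sub>R cl2 \<gamma> w"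
  by (simp add: cl2_def)

lemma triple_sum_eq_cl3: "(\<Sum>i\<in>UNIV. \<Sum>j\<in>UNIV. \<Sum>k\<in>UNIV. w i j k *\<^sub>R (\<gamma> i * \<gamma> j * \<gamma> k)) = 6 *\<^sub>R cl3 \<gamma> w"
  by (simp add: cl3_def)

lemma quadruple_sum_eq_cl4: "(\<Sum>i\<in>UNIV. \<Sum>j\<in>UNIV. \<Sum>k\<in>UNIV. \<Sum>l\<in>UNIV.
    w i j k l *\<^sub>R (\<gamma> i * \<gamma> j * \<gamma> k * \<gamma> l)) = 24 *\<^sub>R cl4 \<gamma> w"
  by (simp add: cl4_def)

lemma cl2_add: "cl2 \<gamma> (\<lambda>i j. v i j + w i j) = cl2 \<gamma> v + cl2 \<gamma> w"
  by (simp add: cl2_def scaleR_add_left scaleR_add_right sum.distrib)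

lemma cl2_diff: "cl2 \<gamma> (\<lambda>i j. v i j - w i j) = cl2 \<gamma> v - cl2 \<gamma> w"
  by (simp add: cl2_def scaleR_diff_left scaleR_diff_right sum_subtractf)

lemma cl2_scale: "cl2 \<gamma> (\<lambda>i j. r * w i j) = r *\<^sub>R cl2 \<gamma> w"
  by (simp add: cl2_def scaleR_sum_right mult.commute mult.assoc)

lemma cl2_sum_right: "cl2 \<gamma> (\<lambda>i j. \<Sum>a\<in>A. w a i j) = (\<Sum>a\<in>A. cl2 \<gamma> (w a))"
  by (induction A rule: infinite_finite_induct) (simp_all add: cl2_add, simp_all add: cl2_def)

lemma cl3_add: "cl3 \<gamma> (\<lambda>i j k. v i j k + w i j k) = cl3 \<gamma> v + cl3 \<gamma> w"
  by (simp add: cl3_def scaleR_add_left scaleR_add_right sum.distrib)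

lemma cl4_add: "cl4 \<gamma> (\<lambda>i j k l. v i j k l + w i j k l) = cl4 \<gamma> v + cl4 \<gamma> w"
  by (simp add: cl4_def scaleR_add_left scaleR_add_right sum.distrib)

lemma cl4_scale: "cl4 \<gamma> (\<lambda>i j k l. r * w i j k l) = r *\<^sub>R cl4 \<gamma> w"
  by (simp add: cl4_def scaleR_sum_right mult.commute mult.assoc)

lemma cl4_sum_right: "cl4 \<gamma> (\<lambda>i j k l. \<Sum>a\<in>A. w a i j k l) = (\<Sum>a\<in>A. cl4 \<gamma> (w a))"
  by (induction A rule: infinite_finite_induct) (simp_all add: cl4_add, simp_all add: cl4_def)

lemma sum_gamma_cl2: "(\<Sum>a\<in>UNIV. \<gamma> a * cl2 \<gamma> (t a)) = 3 *\<^sub>R cl3 \<gamma> t"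
  by (simp add: cl2_def cl3_def sum_distrib_left mult.assoc flip: scaleR_sum_right)

lemma cl2_slot2:
  assumes "skew3 t"
  shows "(\<Sum>i\<in>UNIV. \<Sum>j\<in>UNIV. t i b j *\<^sub>R (\<gamma> i * \<gamma> j)) = - 2 *\<^sub>R cl2 \<gamma> (t b)"
proof -
  have "t i b j = - t b i j" for i j by (rule skew3D[OF assms])
  then show ?thesis by (simp add: sum_negf double_sum_eq_cl2)
qed

text \<open>The pointwise identities below use only the Clifford relations, so they are proved in an
  arbitrary real algebra.  Throughout, \<open>i\<close>, \<open>j\<close>, \<dots> number an orthonormal frame, forms are given by
  their components, \<open>t\<close> are the components of the torsion form, \<open>\<omega>\<^sub>a = cl2 \<gamma> (t a)\<close> is the Clifford action of \<open>e\<^sub>a \<lrcorner> T\<close>,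
  and \<open>S = \<Sum>\<^sub>a \<omega>\<^sub>a\<^sup>2\<close>.\<close>

locale clifford_family =
  fixes \<gamma> :: "'n::finite \<Rightarrow> 'r::real_algebra_1"
  assumes clifford: "\<gamma> i * \<gamma> j + \<gamma> j * \<gamma> i = (if i = j then - 2 *\<^sub>R 1 else 0)"
begin

lemma anticomm: "\<gamma> i * \<gamma> j = - (\<gamma> j * \<gamma> i) - (if i = j then 2 *\<^sub>R 1 else 0)"
proof -
  have "\<gamma> i * \<gamma> j = (if i = j then - 2 *\<^sub>R 1 else 0) - \<gamma> j * \<gamma> i"
    by (subst clifford[of i j, symmetric]) simp
  then show ?thesis
    by simp
qed

lemma anticomm_left: "\<gamma> i * (\<gamma> j * x) = - (\<gamma> j * (\<gamma> i * x)) - (if i = j then 2 *\<^sub>R x else 0)"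
proof -
  have "\<gamma> i * (\<gamma> j * x) = (- (\<gamma> j * \<gamma> i) - (if i = j then 2 *\<^sub>R 1 else 0)) * x"
    by (subst anticomm[symmetric]) (simp only: mult.assoc)
  then show ?thesis
    by (simp add: left_diff_distrib mult.assoc)
qed

text \<open>Symmetrising \<open>\<gamma>\<^sub>i\<gamma>\<^sub>j\<close> with the Clifford relation leaves only the trace of \<open>s\<close>.\<close>

lemma symmetric_contraction:
  assumes "\<And>i j. s i j = s j i"
  shows "(\<Sum>i\<in>UNIV. \<Sum>j\<in>UNIV. s i j *\<^sub>R (\<gamma> i * \<gamma> j)) = - (\<Sum>i\<in>UNIV. s i i) *\<^sub>R 1" (is "?X = _")
proof -
  have "?X = (\<Sum>j\<in>UNIV. \<Sum>i\<in>UNIV. s i j *\<^sub>R (\<gamma> i * \<gamma> j))"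
    by (rule sum.swap)
  also have "\<dots> = (\<Sum>i\<in>UNIV. \<Sum>j\<in>UNIV. s i j *\<^sub>R (\<gamma> j * \<gamma> i))"
    by (simp only: assms)
  finally have "?X + ?X = (\<Sum>i\<in>UNIV. \<Sum>j\<in>UNIV. s i j *\<^sub>R (\<gamma> i * \<gamma> j + \<gamma> j * \<gamma> i))"
    by (simp add: sum.distrib scaleR_add_right)
  also have "\<dots> = (\<Sum>i\<in>UNIV. s i i *\<^sub>R (- 2 *\<^sub>R 1))"
    unfolding clifford by (simp add: delta_simps)
  also have "\<dots> = 2 *\<^sub>R (- (\<Sum>i\<in>UNIV. s i i) *\<^sub>R 1)"
    by (simp add: scaleR_sum_left sum_negf scaleR_sum_right mult.commute)
  finally have "2 *\<^sub>R ?X = 2 *\<^sub>R (- (\<Sum>i\<in>UNIV. s i i) *\<^sub>R 1)"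
    by (simp only: scaleR_2[symmetric])
  then show ?thesis
    by (simp only: scaleR_cancel_left) simp
qed

text \<open>The Lie algebra of the spin group acts on vectors by commutators: \<open>cl2 \<gamma> a\<close> sends \<open>e\<^sub>b\<close> to
  \<open>2 \<Sum>\<^sub>c a\<^sub>b\<^sub>c e\<^sub>c\<close>.  The two lemmas that follow extend the action to two-forms,
  where it is the Lie bracket, and to three-forms.\<close>

lemma comm_cl2:
  assumes "skew a"
  shows "cl2 \<gamma> a * \<gamma> b = \<gamma> b * cl2 \<gamma> a + 2 *\<^sub>R (\<Sum>c\<in>UNIV. a b c *\<^sub>R \<gamma> c)"
proof -
  have p: "\<gamma> i * \<gamma> j * \<gamma> b - \<gamma> b * (\<gamma> i * \<gamma> j) = (if i = b then 2 *\<^sub>R \<gamma> j else 0) - (if j = b then 2 *\<^sub>R \<gamma> i else 0)" for i j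
  proof -
    have "\<gamma> i * \<gamma> j * \<gamma> b = - (\<gamma> i * (\<gamma> b * \<gamma> j)) - (if j = b then 2 *\<^sub>R \<gamma> i else 0)"
      by (simp add: mult.assoc anticomm[of j b] right_diff_distrib)
    also have "\<gamma> i * (\<gamma> b * \<gamma> j) = - (\<gamma> b * (\<gamma> i * \<gamma> j)) - (if i = b then 2 *\<^sub>R \<gamma> j else 0)"
      by (rule anticomm_left)
    finally show ?thesis
      by simp
  qed
  have "cl2 \<gamma> a * \<gamma> b - \<gamma> b * cl2 \<gamma> a =
     (1/2) *\<^sub>R (\<Sum>i\<in>UNIV. \<Sum>j\<in>UNIV. a i j *\<^sub>R (\<gamma> i * \<gamma> j * \<gamma> b - \<gamma> b * (\<gamma> i * \<gamma> j)))"
    by (simp add: cl2_def sum_distrib_left sum_distrib_right sum_subtractf scaleR_diff_right)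
  also have "\<dots> = (\<Sum>j\<in>UNIV. a b j *\<^sub>R \<gamma> j) - (\<Sum>i\<in>UNIV. a i b *\<^sub>R \<gamma> i)"
    unfolding p
    by (simp add: scaleR_diff_right sum_subtractf delta_simps scaleR_sum_right)
  also have "\<dots> = 2 *\<^sub>R (\<Sum>c\<in>UNIV. a b c *\<^sub>R \<gamma> c)"
    by (subst skewD[OF assms, of _ b]) (simp add: sum_negf scaleR_2)
  finally show ?thesis by (simp add: algebra_simps)
qed

lemma cl2_commutator:
  assumes m: "skew m" and m': "skew m'"
  shows "cl2 \<gamma> m * cl2 \<gamma> m' - cl2 \<gamma> m' * cl2 \<gamma> m =
    2 *\<^sub>R cl2 \<gamma> (\<lambda>i j. \<Sum>k\<in>UNIV. m i k * m' j k - m' i k * m j k)"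
proof -
  let ?w = "cl2 \<gamma> m"
  have p: "?w * (\<gamma> k * \<gamma> l) - \<gamma> k * \<gamma> l * ?w =
      2 *\<^sub>R (\<Sum>c\<in>UNIV. m k c *\<^sub>R (\<gamma> c * \<gamma> l)) + 2 *\<^sub>R (\<Sum>c\<in>UNIV. m l c *\<^sub>R (\<gamma> k * \<gamma> c))" for k l
  proof -
    have "?w * (\<gamma> k * \<gamma> l) = \<gamma> k * (?w * \<gamma> l) + 2 *\<^sub>R (\<Sum>c\<in>UNIV. m k c *\<^sub>R (\<gamma> c * \<gamma> l))"
      by (simp add: comm_cl2[OF m, of k] distrib_right sum_distrib_right mult.assoc flip: mult.assoc[of ?w])
    also have "\<gamma> k * (?w * \<gamma> l) = \<gamma> k * \<gamma> l * ?w + 2 *\<^sub>R (\<Sum>c\<in>UNIV. m l c *\<^sub>R (\<gamma> k * \<gamma> c))"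
      by (simp add: comm_cl2[OF m] distrib_left sum_distrib_left mult.assoc)
    finally show ?thesis by simp
  qed
  have "?w * cl2 \<gamma> m' - cl2 \<gamma> m' * ?w =
      (1/2) *\<^sub>R (\<Sum>k\<in>UNIV. \<Sum>l\<in>UNIV. m' k l *\<^sub>R (?w * (\<gamma> k * \<gamma> l) - \<gamma> k * \<gamma> l * ?w))"
    by (simp add: cl2_def[of \<gamma> m'] sum_distrib_left sum_distrib_right sum_subtractf scaleR_diff_right)
  also have "\<dots> = (\<Sum>k\<in>UNIV. \<Sum>l\<in>UNIV. \<Sum>c\<in>UNIV. (m' k l * m k c) *\<^sub>R (\<gamma> c * \<gamma> l))
      + (\<Sum>k\<in>UNIV. \<Sum>l\<in>UNIV. \<Sum>c\<in>UNIV. (m' k l * m l c) *\<^sub>R (\<gamma> k * \<gamma> c))"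
    unfolding p
    by (simp add: scaleR_add_right sum.distrib scaleR_sum_right)
  also have "(\<Sum>k\<in>UNIV. \<Sum>l\<in>UNIV. \<Sum>c\<in>UNIV. (m' k l * m k c) *\<^sub>R (\<gamma> c * \<gamma> l)) =
      (\<Sum>c\<in>UNIV. \<Sum>l\<in>UNIV. \<Sum>k\<in>UNIV. (m c k * m' l k) *\<^sub>R (\<gamma> c * \<gamma> l))"
  proof -
    have eq: "m' k l * m k c = m c k * m' l k" for k l c
      by (simp add: skewD[OF m, of k c] skewD[OF m', of k l])
    have "(\<Sum>k\<in>UNIV. \<Sum>l\<in>UNIV. \<Sum>c\<in>UNIV. (m' k l * m k c) *\<^sub>R (\<gamma> c * \<gamma> l)) =
      (\<Sum>c\<in>UNIV. \<Sum>k\<in>UNIV. \<Sum>l\<in>UNIV. (m' k l * m k c) *\<^sub>R (\<gamma> c * \<gamma> l))"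
      by (rule sum_swap3)
    also have "\<dots> = (\<Sum>c\<in>UNIV. \<Sum>l\<in>UNIV. \<Sum>k\<in>UNIV. (m' k l * m k c) *\<^sub>R (\<gamma> c * \<gamma> l))"
      by (intro sum.cong refl sum.swap)
    finally show ?thesis
      by (simp only: eq)
  qed
  also have "(\<Sum>k\<in>UNIV. \<Sum>l\<in>UNIV. \<Sum>c\<in>UNIV. (m' k l * m l c) *\<^sub>R (\<gamma> k * \<gamma> c)) =
      - (\<Sum>k\<in>UNIV. \<Sum>c\<in>UNIV. \<Sum>l\<in>UNIV. (m' k l * m c l) *\<^sub>R (\<gamma> k * \<gamma> c))"
  proof -
    have eq: "m' k l * m l c = - (m' k l * m c l)" for k l c
      by (simp add: skewD[OF m, of l c])
    have "(\<Sum>k\<in>UNIV. \<Sum>l\<in>UNIV. \<Sum>c\<in>UNIV. (m' k l * m l c) *\<^sub>R (\<gamma> k * \<gamma> c)) =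
        (\<Sum>k\<in>UNIV. \<Sum>c\<in>UNIV. \<Sum>l\<in>UNIV. (m' k l * m l c) *\<^sub>R (\<gamma> k * \<gamma> c))"
      by (intro sum.cong refl sum.swap)
    then show ?thesis
      by (simp only: eq scaleR_minus_left sum_negf)
  qed
  finally show ?thesis
    by (simp add: cl2_def sum_subtractf scaleR_diff_left scaleR_diff_right scaleR_sum_left)
qed

lemma cl2_cl3_commutator:
  assumes a: "skew a"
  shows "cl2 \<gamma> a * cl3 \<gamma> t = cl3 \<gamma> t * cl2 \<gamma> a
    - 2 *\<^sub>R cl3 \<gamma> (\<lambda>i j k. \<Sum>c\<in>UNIV. a i c * t c j k + a j c * t i c k + a k c * t i j c)"
proof -
  let ?w = "cl2 \<gamma> a"
  let ?g = "\<lambda>i j k. \<gamma> i * \<gamma> j * \<gamma> k"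
  have p: "?w * ?g i j k - ?g i j k * ?w = 2 *\<^sub>R ((\<Sum>c\<in>UNIV. a i c *\<^sub>R ?g c j k)
      + (\<Sum>c\<in>UNIV. a j c *\<^sub>R ?g i c k) + (\<Sum>c\<in>UNIV. a k c *\<^sub>R ?g i j c))" for i j k
  proof -
    let ?v = "\<lambda>i. \<Sum>c\<in>UNIV. a i c *\<^sub>R \<gamma> c"
    have "?w * ?g i j k = ((?w * \<gamma> i) * \<gamma> j) * \<gamma> k"
      by (simp only: mult.assoc)
    also have "\<dots> = \<gamma> i * ((?w * \<gamma> j) * \<gamma> k) + 2 *\<^sub>R (?v i * \<gamma> j * \<gamma> k)"
      by (simp add: comm_cl2[OF a, of i] distrib_right mult.assoc)
    also have "\<gamma> i * ((?w * \<gamma> j) * \<gamma> k) = \<gamma> i * \<gamma> j * (?w * \<gamma> k) + 2 *\<^sub>R (\<gamma> i * ?v j * \<gamma> k)"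
      by (simp add: comm_cl2[OF a, of j] distrib_right distrib_left mult.assoc)
    also have "\<gamma> i * \<gamma> j * (?w * \<gamma> k) = ?g i j k * ?w + 2 *\<^sub>R (\<gamma> i * \<gamma> j * ?v k)"
      by (simp add: comm_cl2[OF a, of k] distrib_left mult.assoc)
    finally show ?thesis
      by (simp add: sum_distrib_left sum_distrib_right scaleR_add_right)
  qed
  have "?w * cl3 \<gamma> t - cl3 \<gamma> t * ?w =
      (1/6) *\<^sub>R (\<Sum>i\<in>UNIV. \<Sum>j\<in>UNIV. \<Sum>k\<in>UNIV. t i j k *\<^sub>R (?w * ?g i j k - ?g i j k * ?w))"
    by (simp add: cl3_def sum_distrib_left sum_distrib_right sum_subtractf scaleR_diff_right)
  also have "\<dots> = (1/3) *\<^sub>R (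
      (\<Sum>i\<in>UNIV. \<Sum>j\<in>UNIV. \<Sum>k\<in>UNIV. \<Sum>c\<in>UNIV. (t i j k * a i c) *\<^sub>R ?g c j k) +
      (\<Sum>i\<in>UNIV. \<Sum>j\<in>UNIV. \<Sum>k\<in>UNIV. \<Sum>c\<in>UNIV. (t i j k * a j c) *\<^sub>R ?g i c k) +
      (\<Sum>i\<in>UNIV. \<Sum>j\<in>UNIV. \<Sum>k\<in>UNIV. \<Sum>c\<in>UNIV. (t i j k * a k c) *\<^sub>R ?g i j c))"
    unfolding p by (simp add: scaleR_add_right sum.distrib scaleR_sum_right mult.commute)
  also have "(\<Sum>i\<in>UNIV. \<Sum>j\<in>UNIV. \<Sum>k\<in>UNIV. \<Sum>c\<in>UNIV. (t i j k * a i c) *\<^sub>R ?g c j k) =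
      - (\<Sum>i\<in>UNIV. \<Sum>j\<in>UNIV. \<Sum>k\<in>UNIV. \<Sum>c\<in>UNIV. (a i c * t c j k) *\<^sub>R ?g i j k)"
  proof -
    have "(\<Sum>i\<in>UNIV. \<Sum>j\<in>UNIV. \<Sum>k\<in>UNIV. \<Sum>c\<in>UNIV. (t i j k * a i c) *\<^sub>R ?g c j k) =
        (\<Sum>c\<in>UNIV. \<Sum>i\<in>UNIV. \<Sum>j\<in>UNIV. \<Sum>k\<in>UNIV. (t i j k * a i c) *\<^sub>R ?g c j k)"
      by (rule sum_swap4)
    also have "\<dots> = (\<Sum>c\<in>UNIV. \<Sum>j\<in>UNIV. \<Sum>k\<in>UNIV. \<Sum>i\<in>UNIV. (t i j k * a i c) *\<^sub>R ?g c j k)"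
      by (intro sum.cong refl sum_swap3[symmetric])
    also have "\<dots> = (\<Sum>c\<in>UNIV. \<Sum>j\<in>UNIV. \<Sum>k\<in>UNIV. \<Sum>i\<in>UNIV. - ((a c i * t i j k) *\<^sub>R ?g c j k))"
      by (intro sum.cong refl) (subst skewD[OF a], simp)
    finally show ?thesis by (simp only: sum_negf)
  qed
  also have "(\<Sum>i\<in>UNIV. \<Sum>j\<in>UNIV. \<Sum>k\<in>UNIV. \<Sum>c\<in>UNIV. (t i j k * a j c) *\<^sub>R ?g i c k) =
      - (\<Sum>i\<in>UNIV. \<Sum>j\<in>UNIV. \<Sum>k\<in>UNIV. \<Sum>c\<in>UNIV. (a j c * t i c k) *\<^sub>R ?g i j k)"
  proof -
    have "(\<Sum>i\<in>UNIV. \<Sum>j\<in>UNIV. \<Sum>k\<in>UNIV. \<Sum>c\<in>UNIV. (t i j k * a j c) *\<^sub>R ?g i c k) =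
        (\<Sum>i\<in>UNIV. \<Sum>c\<in>UNIV. \<Sum>j\<in>UNIV. \<Sum>k\<in>UNIV. (t i j k * a j c) *\<^sub>R ?g i c k)"
      by (intro sum.cong refl sum_swap3)
    also have "\<dots> = (\<Sum>i\<in>UNIV. \<Sum>c\<in>UNIV. \<Sum>k\<in>UNIV. \<Sum>j\<in>UNIV. (t i j k * a j c) *\<^sub>R ?g i c k)"
      by (rule sum.cong[OF refl], rule sum.cong[OF refl], rule sum.swap)
    also have "\<dots> = (\<Sum>i\<in>UNIV. \<Sum>c\<in>UNIV. \<Sum>k\<in>UNIV. \<Sum>j\<in>UNIV. - ((a c j * t i j k) *\<^sub>R ?g i c k))"
      by (intro sum.cong refl) (subst skewD[OF a], simp)
    finally show ?thesis by (simp only: sum_negf)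
  qed
  also have "(\<Sum>i\<in>UNIV. \<Sum>j\<in>UNIV. \<Sum>k\<in>UNIV. \<Sum>c\<in>UNIV. (t i j k * a k c) *\<^sub>R ?g i j c) =
      - (\<Sum>i\<in>UNIV. \<Sum>j\<in>UNIV. \<Sum>k\<in>UNIV. \<Sum>c\<in>UNIV. (a k c * t i j c) *\<^sub>R ?g i j k)"
  proof -
    have "(\<Sum>i\<in>UNIV. \<Sum>j\<in>UNIV. \<Sum>k\<in>UNIV. \<Sum>c\<in>UNIV. (t i j k * a k c) *\<^sub>R ?g i j c) =
        (\<Sum>i\<in>UNIV. \<Sum>j\<in>UNIV. \<Sum>c\<in>UNIV. \<Sum>k\<in>UNIV. (t i j k * a k c) *\<^sub>R ?g i j c)"
      by (rule sum.cong[OF refl], rule sum.cong[OF refl], rule sum.swap)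
    also have "\<dots> = (\<Sum>i\<in>UNIV. \<Sum>j\<in>UNIV. \<Sum>c\<in>UNIV. \<Sum>k\<in>UNIV. - ((a c k * t i j k) *\<^sub>R ?g i j c))"
      by (intro sum.cong refl) (subst skewD[OF a], simp)
    finally show ?thesis by (simp only: sum_negf)
  qed
  finally have eq: "?w * cl3 \<gamma> t - cl3 \<gamma> t * ?w = (1/3) *\<^sub>R (
      - (\<Sum>i\<in>UNIV. \<Sum>j\<in>UNIV. \<Sum>k\<in>UNIV. \<Sum>c\<in>UNIV. (a i c * t c j k) *\<^sub>R ?g i j k) +
      - (\<Sum>i\<in>UNIV. \<Sum>j\<in>UNIV. \<Sum>k\<in>UNIV. \<Sum>c\<in>UNIV. (a j c * t i c k) *\<^sub>R ?g i j k) +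
      - (\<Sum>i\<in>UNIV. \<Sum>j\<in>UNIV. \<Sum>k\<in>UNIV. \<Sum>c\<in>UNIV. (a k c * t i j c) *\<^sub>R ?g i j k))" .
  have "6 *\<^sub>R cl3 \<gamma> (\<lambda>i j k. \<Sum>c\<in>UNIV. a i c * t c j k + a j c * t i c k + a k c * t i j c) =
      (\<Sum>i\<in>UNIV. \<Sum>j\<in>UNIV. \<Sum>k\<in>UNIV. \<Sum>c\<in>UNIV. (a i c * t c j k) *\<^sub>R ?g i j k) +
      (\<Sum>i\<in>UNIV. \<Sum>j\<in>UNIV. \<Sum>k\<in>UNIV. \<Sum>c\<in>UNIV. (a j c * t i c k) *\<^sub>R ?g i j k) +
      (\<Sum>i\<in>UNIV. \<Sum>j\<in>UNIV. \<Sum>k\<in>UNIV. \<Sum>c\<in>UNIV. (a k c * t i j c) *\<^sub>R ?g i j k)" (is "6 *\<^sub>R ?C = ?A + ?B + ?D")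
    unfolding triple_sum_eq_cl3[symmetric] by (simp add: scaleR_sum_left scaleR_add_left sum.distrib)
  note sums = this
  have "?w * cl3 \<gamma> t - cl3 \<gamma> t * ?w = (1/3) *\<^sub>R - (6 *\<^sub>R ?C)"
    unfolding eq sums by (simp only: minus_add_distrib)
  also have "\<dots> = - (2 *\<^sub>R ?C)"
    by simp
  finally have "?w * cl3 \<gamma> t = - (2 *\<^sub>R ?C) + cl3 \<gamma> t * ?w"
    by (simp only: diff_eq_eq)
  then show ?thesis
    by (simp only: uminus_add_conv_diff)
qed

text \<open>Clifford's rule for moving a vector past a form, \<open>\<gamma>\<^sub>b T + T \<gamma>\<^sub>b = -2 (e\<^sub>b \<lrcorner> T)\<close>.  It follows
  by writing \<open>3T = \<Sum>\<^sub>a \<gamma>\<^sub>a \<omega>\<^sub>a\<close> and moving \<open>\<gamma>\<^sub>b\<close> first past \<open>\<omega>\<^sub>a\<close> and then past \<open>\<gamma>\<^sub>a\<close>.\<close>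

lemma cl3_anticomm:
  assumes t: "skew3 t"
  shows "cl3 \<gamma> t * \<gamma> b = - (\<gamma> b * cl3 \<gamma> t) - 2 *\<^sub>R cl2 \<gamma> (t b)"
proof -
  have "3 *\<^sub>R (cl3 \<gamma> t * \<gamma> b) = (\<Sum>a\<in>UNIV. \<gamma> a * (cl2 \<gamma> (t a) * \<gamma> b))"
    by (simp add: sum_distrib_right mult.assoc flip: sum_gamma_cl2 scaleR_scaleR mult_scaleR_left)
  also have "\<dots> = (\<Sum>a\<in>UNIV. \<gamma> a * (\<gamma> b * cl2 \<gamma> (t a)))
      + 2 *\<^sub>R (\<Sum>a\<in>UNIV. \<Sum>c\<in>UNIV. t a b c *\<^sub>R (\<gamma> a * \<gamma> c))"
    by (simp add: comm_cl2[OF skew3_skew[OF t]] distrib_left sum.distrib sum_distrib_left scaleR_sum_right)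
  also have "(\<Sum>a\<in>UNIV. \<gamma> a * (\<gamma> b * cl2 \<gamma> (t a))) = - (\<gamma> b * (3 *\<^sub>R cl3 \<gamma> t)) - 2 *\<^sub>R cl2 \<gamma> (t b)"
    unfolding anticomm_left[of _ b]
    by (simp only: sum_subtractf sum_negf sum_gamma_cl2[symmetric] sum_distrib_left) simp
  also have "(\<Sum>a\<in>UNIV. \<Sum>c\<in>UNIV. t a b c *\<^sub>R (\<gamma> a * \<gamma> c)) = - 2 *\<^sub>R cl2 \<gamma> (t b)"
    by (rule cl2_slot2[OF t])
  finally have eq: "3 *\<^sub>R (cl3 \<gamma> t * \<gamma> b) =
      - (\<gamma> b * (3 *\<^sub>R cl3 \<gamma> t)) - 2 *\<^sub>R cl2 \<gamma> (t b) + 2 *\<^sub>R (- 2 *\<^sub>R cl2 \<gamma> (t b))" .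
  show ?thesis
  proof (rule eq_by_functionals)
    fix f :: "'r \<Rightarrow> real" assume "linear f"
    then show "f (cl3 \<gamma> t * \<gamma> b) = f (- (\<gamma> b * cl3 \<gamma> t) - 2 *\<^sub>R cl2 \<gamma> (t b))"
      using arg_cong[OF eq, of f] by (simp add: functional)
  qed
qed

text \<open>The exterior derivative inserts an additional factor \<open>\<gamma>\<^sub>a\<close> at each of the four positions of a product
  \<open>\<gamma>\<^sub>j\<gamma>\<^sub>k\<gamma>\<^sub>l\<close>.  Moving it to the front costs a contraction for every factor that it passes, and the
  coefficients \<open>4\<close>, \<open>8\<close>, \<open>12\<close> of \<open>cl2 \<gamma> (d a)\<close> count them up to sign.\<close>

lemma insert_gamma_second:
  assumes d: "skew3 d"
  shows "(\<Sum>j\<in>UNIV. \<Sum>k\<in>UNIV. \<Sum>l\<in>UNIV. d j k l *\<^sub>R (\<gamma> j * \<gamma> a * \<gamma> k * \<gamma> l)) =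
    - 6 *\<^sub>R (\<gamma> a * cl3 \<gamma> d) - 4 *\<^sub>R cl2 \<gamma> (d a)" (is "?L = _")
proof -
  have "\<gamma> j * \<gamma> a * \<gamma> k * \<gamma> l = - (\<gamma> a * (\<gamma> j * \<gamma> k * \<gamma> l)) - (if j = a then 2 *\<^sub>R (\<gamma> k * \<gamma> l) else 0)" for j k l
    by (simp only: mult.assoc) (rule anticomm_left)
  then have "?L = - (\<gamma> a * (6 *\<^sub>R cl3 \<gamma> d)) - 2 *\<^sub>R (2 *\<^sub>R cl2 \<gamma> (d a))"
    by (simp add: scaleR_diff_right sum_subtractf sum_negf delta_simps scaleR_sum_right sum_distrib_left
        mult.commute flip: triple_sum_eq_cl3 double_sum_eq_cl2)
  then show ?thesis by simp
qed

lemma insert_gamma_third: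
  assumes d: "skew3 d"
  shows "(\<Sum>j\<in>UNIV. \<Sum>k\<in>UNIV. \<Sum>l\<in>UNIV. d j k l *\<^sub>R (\<gamma> j * \<gamma> k * \<gamma> a * \<gamma> l)) =
    6 *\<^sub>R (\<gamma> a * cl3 \<gamma> d) + 8 *\<^sub>R cl2 \<gamma> (d a)" (is "?L = _")
proof -
  have "\<gamma> j * \<gamma> k * \<gamma> a * \<gamma> l = - (\<gamma> j * \<gamma> a * \<gamma> k * \<gamma> l) - (if k = a then 2 *\<^sub>R (\<gamma> j * \<gamma> l) else 0)" for j k l
    by (simp add: mult.assoc anticomm_left[of k a] right_diff_distrib delta_simps)
  then have eq: "?L = - (- 6 *\<^sub>R (\<gamma> a * cl3 \<gamma> d) - 4 *\<^sub>R cl2 \<gamma> (d a)) - 2 *\<^sub>R (- 2 *\<^sub>R cl2 \<gamma> (d a))"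
    unfolding insert_gamma_second[OF d, symmetric] cl2_slot2[OF d, symmetric]
    by (simp add: scaleR_diff_right sum_subtractf sum_negf delta_simps scaleR_sum_right mult.commute)
  show ?thesis
  proof (rule eq_by_functionals)
    fix f :: "'r \<Rightarrow> real" assume "linear f"
    then show "f ?L = f (6 *\<^sub>R (\<gamma> a * cl3 \<gamma> d) + 8 *\<^sub>R cl2 \<gamma> (d a))"
      using arg_cong[OF eq, of f] by (simp add: functional)
  qed
qed

lemma insert_gamma_fourth:
  assumes d: "skew3 d"
  shows "(\<Sum>j\<in>UNIV. \<Sum>k\<in>UNIV. \<Sum>l\<in>UNIV. d j k l *\<^sub>R (\<gamma> j * \<gamma> k * \<gamma> l * \<gamma> a)) =
    - 6 *\<^sub>R (\<gamma> a * cl3 \<gamma> d) - 12 *\<^sub>R cl2 \<gamma> (d a)" (is "?L = _")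
proof -
  have "?L = 6 *\<^sub>R cl3 \<gamma> d * \<gamma> a"
    by (simp only: triple_sum_eq_cl3[symmetric] sum_distrib_right mult_scaleR_left)
  then show ?thesis
    by (simp add: cl3_anticomm[OF d] scaleR_diff_right)
qed

text \<open>The rule \<open>e\<^sub>a \<cdot> D\<^sub>a = e\<^sub>a \<and> D\<^sub>a - e\<^sub>a \<lrcorner> D\<^sub>a\<close>, summed over \<open>a\<close>.  For \<open>D\<^sub>a = \<nabla>\<^sub>a T\<close> it says that
  the Dirac symbol applied to \<open>\<nabla>T\<close> gives \<open>dT + \<delta>T\<close>.\<close>

lemma sum_cl3_eq_cl4_cl2:
  assumes D: "\<And>a. skew3 (D a)"
  shows "(\<Sum>a\<in>UNIV. \<gamma> a * cl3 \<gamma> (D a)) =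
    cl4 \<gamma> (\<lambda>i j k l. D i j k l - D j i k l + D k i j l - D l i j k)
    - (\<Sum>a\<in>UNIV. cl2 \<gamma> (D a a))"
proof -
  let ?g = "\<lambda>i j k l. \<gamma> i * \<gamma> j * \<gamma> k * \<gamma> l"
  have 1: "(\<Sum>i\<in>UNIV. \<Sum>j\<in>UNIV. \<Sum>k\<in>UNIV. \<Sum>l\<in>UNIV. D i j k l *\<^sub>R ?g i j k l) =
      (\<Sum>a\<in>UNIV. 6 *\<^sub>R (\<gamma> a * cl3 \<gamma> (D a)))"
    by (simp add: sum_distrib_left mult.assoc flip: triple_sum_eq_cl3 mult_scaleR_right)
  have 2: "(\<Sum>i\<in>UNIV. \<Sum>j\<in>UNIV. \<Sum>k\<in>UNIV. \<Sum>l\<in>UNIV. D j i k l *\<^sub>R ?g i j k l) =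
      (\<Sum>a\<in>UNIV. - 6 *\<^sub>R (\<gamma> a * cl3 \<gamma> (D a)) - 4 *\<^sub>R cl2 \<gamma> (D a a))"
    by (subst sum.swap, subst insert_gamma_second[OF D], rule refl)
  have 3: "(\<Sum>i\<in>UNIV. \<Sum>j\<in>UNIV. \<Sum>k\<in>UNIV. \<Sum>l\<in>UNIV. D k i j l *\<^sub>R ?g i j k l) =
      (\<Sum>a\<in>UNIV. 6 *\<^sub>R (\<gamma> a * cl3 \<gamma> (D a)) + 8 *\<^sub>R cl2 \<gamma> (D a a))"
    by (subst sum_swap3, subst insert_gamma_third[OF D], rule refl)
  have 4: "(\<Sum>i\<in>UNIV. \<Sum>j\<in>UNIV. \<Sum>k\<in>UNIV. \<Sum>l\<in>UNIV. D l i j k *\<^sub>R ?g i j k l) =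
      (\<Sum>a\<in>UNIV. - 6 *\<^sub>R (\<gamma> a * cl3 \<gamma> (D a)) - 12 *\<^sub>R cl2 \<gamma> (D a a))"
    by (subst sum_swap4, subst insert_gamma_fourth[OF D], rule refl)
  have "24 *\<^sub>R cl4 \<gamma> (\<lambda>i j k l. D i j k l - D j i k l + D k i j l - D l i j k) =
      24 *\<^sub>R ((\<Sum>a\<in>UNIV. \<gamma> a * cl3 \<gamma> (D a)) + (\<Sum>a\<in>UNIV. cl2 \<gamma> (D a a)))" (is "?L = ?R")
  proof (rule eq_by_functionals)
    fix f :: "'r \<Rightarrow> real" assume f: "linear f"
    show "f ?L = f ?R"
      unfolding quadruple_sum_eq_cl4[symmetric] scaleR_add_left scaleR_diff_left sum.distrib sum_subtractf 1 2 3 4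
      by (simp add: functional[OF f] linear_sum[OF f] sum.distrib sum_subtractf sum_negf algebra_simps
          flip: sum_distrib_left)
  qed
  then show ?thesis
    by simp
qed

text \<open>For a two-form \<open>\<alpha>\<close>, the tensor \<open>\<alpha> \<otimes> \<alpha>\<close> can be contracted with a product of four gammas in three
  essentially different ways, depending on which pairs of positions carry the two copies of \<open>\<alpha>\<close>.
  All three reduce to \<open>(cl2 \<gamma> \<alpha>)\<^sup>2\<close> and the scalar \<open>norm_sq\<close>, which is twice the usual squared norm of \<open>\<alpha>\<close>.\<close>

context
  fixes \<alpha> :: "'n \<Rightarrow> 'n \<Rightarrow> real"
  assumes sk: "skew \<alpha>"
begin

abbreviation "norm_sq \<equiv> (\<Sum>i\<in>UNIV. \<Sum>j\<in>UNIV. (\<alpha> i j)\<^sup>2)"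

text \<open>The contracted tensor \<open>\<Sum>\<^sub>j \<alpha>\<^sub>i\<^sub>j \<alpha>\<^sub>j\<^sub>l\<close> is symmetric, so only its trace survives.\<close>

lemma inner_contraction:
  "(\<Sum>i\<in>UNIV. \<Sum>l\<in>UNIV. (\<Sum>j\<in>UNIV. \<alpha> i j * \<alpha> j l) *\<^sub>R (\<gamma> i * \<gamma> l)) = norm_sq *\<^sub>R 1"
proof -
  have "\<alpha> i j * \<alpha> j l = \<alpha> l j * \<alpha> j i" for i j l
    by (simp add: skewD[OF sk, of i j] skewD[OF sk, of j l])
  then have "(\<Sum>i\<in>UNIV. \<Sum>l\<in>UNIV. (\<Sum>j\<in>UNIV. \<alpha> i j * \<alpha> j l) *\<^sub>R (\<gamma> i * \<gamma> l)) =
      - (\<Sum>i\<in>UNIV. \<Sum>j\<in>UNIV. \<alpha> i j * \<alpha> j i) *\<^sub>R 1"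
    by (intro symmetric_contraction) simp
  moreover have "\<alpha> i j * \<alpha> j i = - (\<alpha> i j)\<^sup>2" for i j
    by (simp add: skewD[OF sk, of j i] power2_eq_square)
  ultimately show ?thesis
    by (simp add: sum_negf)
qed

lemma pairs_adjacent:
  "(\<Sum>i\<in>UNIV. \<Sum>j\<in>UNIV. \<Sum>k\<in>UNIV. \<Sum>l\<in>UNIV. (\<alpha> i j * \<alpha> k l) *\<^sub>R (\<gamma> i * \<gamma> j * \<gamma> k * \<gamma> l)) =
    4 *\<^sub>R (cl2 \<gamma> \<alpha> * cl2 \<gamma> \<alpha>)" (is "?L = _")
proof -
  have "?L = (2 *\<^sub>R cl2 \<gamma> \<alpha>) * (2 *\<^sub>R cl2 \<gamma> \<alpha>)"
    unfolding double_sum_eq_cl2[symmetric] sum_distrib_right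
    by (simp add: sum_distrib_left mult.assoc) (simp add: mult.commute)
  then show ?thesis
    by simp
qed

lemma pairs_crossed:
  "(\<Sum>i\<in>UNIV. \<Sum>j\<in>UNIV. \<Sum>k\<in>UNIV. \<Sum>l\<in>UNIV. (\<alpha> i k * \<alpha> j l) *\<^sub>R (\<gamma> i * \<gamma> j * \<gamma> k * \<gamma> l)) =
    - 4 *\<^sub>R (cl2 \<gamma> \<alpha> * cl2 \<gamma> \<alpha>) - (2 * norm_sq) *\<^sub>R 1" (is "?L = _")
proof -
  have p: "\<gamma> i * \<gamma> k * \<gamma> j * \<gamma> l = - (\<gamma> i * \<gamma> j * \<gamma> k * \<gamma> l) - (if k = j then 2 *\<^sub>R (\<gamma> i * \<gamma> l) else 0)" for i j k l
    by (simp add: mult.assoc anticomm_left[of k j] right_diff_distrib delta_simps)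
  have "?L = (\<Sum>i\<in>UNIV. \<Sum>j\<in>UNIV. \<Sum>k\<in>UNIV. \<Sum>l\<in>UNIV. (\<alpha> i j * \<alpha> k l) *\<^sub>R (\<gamma> i * \<gamma> k * \<gamma> j * \<gamma> l))"
    by (intro sum.cong refl sum.swap)
  also have "\<dots> = (\<Sum>i\<in>UNIV. \<Sum>j\<in>UNIV. \<Sum>k\<in>UNIV. \<Sum>l\<in>UNIV. (\<alpha> i j * \<alpha> k l) *\<^sub>R
      (- (\<gamma> i * \<gamma> j * \<gamma> k * \<gamma> l) - (if k = j then 2 *\<^sub>R (\<gamma> i * \<gamma> l) else 0)))"
    by (intro sum.cong refl) (subst p, rule refl)
  finally have "?L = - 4 *\<^sub>R (cl2 \<gamma> \<alpha> * cl2 \<gamma> \<alpha>) -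
      2 *\<^sub>R (\<Sum>i\<in>UNIV. \<Sum>j\<in>UNIV. \<Sum>l\<in>UNIV. (\<alpha> i j * \<alpha> j l) *\<^sub>R (\<gamma> i * \<gamma> l))"
    by (simp add: scaleR_diff_right sum_subtractf sum_negf delta_simps scaleR_sum_right mult.commute
        flip: pairs_adjacent)
  also have "(\<Sum>i\<in>UNIV. \<Sum>j\<in>UNIV. \<Sum>l\<in>UNIV. (\<alpha> i j * \<alpha> j l) *\<^sub>R (\<gamma> i * \<gamma> l)) = norm_sq *\<^sub>R 1"
    unfolding inner_contraction[symmetric] unfolding scaleR_sum_left
    by (intro sum.cong refl sum.swap)
  finally show ?thesis by simp
qed

lemma pairs_nested:
  "(\<Sum>i\<in>UNIV. \<Sum>j\<in>UNIV. \<Sum>k\<in>UNIV. \<Sum>l\<in>UNIV. (\<alpha> i l * \<alpha> j k) *\<^sub>R (\<gamma> i * \<gamma> j * \<gamma> k * \<gamma> l)) =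
    4 *\<^sub>R (cl2 \<gamma> \<alpha> * cl2 \<gamma> \<alpha>) + (4 * norm_sq) *\<^sub>R 1" (is "?L = _")
proof -
  have p: "\<gamma> i * \<gamma> j * \<gamma> k * \<gamma> l = - (\<gamma> i * \<gamma> j * \<gamma> l * \<gamma> k) - (if k = l then 2 *\<^sub>R (\<gamma> i * \<gamma> j) else 0)" for i j k l
    by (simp add: mult.assoc anticomm[of k l] right_diff_distrib delta_simps)
  have "?L = (\<Sum>i\<in>UNIV. \<Sum>j\<in>UNIV. \<Sum>k\<in>UNIV. \<Sum>l\<in>UNIV. (\<alpha> i l * \<alpha> j k) *\<^sub>R
      (- (\<gamma> i * \<gamma> j * \<gamma> l * \<gamma> k) - (if k = l then 2 *\<^sub>R (\<gamma> i * \<gamma> j) else 0)))"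
    by (intro sum.cong refl) (subst p, rule refl)
  also have "\<dots> = - (\<Sum>i\<in>UNIV. \<Sum>j\<in>UNIV. \<Sum>k\<in>UNIV. \<Sum>l\<in>UNIV. (\<alpha> i l * \<alpha> j k) *\<^sub>R (\<gamma> i * \<gamma> j * \<gamma> l * \<gamma> k))
      - 2 *\<^sub>R (\<Sum>i\<in>UNIV. \<Sum>j\<in>UNIV. \<Sum>k\<in>UNIV. (\<alpha> i k * \<alpha> j k) *\<^sub>R (\<gamma> i * \<gamma> j))"
    by (simp add: scaleR_diff_right sum_subtractf sum_negf delta_simps scaleR_sum_right mult.commute)
  also have "(\<Sum>i\<in>UNIV. \<Sum>j\<in>UNIV. \<Sum>k\<in>UNIV. \<Sum>l\<in>UNIV. (\<alpha> i l * \<alpha> j k) *\<^sub>R (\<gamma> i * \<gamma> j * \<gamma> l * \<gamma> k)) =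
      - 4 *\<^sub>R (cl2 \<gamma> \<alpha> * cl2 \<gamma> \<alpha>) - (2 * norm_sq) *\<^sub>R 1"
    unfolding pairs_crossed[symmetric]
    by (intro sum.cong refl sum.swap)
  also have "(\<Sum>i\<in>UNIV. \<Sum>j\<in>UNIV. \<Sum>k\<in>UNIV. (\<alpha> i k * \<alpha> j k) *\<^sub>R (\<gamma> i * \<gamma> j)) = - (norm_sq *\<^sub>R 1)"
  proof -
    have "\<alpha> i k * \<alpha> j k = - (\<alpha> i k * \<alpha> k j)" for i j k
      by (simp add: skewD[OF sk, of j k])
    then show ?thesis
      unfolding inner_contraction[symmetric] unfolding scaleR_sum_left
      by (simp only: scaleR_minus_left sum_negf)
  qed
  finally have eq: "?L = - (- 4 *\<^sub>R (cl2 \<gamma> \<alpha> * cl2 \<gamma> \<alpha>) - (2 * norm_sq) *\<^sub>R 1) - 2 *\<^sub>R - (norm_sq *\<^sub>R 1)" .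
  show ?thesis
  proof (rule eq_by_functionals)
    fix f :: "'r \<Rightarrow> real" assume "linear f"
    then show "f ?L = f (4 *\<^sub>R (cl2 \<gamma> \<alpha> * cl2 \<gamma> \<alpha>) + (4 * norm_sq) *\<^sub>R 1)"
      unfolding eq by (simp add: functional algebra_simps)
  qed
qed

text \<open>The formula \<open>\<alpha>\<^sup>2 = \<alpha> \<and> \<alpha> - \<bar>\<alpha>\<bar>\<^sup>2\<close> for the Clifford square of a two-form, whose part of degree two
  vanishes.\<close>

lemma cl4_wedge22:
  "cl4 \<gamma> (wedge22 \<alpha> \<alpha>) = cl2 \<gamma> \<alpha> * cl2 \<gamma> \<alpha> + (norm_sq / 2) *\<^sub>R 1"
proof -
  let ?w = "\<lambda>i j k l. \<alpha> i j * \<alpha> k l - \<alpha> i k * \<alpha> j l + \<alpha> i l * \<alpha> j k"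
  have w: "wedge22 \<alpha> \<alpha> = (\<lambda>i j k l. 2 * ?w i j k l)"
    by (simp add: wedge22_def fun_eq_iff)
  have eq: "24 *\<^sub>R cl4 \<gamma> ?w =
      4 *\<^sub>R (cl2 \<gamma> \<alpha> * cl2 \<gamma> \<alpha>)
      - (- 4 *\<^sub>R (cl2 \<gamma> \<alpha> * cl2 \<gamma> \<alpha>) - (2 * norm_sq) *\<^sub>R 1)
      + (4 *\<^sub>R (cl2 \<gamma> \<alpha> * cl2 \<gamma> \<alpha>) + (4 * norm_sq) *\<^sub>R 1)"
    unfolding quadruple_sum_eq_cl4[symmetric] scaleR_add_left[of "_ - _"] scaleR_diff_left sum.distrib sum_subtractf
      pairs_adjacent pairs_crossed pairs_nested ..
  show ?thesis
  proof (rule eq_by_functionals)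
    fix f :: "'r \<Rightarrow> real" assume "linear f"
    then show "f (cl4 \<gamma> (wedge22 \<alpha> \<alpha>)) = f (cl2 \<gamma> \<alpha> * cl2 \<gamma> \<alpha> + (norm_sq / 2) *\<^sub>R 1)"
      unfolding w cl4_scale using arg_cong[OF eq, of f] by (simp add: functional field_simps)
  qed
qed

end

text \<open>The definition of \<open>\<sigma>\<^sub>T\<close> together with the formula for the square of a two-form gives \<open>S = 2\<sigma>\<^sub>T - 3\<parallel>T\<parallel>\<^sup>2\<close>.\<close>

lemma sum_cl2_squares:
  assumes t: "skew3 t"
  shows "(\<Sum>a\<in>UNIV. cl2 \<gamma> (t a) * cl2 \<gamma> (t a)) =
    2 *\<^sub>R cl4 \<gamma> (sigma_T id t) - (3 * norm_T_sq id t) *\<^sub>R 1"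
proof -
  have "sigma_T id t = (\<lambda>x y z w. (1/2) * (\<Sum>a\<in>UNIV. wedge22 (t a) (t a) x y z w))"
    by (simp add: sigma_T_def fun_eq_iff)
  then have "2 *\<^sub>R cl4 \<gamma> (sigma_T id t) = (\<Sum>a\<in>UNIV. cl4 \<gamma> (wedge22 (t a) (t a)))"
    by (simp only: cl4_scale cl4_sum_right) simp
  also have "\<dots> = (\<Sum>a\<in>UNIV. cl2 \<gamma> (t a) * cl2 \<gamma> (t a)) + (3 * norm_T_sq id t) *\<^sub>R 1"
    by (simp add: cl4_wedge22[OF skew3_skew[OF t]] sum.distrib norm_T_sq_def flip: scaleR_sum_left sum_divide_distrib)
  finally show ?thesis
    by simp
qed

text \<open>The double contraction of the commutators \<open>[\<omega>\<^sub>a, \<omega>\<^sub>b]\<close> is evaluated in two ways.  Expanded in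
  components it is a difference of two of the products of four gammas treated above; moving the
  gammas past the \<open>\<omega>\<^sub>a\<close> instead expresses it by \<open>T\<^sup>2\<close> and \<open>S\<close>.  Comparison yields
  \<open>T\<^sup>2\<close> without multiplying out a product of six gammas.\<close>

lemma sum_gamma_gamma_commutator_direct:
  assumes t: "skew3 t"
  shows "(\<Sum>a\<in>UNIV. \<Sum>b\<in>UNIV. \<gamma> a * \<gamma> b * (cl2 \<gamma> (t a) * cl2 \<gamma> (t b) - cl2 \<gamma> (t b) * cl2 \<gamma> (t a))) =
    - 8 *\<^sub>R (\<Sum>a\<in>UNIV. cl2 \<gamma> (t a) * cl2 \<gamma> (t a)) - (36 * norm_T_sq id t) *\<^sub>R 1" (is "?V = _")
proof -
  let ?g = "\<lambda>i j k l. \<gamma> i * \<gamma> j * \<gamma> k * \<gamma> l"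
  have cyc: "t i j k = t k i j" for i j k
    using skew3D(3)[OF t, of k i j] by simp
  \<comment> \<open>Cyclic rotation of the indices puts the summed index of both factors in front.\<close>
  define u where "u = (\<lambda>k a i. t a i k)"
  have u: "u = t"
    unfolding u_def by (intro ext) (rule cyc)
  have "?V = (\<Sum>a\<in>UNIV. \<Sum>b\<in>UNIV. \<Sum>i\<in>UNIV. \<Sum>j\<in>UNIV. \<Sum>k\<in>UNIV.
      (u k a i * u k b j) *\<^sub>R ?g a b i j) -
    (\<Sum>a\<in>UNIV. \<Sum>b\<in>UNIV. \<Sum>i\<in>UNIV. \<Sum>j\<in>UNIV. \<Sum>k\<in>UNIV.
      (u k a j * u k b i) *\<^sub>R ?g a b i j)"
    unfolding cl2_commutator[OF skew3_skew[OF t] skew3_skew[OF t]] double_sum_eq_cl2[symmetric] u_def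
    by (simp add: sum_distrib_left mult.assoc scaleR_diff_left sum_subtractf scaleR_sum_left
        right_diff_distrib mult.commute[of "t _ _ _" "t _ _ _"])
  note this[unfolded u]
  also have "(\<Sum>a\<in>UNIV. \<Sum>b\<in>UNIV. \<Sum>i\<in>UNIV. \<Sum>j\<in>UNIV. \<Sum>k\<in>UNIV. (t k a i * t k b j) *\<^sub>R ?g a b i j) =
    (\<Sum>k\<in>UNIV. \<Sum>a\<in>UNIV. \<Sum>b\<in>UNIV. \<Sum>i\<in>UNIV. \<Sum>j\<in>UNIV. (t k a i * t k b j) *\<^sub>R ?g a b i j)"
    by (rule sum_swap5)
  also have "\<dots> = (\<Sum>k\<in>UNIV. - 4 *\<^sub>R (cl2 \<gamma> (t k) * cl2 \<gamma> (t k)) - (2 * (\<Sum>i\<in>UNIV. \<Sum>j\<in>UNIV. (t k i j)\<^sup>2)) *\<^sub>R 1)"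
    by (subst pairs_crossed[OF skew3_skew[OF t]], rule refl)
  also have "(\<Sum>a\<in>UNIV. \<Sum>b\<in>UNIV. \<Sum>i\<in>UNIV. \<Sum>j\<in>UNIV. \<Sum>k\<in>UNIV. (t k a j * t k b i) *\<^sub>R ?g a b i j) =
    (\<Sum>k\<in>UNIV. \<Sum>a\<in>UNIV. \<Sum>b\<in>UNIV. \<Sum>i\<in>UNIV. \<Sum>j\<in>UNIV. (t k a j * t k b i) *\<^sub>R ?g a b i j)"
    by (rule sum_swap5)
  also have "\<dots> = (\<Sum>k\<in>UNIV. 4 *\<^sub>R (cl2 \<gamma> (t k) * cl2 \<gamma> (t k)) + (4 * (\<Sum>i\<in>UNIV. \<Sum>j\<in>UNIV. (t k i j)\<^sup>2)) *\<^sub>R 1)"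
    by (subst pairs_nested[OF skew3_skew[OF t]], rule refl)
  finally have V: "?V =
      (\<Sum>k\<in>UNIV. - 4 *\<^sub>R (cl2 \<gamma> (t k) * cl2 \<gamma> (t k)) - (2 * (\<Sum>i\<in>UNIV. \<Sum>j\<in>UNIV. (t k i j)\<^sup>2)) *\<^sub>R 1) -
      (\<Sum>k\<in>UNIV. 4 *\<^sub>R (cl2 \<gamma> (t k) * cl2 \<gamma> (t k)) + (4 * (\<Sum>i\<in>UNIV. \<Sum>j\<in>UNIV. (t k i j)\<^sup>2)) *\<^sub>R 1)" .
  show ?thesis
  proof (rule eq_by_functionals)
    fix f :: "'r \<Rightarrow> real" assume f: "linear f"
    show "f ?V = f (- 8 *\<^sub>R (\<Sum>a\<in>UNIV. cl2 \<gamma> (t a) * cl2 \<gamma> (t a)) - (36 * norm_T_sq id t) *\<^sub>R 1)"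
      unfolding V
      by (simp add: functional[OF f] linear_sum[OF f] norm_T_sq_def sum.distrib sum_subtractf sum_negf
        flip: sum_distrib_left sum_distrib_right)
  qed
qed

lemma sum_gamma_gamma_commutator:
  assumes t: "skew3 t"
  shows "(\<Sum>a\<in>UNIV. \<Sum>b\<in>UNIV. \<gamma> a * \<gamma> b * (cl2 \<gamma> (t a) * cl2 \<gamma> (t b) - cl2 \<gamma> (t b) * cl2 \<gamma> (t a))) =
    18 *\<^sub>R (cl3 \<gamma> t * cl3 \<gamma> t) + 10 *\<^sub>R (\<Sum>a\<in>UNIV. cl2 \<gamma> (t a) * cl2 \<gamma> (t a))" (is "?V = _")
proof -
  let ?w = "\<lambda>a. cl2 \<gamma> (t a)"
  let ?T = "cl3 \<gamma> t"
  let ?S = "\<Sum>a\<in>UNIV. ?w a * ?w a"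
  have c: "\<gamma> b * ?w a = ?w a * \<gamma> b - 2 *\<^sub>R (\<Sum>c\<in>UNIV. t a b c *\<^sub>R \<gamma> c)" for a b
    using comm_cl2[OF skew3_skew[OF t], of a b] by simp
  have inner: "(\<Sum>b\<in>UNIV. \<gamma> b * (?w a * ?w b)) =
      3 *\<^sub>R (?w a * ?T) - 2 *\<^sub>R (\<Sum>b\<in>UNIV. \<Sum>c\<in>UNIV. t a b c *\<^sub>R (\<gamma> c * ?w b))" for a
  proof -
    have "(\<Sum>b\<in>UNIV. \<gamma> b * (?w a * ?w b)) = (\<Sum>b\<in>UNIV. (?w a * \<gamma> b - 2 *\<^sub>R (\<Sum>c\<in>UNIV. t a b c *\<^sub>R \<gamma> c)) * ?w b)"
      by (simp only: c[symmetric] mult.assoc)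
    also have "\<dots> = ?w a * (\<Sum>b\<in>UNIV. \<gamma> b * ?w b) - 2 *\<^sub>R (\<Sum>b\<in>UNIV. \<Sum>c\<in>UNIV. t a b c *\<^sub>R (\<gamma> c * ?w b))"
      by (simp add: left_diff_distrib sum_subtractf sum_distrib_left sum_distrib_right scaleR_sum_right mult.assoc)
    finally show ?thesis
      by (simp add: sum_gamma_cl2)
  qed
  have V1: "(\<Sum>a\<in>UNIV. \<Sum>b\<in>UNIV. \<gamma> a * (\<gamma> b * (?w a * ?w b))) = 9 *\<^sub>R (?T * ?T) + 4 *\<^sub>R ?S"
  proof -
    have "(\<Sum>a\<in>UNIV. \<Sum>b\<in>UNIV. \<gamma> a * (\<gamma> b * (?w a * ?w b))) =
        3 *\<^sub>R ((\<Sum>a\<in>UNIV. \<gamma> a * ?w a) * ?T)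
        - 2 *\<^sub>R (\<Sum>a\<in>UNIV. \<Sum>b\<in>UNIV. \<Sum>c\<in>UNIV. t a b c *\<^sub>R (\<gamma> a * (\<gamma> c * ?w b)))"
      unfolding sum_distrib_left[symmetric] inner
      by (simp add: right_diff_distrib sum_subtractf scaleR_sum_right sum_distrib_left sum_distrib_right mult.assoc)
    also have "(\<Sum>a\<in>UNIV. \<Sum>b\<in>UNIV. \<Sum>c\<in>UNIV. t a b c *\<^sub>R (\<gamma> a * (\<gamma> c * ?w b))) =
        (\<Sum>b\<in>UNIV. (\<Sum>a\<in>UNIV. \<Sum>c\<in>UNIV. t a b c *\<^sub>R (\<gamma> a * \<gamma> c)) * ?w b)"
      by (subst sum.swap) (simp add: sum_distrib_right mult.assoc)
    also have "\<dots> = - 2 *\<^sub>R ?S"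
      unfolding cl2_slot2[OF t] by (simp add: scaleR_sum_right)
    finally show ?thesis
      by (simp add: sum_gamma_cl2)
  qed
  have V2: "(\<Sum>a\<in>UNIV. \<Sum>b\<in>UNIV. \<gamma> a * (\<gamma> b * (?w b * ?w a))) = - (9 *\<^sub>R (?T * ?T) + 4 *\<^sub>R ?S) - 2 *\<^sub>R ?S"
  proof -
    have "(\<Sum>a\<in>UNIV. \<Sum>b\<in>UNIV. \<gamma> a * (\<gamma> b * (?w b * ?w a))) =
       (\<Sum>a\<in>UNIV. \<Sum>b\<in>UNIV. - (\<gamma> b * (\<gamma> a * (?w b * ?w a))) - (if a = b then 2 *\<^sub>R (?w b * ?w a) else 0))"
      by (intro sum.cong refl anticomm_left)
    also have "\<dots> = - (\<Sum>a\<in>UNIV. \<Sum>b\<in>UNIV. \<gamma> b * (\<gamma> a * (?w b * ?w a))) - 2 *\<^sub>R ?S"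
      by (simp add: sum_subtractf sum_negf scaleR_sum_right)
    also have "(\<Sum>a\<in>UNIV. \<Sum>b\<in>UNIV. \<gamma> b * (\<gamma> a * (?w b * ?w a))) = 9 *\<^sub>R (?T * ?T) + 4 *\<^sub>R ?S"
      unfolding V1[symmetric] by (rule sum.swap)
    finally show ?thesis .
  qed
  have V: "?V = (\<Sum>a\<in>UNIV. \<Sum>b\<in>UNIV. \<gamma> a * (\<gamma> b * (?w a * ?w b))) - (\<Sum>a\<in>UNIV. \<Sum>b\<in>UNIV. \<gamma> a * (\<gamma> b * (?w b * ?w a)))"
    by (simp add: right_diff_distrib sum_subtractf mult.assoc)
  show ?thesis
  proof (rule eq_by_functionals)
    fix f :: "'r \<Rightarrow> real" assume f: "linear f"
    show "f ?V = f (18 *\<^sub>R (?T * ?T) + 10 *\<^sub>R ?S)"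
      unfolding V V1 V2 by (simp add: functional[OF f])
  qed
qed

text \<open>Comparing both evaluations of the contracted commutators, \<open>-8S - 36\<parallel>T\<parallel>\<^sup>2 = 18T\<^sup>2 + 10S\<close>, and \<open>S = 2\<sigma>\<^sub>T - 3\<parallel>T\<parallel>\<^sup>2\<close>.\<close>

lemma cl3_square:
  assumes t: "skew3 t"
  shows "cl3 \<gamma> t * cl3 \<gamma> t = - 2 *\<^sub>R cl4 \<gamma> (sigma_T id t) + norm_T_sq id t *\<^sub>R 1"
proof (rule eq_by_functionals)
  fix f :: "'r \<Rightarrow> real" assume f: "linear f"
  show "f (cl3 \<gamma> t * cl3 \<gamma> t) = f (- 2 *\<^sub>R cl4 \<gamma> (sigma_T id t) + norm_T_sq id t *\<^sub>R 1)"
    using arg_cong[OF trans[OF sum_gamma_gamma_commutator_direct[OF t, symmetric] sum_gamma_gamma_commutator[OF t]], of f]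
      arg_cong[OF sum_cl2_squares[OF t], of f]
    by (simp add: functional[OF f] algebra_simps)
qed

text \<open>Moving \<open>\<gamma>\<^sub>a\<close> past \<open>T\<close> costs \<open>-2\<omega>\<^sub>a\<close> and leaves \<open>\<Sum>\<^sub>a \<gamma>\<^sub>a \<omega>\<^sub>a = 3T\<close>.\<close>

lemma sum_gamma_cl3_cl2:
  assumes t: "skew3 t"
  shows "(\<Sum>a\<in>UNIV. \<gamma> a * (cl3 \<gamma> t * cl2 \<gamma> (t a))) =
    - 3 *\<^sub>R (cl3 \<gamma> t * cl3 \<gamma> t) - 2 *\<^sub>R (\<Sum>a\<in>UNIV. cl2 \<gamma> (t a) * cl2 \<gamma> (t a))"
proof -
  have "\<gamma> a * cl3 \<gamma> t = - (cl3 \<gamma> t * \<gamma> a) - 2 *\<^sub>R cl2 \<gamma> (t a)" for a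
    using cl3_anticomm[OF t, of a] by simp
  then have "(\<Sum>a\<in>UNIV. \<gamma> a * (cl3 \<gamma> t * cl2 \<gamma> (t a))) =
      (\<Sum>a\<in>UNIV. (- (cl3 \<gamma> t * \<gamma> a) - 2 *\<^sub>R cl2 \<gamma> (t a)) * cl2 \<gamma> (t a))"
    by (simp only: mult.assoc[symmetric])
  also have "\<dots> = - (cl3 \<gamma> t * (\<Sum>a\<in>UNIV. \<gamma> a * cl2 \<gamma> (t a))) - 2 *\<^sub>R (\<Sum>a\<in>UNIV. cl2 \<gamma> (t a) * cl2 \<gamma> (t a))"
    by (simp add: left_diff_distrib sum_subtractf sum_negf sum_distrib_left scaleR_sum_right mult.assoc)
  finally show ?thesis
    by (simp add: sum_gamma_cl2)
qed

text \<open>The algebraic part of the Lichnerowicz formula.  The first Bianchi identity kills the part of \<open>\<gamma>\<^sub>k\<gamma>\<^sub>l\<gamma>\<^sub>i\<close>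
  that is totally antisymmetric; what remains is a contraction with the Ricci tensor, and the pair
  symmetry makes the latter symmetric, so that only its trace contributes.\<close>

lemma lichnerowicz_contraction:
  assumes skew12: "\<And>k l i j. R k l i j = - R l k i j" and skew34: "\<And>k l i j. R k l i j = - R k l j i"
    and bianchi: "\<And>k l i j. R k l i j + R l i k j + R i k l j = 0"
  shows "(\<Sum>k\<in>UNIV. \<Sum>l\<in>UNIV. \<gamma> k * \<gamma> l * cl2 \<gamma> (R k l)) = (\<Sum>k\<in>UNIV. \<Sum>l\<in>UNIV. R k l l k) *\<^sub>R 1"
proof -
  define ric where "ric k j = (\<Sum>l\<in>UNIV. R k l l j)" for k j
  \<comment> \<open>A signed sum of the four cyclic identities, one for each index in the last place.\<close>
  have pair: "R k l i j = R i j k l" for k l i j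
    using bianchi[of k l i j] bianchi[of l i j k] bianchi[of i j k l] bianchi[of j k l i]
      skew34[of l i j k] skew34[of i j l k] skew12[of j l i k] skew12[of j k i l] skew34[of k j i l]
      skew12[of k i j l] skew34[of i k j l] skew12[of j k l i] skew34[of k l j i] skew34[of l j k i]
    by linarith
  have ric_sym: "ric k j = ric j k" for k j
  proof -
    have "R k l l j = R j l l k" for l
      using pair[of k l l j] skew12[of l j k l] skew34[of j l k l] by simp
    then show ?thesis by (simp add: ric_def)
  qed
  have diag: "R k k i j = 0" for k i j
    using skew12[of k k i j] by simp
  let ?P = "\<lambda>j. \<Sum>k\<in>UNIV. \<Sum>l\<in>UNIV. \<Sum>i\<in>UNIV. R k l i j *\<^sub>R (\<gamma> k * (\<gamma> l * \<gamma> i))"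
  let ?r = "\<lambda>j. \<Sum>k\<in>UNIV. ric k j *\<^sub>R \<gamma> k"
  have r1: "(\<Sum>k\<in>UNIV. \<Sum>l\<in>UNIV. R k l l j *\<^sub>R \<gamma> k) = ?r j" for j
    by (simp add: ric_def scaleR_sum_left)
  have r2: "(\<Sum>k\<in>UNIV. \<Sum>l\<in>UNIV. R k l k j *\<^sub>R \<gamma> l) = - ?r j" for j
  proof -
    have "(\<Sum>k\<in>UNIV. \<Sum>l\<in>UNIV. R k l k j *\<^sub>R \<gamma> l) = (\<Sum>l\<in>UNIV. \<Sum>k\<in>UNIV. - (R l k k j *\<^sub>R \<gamma> l))"
      by (subst sum.swap, intro sum.cong refl, subst skew12, simp)
    then show ?thesis
      by (simp only: sum_negf r1)
  qed
  \<comment> \<open>The two cyclic rotations of the three gammas differ from the original order by Ricci terms.\<close>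
  have rot2: "(\<Sum>k\<in>UNIV. \<Sum>l\<in>UNIV. \<Sum>i\<in>UNIV. R k l i j *\<^sub>R (\<gamma> i * (\<gamma> k * \<gamma> l))) = ?P j + 4 *\<^sub>R ?r j" for j
  proof -
    have g: "\<gamma> i * (\<gamma> k * \<gamma> l) = \<gamma> k * (\<gamma> l * \<gamma> i) + (if i = l then 2 *\<^sub>R \<gamma> k else 0) - (if i = k then 2 *\<^sub>R \<gamma> l else 0)" for i k l
      by (subst anticomm_left, subst anticomm[of i l]) (simp add: right_diff_distrib delta_simps)
    have "(\<Sum>k\<in>UNIV. \<Sum>l\<in>UNIV. \<Sum>i\<in>UNIV. R k l i j *\<^sub>R (\<gamma> i * (\<gamma> k * \<gamma> l))) =
      (\<Sum>k\<in>UNIV. \<Sum>l\<in>UNIV. \<Sum>i\<in>UNIV. R k l i j *\<^sub>R (\<gamma> k * (\<gamma> l * \<gamma> i) + (if i = l then 2 *\<^sub>R \<gamma> k else 0) - (if i = k then 2 *\<^sub>R \<gamma> l else 0)))"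
      by (intro sum.cong refl) (subst g, rule refl)
    also have "\<dots> = ?P j + 2 *\<^sub>R (\<Sum>k\<in>UNIV. \<Sum>l\<in>UNIV. R k l l j *\<^sub>R \<gamma> k) - 2 *\<^sub>R (\<Sum>k\<in>UNIV. \<Sum>l\<in>UNIV. R k l k j *\<^sub>R \<gamma> l)"
      by (simp add: scaleR_diff_right scaleR_add_right sum.distrib sum_subtractf delta_simps scaleR_sum_right mult.commute)
    finally show ?thesis
      unfolding r1 r2 by (simp flip: scaleR_add_left)
  qed
  have rot3: "(\<Sum>k\<in>UNIV. \<Sum>l\<in>UNIV. \<Sum>i\<in>UNIV. R k l i j *\<^sub>R (\<gamma> l * (\<gamma> i * \<gamma> k))) = ?P j + 2 *\<^sub>R ?r j" for j
  proof -
    have g: "\<gamma> l * (\<gamma> i * \<gamma> k) = \<gamma> k * (\<gamma> l * \<gamma> i) + (if k = l then 2 *\<^sub>R \<gamma> i else 0) - (if i = k then 2 *\<^sub>R \<gamma> l else 0)" for i k l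
      by (subst anticomm[of i k], subst anticomm_left[of k l]) (simp add: right_diff_distrib delta_simps)
    have "(\<Sum>k\<in>UNIV. \<Sum>l\<in>UNIV. \<Sum>i\<in>UNIV. R k l i j *\<^sub>R (\<gamma> l * (\<gamma> i * \<gamma> k))) =
      (\<Sum>k\<in>UNIV. \<Sum>l\<in>UNIV. \<Sum>i\<in>UNIV. R k l i j *\<^sub>R (\<gamma> k * (\<gamma> l * \<gamma> i) + (if k = l then 2 *\<^sub>R \<gamma> i else 0) - (if i = k then 2 *\<^sub>R \<gamma> l else 0)))"
      by (intro sum.cong refl) (subst g, rule refl)
    also have "\<dots> = ?P j - 2 *\<^sub>R (\<Sum>k\<in>UNIV. \<Sum>l\<in>UNIV. R k l k j *\<^sub>R \<gamma> l)"
      by (simp add: scaleR_diff_right scaleR_add_right sum.distrib sum_subtractf delta_simps diag scaleR_sum_right mult.commute)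
    finally show ?thesis
      unfolding r2 by simp
  qed
  have P: "?P j = - 2 *\<^sub>R ?r j" for j
  proof (rule eq_by_functionals)
    fix f :: "'r \<Rightarrow> real" assume f: "linear f"
    have "0 = (\<Sum>k\<in>UNIV. \<Sum>l\<in>UNIV. \<Sum>i\<in>UNIV. (R k l i j + R l i k j + R i k l j) *\<^sub>R (\<gamma> k * (\<gamma> l * \<gamma> i)))"
      by (simp add: bianchi)
    also have "\<dots> = ?P j + (\<Sum>k\<in>UNIV. \<Sum>l\<in>UNIV. \<Sum>i\<in>UNIV. R l i k j *\<^sub>R (\<gamma> k * (\<gamma> l * \<gamma> i)))
        + (\<Sum>k\<in>UNIV. \<Sum>l\<in>UNIV. \<Sum>i\<in>UNIV. R i k l j *\<^sub>R (\<gamma> k * (\<gamma> l * \<gamma> i)))"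
      by (simp add: scaleR_add_left sum.distrib)
    also have "(\<Sum>k\<in>UNIV. \<Sum>l\<in>UNIV. \<Sum>i\<in>UNIV. R l i k j *\<^sub>R (\<gamma> k * (\<gamma> l * \<gamma> i))) = ?P j + 4 *\<^sub>R ?r j"
      by (subst rot2[symmetric]) (rule sum_swap3[symmetric])
    also have "(\<Sum>k\<in>UNIV. \<Sum>l\<in>UNIV. \<Sum>i\<in>UNIV. R i k l j *\<^sub>R (\<gamma> k * (\<gamma> l * \<gamma> i))) = ?P j + 2 *\<^sub>R ?r j"
      by (subst rot3[symmetric]) (rule sum_swap3)
    finally have "f 0 = f (?P j + (?P j + 4 *\<^sub>R ?r j) + (?P j + 2 *\<^sub>R ?r j))"
      by simp
    then show "f (?P j) = f (- 2 *\<^sub>R ?r j)"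
      by (simp add: functional[OF f])
  qed
  have "2 *\<^sub>R (\<Sum>k\<in>UNIV. \<Sum>l\<in>UNIV. \<gamma> k * \<gamma> l * cl2 \<gamma> (R k l)) =
      (\<Sum>k\<in>UNIV. \<Sum>l\<in>UNIV. \<Sum>i\<in>UNIV. \<Sum>j\<in>UNIV. R k l i j *\<^sub>R (\<gamma> k * (\<gamma> l * \<gamma> i)) * \<gamma> j)"
    unfolding scaleR_sum_right mult_scaleR_right[symmetric] double_sum_eq_cl2[symmetric]
    by (simp add: sum_distrib_left mult.assoc)
  also have "\<dots> = (\<Sum>j\<in>UNIV. ?P j * \<gamma> j)"
    by (subst sum_swap4) (simp add: sum_distrib_right)
  also have "\<dots> = - 2 *\<^sub>R (\<Sum>j\<in>UNIV. \<Sum>k\<in>UNIV. ric k j *\<^sub>R (\<gamma> k * \<gamma> j))"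
    unfolding P by (simp add: sum_distrib_right scaleR_sum_right)
  also have "(\<Sum>j\<in>UNIV. \<Sum>k\<in>UNIV. ric k j *\<^sub>R (\<gamma> k * \<gamma> j)) = - (\<Sum>k\<in>UNIV. ric k k) *\<^sub>R 1"
    by (subst sum.swap) (rule symmetric_contraction[OF ric_sym])
  finally have "2 *\<^sub>R (\<Sum>k\<in>UNIV. \<Sum>l\<in>UNIV. \<gamma> k * \<gamma> l * cl2 \<gamma> (R k l)) = 2 *\<^sub>R ((\<Sum>k\<in>UNIV. ric k k) *\<^sub>R 1)"
    by simp
  then show ?thesis
    by (simp only: scaleR_cancel_left) (simp add: ric_def)
qed

text \<open>The algebraic core.  \<open>F a b\<close> are the components of the curvature of the connection with torsion,
  so \<open>cl2 \<gamma> (F a b)\<close> is twice its action on spinors.  The contraction with \<open>\<gamma>\<^sub>a\<gamma>\<^sub>b\<close> turns its three parts into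
  the Riemannian scalar curvature, into \<open>3dT + 2\<delta>T\<close>, and into \<open>-2\<sigma>\<^sub>T - (3/2)\<parallel>T\<parallel>\<^sup>2\<close>.  The left-hand side is the
  zeroth-order form that the Casimir operator takes on parallel spinors.\<close>

theorem casimir_eq_curvature_contraction:
  assumes t: "skew3 t" and D: "\<And>a. skew3 (D a)"
    and skew12: "\<And>k l i j. R k l i j = - R l k i j" and skew34: "\<And>k l i j. R k l i j = - R k l j i"
    and bianchi: "\<And>k l i j. R k l i j + R l i k j + R i k l j = 0"
    and F: "\<And>a b i j. F a b i j = R a b i j + (D a b i j - D b a i j) / 2
      + (\<Sum>k\<in>UNIV. t a i k * t b j k - t b i k * t a j k) / 4"
  shows "- (1/2) *\<^sub>R (\<Sum>a\<in>UNIV. \<gamma> a * cl3 \<gamma> (D a)) + (1/8) *\<^sub>R (\<Sum>a\<in>UNIV. \<gamma> a * (cl3 \<gamma> t * cl2 \<gamma> (t a)))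
      - (1/8) *\<^sub>R (cl3 \<gamma> t * cl3 \<gamma> t)
      + (1/8) *\<^sub>R cl4 \<gamma> (\<lambda>i j k l. (D i j k l - D j i k l + D k i j l - D l i j k) - 2 * sigma_T id t i j k l)
      + (1/4) *\<^sub>R cl2 \<gamma> (\<lambda>i j. - (\<Sum>a\<in>UNIV. D a a i j))
      - (1/8 * (\<Sum>k\<in>UNIV. \<Sum>l\<in>UNIV. R k l l k)) *\<^sub>R 1 - (1/16 * norm_T_sq id t) *\<^sub>R 1
    = - (1/8) *\<^sub>R (\<Sum>a\<in>UNIV. \<Sum>b\<in>UNIV. \<gamma> a * \<gamma> b * cl2 \<gamma> (F a b))" (is "?C = - (1/8) *\<^sub>R ?K")
proof -
  let ?G = "\<Sum>a\<in>UNIV. \<gamma> a * cl3 \<gamma> (D a)"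
  let ?d = "\<Sum>a\<in>UNIV. cl2 \<gamma> (D a a)"
  let ?dD = "\<lambda>i j k l. D i j k l - D j i k l + D k i j l - D l i j k"
  let ?V = "\<Sum>a\<in>UNIV. \<Sum>b\<in>UNIV. \<gamma> a * \<gamma> b * (cl2 \<gamma> (t a) * cl2 \<gamma> (t b) - cl2 \<gamma> (t b) * cl2 \<gamma> (t a))"
  have c4: "cl4 \<gamma> (\<lambda>i j k l. ?dD i j k l - 2 * sigma_T id t i j k l) = cl4 \<gamma> ?dD - 2 *\<^sub>R cl4 \<gamma> (sigma_T id t)"
    using cl4_add[of \<gamma> ?dD "\<lambda>i j k l. (-2) * sigma_T id t i j k l"] cl4_scale[of \<gamma> "-2" "sigma_T id t"]
    by simp
  have c2: "cl2 \<gamma> (\<lambda>i j. - (\<Sum>a\<in>UNIV. D a a i j)) = - ?d"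
    using cl2_scale[of \<gamma> "-1" "\<lambda>i j. \<Sum>a\<in>UNIV. D a a i j"] by (simp add: cl2_sum_right)
  have "F a b = (\<lambda>i j. R a b i j + (1/2) * (D a b i j - D b a i j)
      + (1/4) * (\<Sum>k\<in>UNIV. t a i k * t b j k - t b i k * t a j k))" for a b
    by (simp add: F fun_eq_iff)
  then have F2: "cl2 \<gamma> (F a b) = cl2 \<gamma> (R a b) + (1/2) *\<^sub>R (cl2 \<gamma> (D a b) - cl2 \<gamma> (D b a))
      + (1/8) *\<^sub>R (cl2 \<gamma> (t a) * cl2 \<gamma> (t b) - cl2 \<gamma> (t b) * cl2 \<gamma> (t a))" for a b
    by (simp only: cl2_add cl2_scale cl2_diff cl2_commutator[OF skew3_skew[OF t] skew3_skew[OF t]]) simp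
  have D1: "(\<Sum>a\<in>UNIV. \<Sum>b\<in>UNIV. \<gamma> a * \<gamma> b * cl2 \<gamma> (D a b)) = 3 *\<^sub>R ?G"
    by (simp add: mult.assoc sum_gamma_cl2 scaleR_sum_right flip: sum_distrib_left)
  have D2: "(\<Sum>a\<in>UNIV. \<Sum>b\<in>UNIV. \<gamma> a * \<gamma> b * cl2 \<gamma> (D b a)) = - 3 *\<^sub>R ?G - 2 *\<^sub>R ?d"
  proof -
    have "(\<Sum>a\<in>UNIV. \<Sum>b\<in>UNIV. \<gamma> a * \<gamma> b * cl2 \<gamma> (D b a)) =
        (\<Sum>a\<in>UNIV. \<Sum>b\<in>UNIV. - (\<gamma> b * (\<gamma> a * cl2 \<gamma> (D b a))) - (if a = b then 2 *\<^sub>R cl2 \<gamma> (D b a) else 0))"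
      unfolding mult.assoc by (intro sum.cong refl anticomm_left)
    also have "\<dots> = - (\<Sum>a\<in>UNIV. \<Sum>b\<in>UNIV. \<gamma> b * (\<gamma> a * cl2 \<gamma> (D b a))) - 2 *\<^sub>R ?d"
      by (simp add: sum_subtractf sum_negf scaleR_sum_right)
    also have "(\<Sum>a\<in>UNIV. \<Sum>b\<in>UNIV. \<gamma> b * (\<gamma> a * cl2 \<gamma> (D b a))) = 3 *\<^sub>R ?G"
      unfolding D1[symmetric] mult.assoc by (rule sum.swap)
    finally show ?thesis by simp
  qed
  have K: "?K = (\<Sum>k\<in>UNIV. \<Sum>l\<in>UNIV. R k l l k) *\<^sub>R 1 + (1/2) *\<^sub>R (3 *\<^sub>R ?G - (- 3 *\<^sub>R ?G - 2 *\<^sub>R ?d)) + (1/8) *\<^sub>R ?V"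
    unfolding F2 lichnerowicz_contraction[OF skew12 skew34 bianchi, symmetric] D1[symmetric] D2[symmetric]
    by (simp add: distrib_left right_diff_distrib sum.distrib sum_subtractf scaleR_sum_right scaleR_diff_right)
  show ?thesis
  proof (rule eq_by_functionals)
    fix f :: "'r \<Rightarrow> real" assume f: "linear f"
    show "f ?C = f (- (1/8) *\<^sub>R ?K)"
      unfolding c4 c2 K sum_gamma_cl3_cl2[OF t] cl3_square[OF t] sum_gamma_gamma_commutator_direct[OF t]
        sum_cl2_squares[OF t]
      using arg_cong[OF sum_cl3_eq_cl4_cl2[of D, OF D], of f]
      by (simp add: functional[OF f] algebra_simps)
  qed
qed

end

section \<open>Directional derivatives\<close>
text \<open>This is \<open>pd\<close> read in coordinates.\<close>

abbreviation dir_deriv :: "(real^'n \<Rightarrow> 'b::real_normed_vector) \<Rightarrow> real^'n \<Rightarrow> real^'n \<Rightarrow> 'b" where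
  "dir_deriv f x v \<equiv> frechet_derivative f (at x) v"

lemma Ck_on_subset: "Ck_on k S f \<Longrightarrow> S' \<subseteq> S \<Longrightarrow> Ck_on k S' f"
  by (induction k arbitrary: f) (auto intro: continuous_on_subset)

lemma smooth_on_subset: "smooth_on S f \<Longrightarrow> S' \<subseteq> S \<Longrightarrow> smooth_on S' f"
  by (auto simp: smooth_on_def intro: Ck_on_subset)

lemma smooth_on_differentiable: "smooth_on S f \<Longrightarrow> x \<in> S \<Longrightarrow> f differentiable (at x)"
  unfolding smooth_on_def by (metis Ck_on.simps(2))

lemma smooth_on_dir_deriv: "smooth_on S f \<Longrightarrow> smooth_on S (\<lambda>x. dir_deriv f x v)"
  unfolding smooth_on_def by (metis Ck_on.simps(2))

lemma smooth_on_continuous: "smooth_on S f \<Longrightarrow> continuous_on S f"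
  unfolding smooth_on_def by (metis Ck_on.simps(1))

lemma has_derivative_dir_deriv: "f differentiable (at x) \<Longrightarrow> (f has_derivative dir_deriv f x) (at x)"
  by (simp add: frechet_derivative_works[symmetric])

lemma dir_deriv_eqI: "(f has_derivative f') (at x) \<Longrightarrow> dir_deriv f x v = f' v"
  by (metis frechet_derivative_at)

lemma has_derivative_line:
  fixes h :: "real^'n \<Rightarrow> real"
  assumes "h differentiable (at (x + r *\<^sub>R v))"
  shows "((\<lambda>r. h (x + r *\<^sub>R v)) has_real_derivative dir_deriv h (x + r *\<^sub>R v) v) (at r)"
proof -
  have h: "(h has_derivative dir_deriv h (x + r *\<^sub>R v)) (at (x + r *\<^sub>R v))"
    by (rule has_derivative_dir_deriv[OF assms])
  have "((\<lambda>r. x + r *\<^sub>R v) has_derivative (\<lambda>d. d *\<^sub>R v)) (at r)"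
    by (auto intro!: derivative_eq_intros)
  from has_derivative_compose[OF this h]
  have "((\<lambda>r. h (x + r *\<^sub>R v)) has_derivative (\<lambda>d. dir_deriv h (x + r *\<^sub>R v) (d *\<^sub>R v))) (at r)" .
  moreover have "dir_deriv h (x + r *\<^sub>R v) (d *\<^sub>R v) = dir_deriv h (x + r *\<^sub>R v) v * d" for d
    using linear_cmul[OF has_derivative_linear[OF h], of d v] by simp
  ultimately show ?thesis
    by (simp add: has_field_derivative_def)
qed

text \<open>Two applications of the mean value theorem, one in each direction.\<close>

lemma second_difference:
  fixes h :: "real^'n \<Rightarrow> real"
  assumes s: "s > 0"
    and U: "\<And>a b. 0 \<le> a \<Longrightarrow> a \<le> s \<Longrightarrow> 0 \<le> b \<Longrightarrow> b \<le> s \<Longrightarrow> x + a *\<^sub>R v + b *\<^sub>R w \<in> U"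
    and h: "\<And>y. y \<in> U \<Longrightarrow> h differentiable (at y)"
    and hv: "\<And>y. y \<in> U \<Longrightarrow> (\<lambda>y. dir_deriv h y v) differentiable (at y)"
  shows "\<exists>a b. 0 < a \<and> a < s \<and> 0 < b \<and> b < s \<and>
    h (x + s *\<^sub>R v + s *\<^sub>R w) - h (x + s *\<^sub>R v) - h (x + s *\<^sub>R w) + h x =
      s * (s * dir_deriv (\<lambda>y. dir_deriv h y v) (x + a *\<^sub>R v + b *\<^sub>R w) w)"
proof -
  let ?\<phi> = "\<lambda>r. h (x + s *\<^sub>R w + r *\<^sub>R v) - h (x + r *\<^sub>R v)"
  have "\<exists>a>0. a < s \<and> ?\<phi> s - ?\<phi> 0 = (s - 0) * (dir_deriv h (x + s *\<^sub>R w + a *\<^sub>R v) v - dir_deriv h (x + a *\<^sub>R v) v)"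
  proof (rule MVT2[OF s])
    fix r :: real assume "0 \<le> r" "r \<le> s"
    then have "x + s *\<^sub>R w + r *\<^sub>R v \<in> U" "x + r *\<^sub>R v \<in> U"
      using U[of r s] U[of r 0] s by (simp_all add: ac_simps)
    then show "(?\<phi> has_real_derivative (dir_deriv h (x + s *\<^sub>R w + r *\<^sub>R v) v - dir_deriv h (x + r *\<^sub>R v) v)) (at r)"
      by (intro DERIV_diff has_derivative_line h)
  qed
  then obtain a where a: "0 < a" "a < s"
    and 1: "?\<phi> s - ?\<phi> 0 = s * (dir_deriv h (x + s *\<^sub>R w + a *\<^sub>R v) v - dir_deriv h (x + a *\<^sub>R v) v)"
    by auto
  let ?\<chi> = "\<lambda>r. dir_deriv h (x + a *\<^sub>R v + r *\<^sub>R w) v"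
  have "\<exists>b>0. b < s \<and> ?\<chi> s - ?\<chi> 0 = (s - 0) * dir_deriv (\<lambda>y. dir_deriv h y v) (x + a *\<^sub>R v + b *\<^sub>R w) w"
  proof (rule MVT2[OF s])
    fix r :: real assume "0 \<le> r" "r \<le> s"
    then have "x + a *\<^sub>R v + r *\<^sub>R w \<in> U"
      using U[of a r] a by simp
    then show "(?\<chi> has_real_derivative dir_deriv (\<lambda>y. dir_deriv h y v) (x + a *\<^sub>R v + r *\<^sub>R w) w) (at r)"
      by (intro has_derivative_line hv)
  qed
  then obtain b where b: "0 < b" "b < s"
    and 2: "?\<chi> s - ?\<chi> 0 = s * dir_deriv (\<lambda>y. dir_deriv h y v) (x + a *\<^sub>R v + b *\<^sub>R w) w"
    by auto
  have "?\<phi> s - ?\<phi> 0 = s * (?\<chi> s - ?\<chi> 0)"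
    unfolding 1 by (simp add: ac_simps)
  then show ?thesis
    unfolding 2 using a b by (intro exI[of _ a] exI[of _ b]) (simp add: ac_simps)
qed

text \<open>The second difference over a small parallelogram is symmetric in the two directions and equals \<open>s\<^sup>2\<close> times either mixed
  derivative at a nearby point.\<close>

lemma second_derivative_symmetric_real:
  fixes h :: "real^'n \<Rightarrow> real"
  assumes U: "open U" "x \<in> U"
    and h: "\<And>y. y \<in> U \<Longrightarrow> h differentiable (at y)"
    and hd: "\<And>y u. y \<in> U \<Longrightarrow> (\<lambda>y. dir_deriv h y u) differentiable (at y)"
    and cont: "\<And>u u'. continuous_on U (\<lambda>y. dir_deriv (\<lambda>y. dir_deriv h y u) y u')"
  shows "dir_deriv (\<lambda>y. dir_deriv h y v) x w = dir_deriv (\<lambda>y. dir_deriv h y w) x v"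
proof (rule ccontr)
  let ?A = "\<lambda>y. dir_deriv (\<lambda>y. dir_deriv h y v) y w" and ?B = "\<lambda>y. dir_deriv (\<lambda>y. dir_deriv h y w) y v"
  assume ne: "?A x \<noteq> ?B x"
  define \<epsilon> where "\<epsilon> = \<bar>?A x - ?B x\<bar> / 2"
  have "\<epsilon> > 0" using ne by (simp add: \<epsilon>_def)
  have "isCont ?A x" "isCont ?B x"
    using cont U by (simp_all add: continuous_on_eq_continuous_at)
  then obtain d1 d2 where "d1 > 0" "d2 > 0"
    and d1: "\<And>y. dist y x < d1 \<Longrightarrow> dist (?A y) (?A x) < \<epsilon>"
    and d2: "\<And>y. dist y x < d2 \<Longrightarrow> dist (?B y) (?B x) < \<epsilon>"
    using \<open>\<epsilon> > 0\<close> unfolding continuous_at_eps_delta by (metis dist_commute)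
  obtain d3 where "d3 > 0" and d3: "\<And>y. dist y x < d3 \<Longrightarrow> y \<in> U"
    using U by (metis open_dist)
  define d where "d = min d1 (min d2 d3)"
  have "d > 0" using \<open>d1 > 0\<close> \<open>d2 > 0\<close> \<open>d3 > 0\<close> by (simp add: d_def)
  \<comment> \<open>With this side length the whole parallelogram stays inside the ball of radius d.\<close>
  define s where "s = d / (2 * (norm v + norm w + 1))"
  have pos: "norm v + norm w + 1 > 0"
    using norm_ge_zero[of v] norm_ge_zero[of w] by linarith
  have "s > 0" unfolding s_def using \<open>d > 0\<close> pos by simp
  have s: "s * (norm v + norm w + 1) = d / 2"
    using pos by (simp add: s_def field_simps)
  have near: "dist (x + a *\<^sub>R v + b *\<^sub>R w) x < d" if "0 \<le> a" "a \<le> s" "0 \<le> b" "b \<le> s" for a b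
  proof -
    have "dist (x + a *\<^sub>R v + b *\<^sub>R w) x = norm (a *\<^sub>R v + b *\<^sub>R w)"
      by (simp add: dist_norm)
    also have "\<dots> \<le> a * norm v + b * norm w"
      using norm_triangle_ineq[of "a *\<^sub>R v" "b *\<^sub>R w"] that by simp
    also have "\<dots> \<le> s * norm v + s * norm w"
      using that by (intro add_mono mult_right_mono) auto
    also have "\<dots> \<le> s * (norm v + norm w + 1)"
      using \<open>s > 0\<close> by (simp add: distrib_left)
    also have "\<dots> < d" using s \<open>d > 0\<close> by simp
    finally show ?thesis .
  qed
  have near': "x + a *\<^sub>R v + b *\<^sub>R w \<in> U" if "0 \<le> a" "a \<le> s" "0 \<le> b" "b \<le> s" for a b
    using near[OF that] by (intro d3) (simp add: d_def)
  have "\<exists>a b. 0 < a \<and> a < s \<and> 0 < b \<and> b < s \<and>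
      h (x + s *\<^sub>R v + s *\<^sub>R w) - h (x + s *\<^sub>R v) - h (x + s *\<^sub>R w) + h x =
      s * (s * ?A (x + a *\<^sub>R v + b *\<^sub>R w))"
    by (intro second_difference[where U = U] \<open>s > 0\<close> near' h hd)
  then obtain a b where ab: "0 < a" "a < s" "0 < b" "b < s" and
    1: "h (x + s *\<^sub>R v + s *\<^sub>R w) - h (x + s *\<^sub>R v) - h (x + s *\<^sub>R w) + h x =
      s * (s * ?A (x + a *\<^sub>R v + b *\<^sub>R w))"
    by (elim exE conjE)
  have near2: "x + a *\<^sub>R w + b *\<^sub>R v \<in> U" if "0 \<le> a" "a \<le> s" "0 \<le> b" "b \<le> s" for a b
    using near'[OF that(3,4) that(1,2)] by (simp add: ac_simps)
  have "\<exists>a b. 0 < a \<and> a < s \<and> 0 < b \<and> b < s \<and>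
      h (x + s *\<^sub>R w + s *\<^sub>R v) - h (x + s *\<^sub>R w) - h (x + s *\<^sub>R v) + h x =
      s * (s * ?B (x + a *\<^sub>R w + b *\<^sub>R v))"
    by (intro second_difference[where U = U] \<open>s > 0\<close> near2 h hd)
  then obtain a' b' where ab': "0 < a'" "a' < s" "0 < b'" "b' < s" and
    2: "h (x + s *\<^sub>R w + s *\<^sub>R v) - h (x + s *\<^sub>R w) - h (x + s *\<^sub>R v) + h x =
      s * (s * ?B (x + a' *\<^sub>R w + b' *\<^sub>R v))"
    by (elim exE conjE)
  have swp: "x + a' *\<^sub>R w + b' *\<^sub>R v = x + b' *\<^sub>R v + a' *\<^sub>R w"
    by (simp add: ac_simps)
  have comm: "x + s *\<^sub>R w + s *\<^sub>R v = x + s *\<^sub>R v + s *\<^sub>R w"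
    by (simp add: ac_simps)
  have "s * (s * ?A (x + a *\<^sub>R v + b *\<^sub>R w)) = s * (s * ?B (x + b' *\<^sub>R v + a' *\<^sub>R w))"
    using 1 2 unfolding swp comm by linarith
  then have "?A (x + a *\<^sub>R v + b *\<^sub>R w) = ?B (x + b' *\<^sub>R v + a' *\<^sub>R w)"
    using \<open>s > 0\<close> by simp
  moreover have "dist (?A (x + a *\<^sub>R v + b *\<^sub>R w)) (?A x) < \<epsilon>"
    using near[of a b] ab by (intro d1) (simp add: d_def)
  moreover have "dist (?B (x + b' *\<^sub>R v + a' *\<^sub>R w)) (?B x) < \<epsilon>"
    using near[of b' a'] ab' by (intro d2) (simp add: d_def)
  ultimately have "\<bar>?A x - ?B x\<bar> < 2 * \<epsilon>"
    unfolding dist_real_def by linarith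
  then show False by (simp add: \<epsilon>_def)
qed

lemma dir_deriv_cong:
  assumes "open U" "x \<in> U" "\<And>y. y \<in> U \<Longrightarrow> f y = g y"
  shows "dir_deriv f x = dir_deriv g x"
proof -
  have "(f has_derivative D) (at x) \<longleftrightarrow> (g has_derivative D) (at x)" for D
    using assms has_derivative_transform_within_open by metis
  then show ?thesis
    by (simp add: frechet_derivative_def)
qed

lemma differentiable_cong_open:
  assumes "open U" "x \<in> U" "\<And>y. y \<in> U \<Longrightarrow> f y = g y" "g differentiable (at x)"
  shows "f differentiable (at x)"
  using assms has_derivative_transform_within_open unfolding differentiable_def by metis

lemma second_derivative_symmetric:
  fixes f :: "real^'n \<Rightarrow> 'b::euclidean_space"
  assumes U: "open U" "x \<in> U" and f: "smooth_on U f"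
  shows "dir_deriv (\<lambda>y. dir_deriv f y v) x w = dir_deriv (\<lambda>y. dir_deriv f y w) x v"
proof (rule euclidean_eqI)
  fix b :: 'b
  define h where "h y = f y \<bullet> b" for y
  have inner: "(\<lambda>y. F y \<bullet> b) differentiable (at y)" "dir_deriv (\<lambda>y. F y \<bullet> b) y u = dir_deriv F y u \<bullet> b"
    if "F differentiable (at y)" for F :: "real^'n \<Rightarrow> 'b" and y u
  proof -
    have "((\<lambda>y. F y \<bullet> b) has_derivative (\<lambda>u. dir_deriv F y u \<bullet> b)) (at y)"
      by (intro has_derivative_inner_left has_derivative_dir_deriv that)
    then show "(\<lambda>y. F y \<bullet> b) differentiable (at y)" "dir_deriv (\<lambda>y. F y \<bullet> b) y u = dir_deriv F y u \<bullet> b"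
      by (auto simp: differentiable_def intro: dir_deriv_eqI)
  qed
  have f1: "f differentiable (at y)" and f2: "(\<lambda>y. dir_deriv f y u) differentiable (at y)" if "y \<in> U" for y u
    using f that by (auto intro: smooth_on_differentiable smooth_on_dir_deriv)
  have h1: "dir_deriv h y u = dir_deriv f y u \<bullet> b" if "y \<in> U" for y u
    unfolding h_def using inner(2)[OF f1[OF that]] .
  have h2: "dir_deriv (\<lambda>y. dir_deriv h y u) y u' = dir_deriv (\<lambda>y. dir_deriv f y u) y u' \<bullet> b" if "y \<in> U" for y u u'
  proof -
    have "dir_deriv (\<lambda>y. dir_deriv h y u) y = dir_deriv (\<lambda>y. dir_deriv f y u \<bullet> b) y"
      by (rule dir_deriv_cong[OF U(1) that h1])
    then show ?thesis
      using inner(2)[OF f2[OF that]] by simp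
  qed
  have "dir_deriv (\<lambda>y. dir_deriv h y v) x w = dir_deriv (\<lambda>y. dir_deriv h y w) x v"
  proof (rule second_derivative_symmetric_real[OF U])
    show "h differentiable (at y)" if "y \<in> U" for y
      unfolding h_def using inner(1)[OF f1[OF that]] .
    show "(\<lambda>y. dir_deriv h y u) differentiable (at y)" if "y \<in> U" for y u
      by (rule differentiable_cong_open[OF U(1) that h1 inner(1)[OF f2[OF that]]])
    show "continuous_on U (\<lambda>y. dir_deriv (\<lambda>y. dir_deriv h y u) y u')" for u u'
    proof (subst continuous_on_cong[OF refl h2])
      show "continuous_on U (\<lambda>y. dir_deriv (\<lambda>y. dir_deriv f y u) y u' \<bullet> b)"
        by (intro continuous_intros smooth_on_continuous smooth_on_dir_deriv f)
    qed
  qed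
  then show "dir_deriv (\<lambda>y. dir_deriv f y v) x w \<bullet> b = dir_deriv (\<lambda>y. dir_deriv f y w) x v \<bullet> b"
    by (simp add: h2[OF U(2)])
qed

lemma vec_expand: "x = (\<Sum>i\<in>UNIV. (x $ i) *\<^sub>R axis i 1)" for x :: "real^'n"
  by (simp add: vec_eq_iff axis_def if_distrib cong: if_cong)

text \<open>The product rule for a field of linear maps that is known to be differentiable only when applied
  to constant vectors, as is the case for tensor fields given by their values on coordinate vectors.\<close>

lemma has_derivative_linear_apply:
  fixes B :: "real^'n \<Rightarrow> real^'m \<Rightarrow> 'b::real_normed_vector"
  assumes U: "open U" "x \<in> U" and lin: "\<And>y. y \<in> U \<Longrightarrow> linear (B y)"
    and B: "\<And>u. (\<lambda>y. B y u) differentiable (at x)" and f: "f differentiable (at x)"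
  shows "((\<lambda>y. B y (f y)) has_derivative (\<lambda>v. dir_deriv (\<lambda>y. B y (f x)) x v + B x (dir_deriv f x v))) (at x)"
proof -
  have ex: "B y u = (\<Sum>i\<in>UNIV. (u $ i) *\<^sub>R B y (axis i 1))" if "y \<in> U" for y u
    by (subst vec_expand[of u]) (simp add: linear_sum[OF lin[OF that]] linear_cmul[OF lin[OF that]])
  have Bd: "((\<lambda>y. B y u) has_derivative dir_deriv (\<lambda>y. B y u) x) (at x)" for u
    by (rule has_derivative_dir_deriv[OF B])
  have fd: "((\<lambda>y. f y $ i) has_derivative (\<lambda>v. dir_deriv f x v $ i)) (at x)" for i
    by (rule bounded_linear.has_derivative[OF bounded_linear_vec_nth has_derivative_dir_deriv[OF f]])
  have c: "dir_deriv (\<lambda>y. B y u) x v = (\<Sum>i\<in>UNIV. (u $ i) *\<^sub>R dir_deriv (\<lambda>y. B y (axis i 1)) x v)" for u v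
  proof -
    have "((\<lambda>y. \<Sum>i\<in>UNIV. (u $ i) *\<^sub>R B y (axis i 1)) has_derivative
        (\<lambda>v. \<Sum>i\<in>UNIV. (u $ i) *\<^sub>R dir_deriv (\<lambda>y. B y (axis i 1)) x v)) (at x)"
      by (intro has_derivative_sum has_derivative_scaleR_right Bd)
    from dir_deriv_eqI[OF this] show ?thesis
      by (subst dir_deriv_cong[OF U ex])
  qed
  have "((\<lambda>y. \<Sum>i\<in>UNIV. (f y $ i) *\<^sub>R B y (axis i 1)) has_derivative
      (\<lambda>v. \<Sum>i\<in>UNIV. (f x $ i) *\<^sub>R dir_deriv (\<lambda>y. B y (axis i 1)) x v + (dir_deriv f x v $ i) *\<^sub>R B x (axis i 1))) (at x)"
    by (intro has_derivative_sum has_derivative_scaleR fd Bd)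
  then have "((\<lambda>y. \<Sum>i\<in>UNIV. (f y $ i) *\<^sub>R B y (axis i 1)) has_derivative
      (\<lambda>v. dir_deriv (\<lambda>y. B y (f x)) x v + B x (dir_deriv f x v))) (at x)"
    by (simp add: sum.distrib c[symmetric] ex[OF U(2), symmetric])
  then show ?thesis
    by (rule has_derivative_transform_within_open[OF _ U]) (simp add: ex[symmetric])
qed

lemma linear_dir_deriv_param:
  fixes B :: "real^'n \<Rightarrow> real^'m \<Rightarrow> 'b::real_normed_vector"
  assumes U: "open U" "x \<in> U" and lin: "\<And>y. y \<in> U \<Longrightarrow> linear (B y)"
    and B: "\<And>u. (\<lambda>y. B y u) differentiable (at x)"
  shows "linear (\<lambda>u. dir_deriv (\<lambda>y. B y u) x v)"
proof (rule linearI)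
  note Bd = has_derivative_dir_deriv[OF B]
  fix a b
  have "dir_deriv (\<lambda>y. B y (a + b)) x v = dir_deriv (\<lambda>y. B y a + B y b) x v"
    by (subst dir_deriv_cong[OF U linear_add[OF lin]]) auto
  also have "\<dots> = dir_deriv (\<lambda>y. B y a) x v + dir_deriv (\<lambda>y. B y b) x v"
    by (rule dir_deriv_eqI[OF has_derivative_add[OF Bd Bd]])
  finally show "dir_deriv (\<lambda>y. B y (a + b)) x v = dir_deriv (\<lambda>y. B y a) x v + dir_deriv (\<lambda>y. B y b) x v" .
next
  note Bd = has_derivative_dir_deriv[OF B]
  fix r b
  have "dir_deriv (\<lambda>y. B y (r *\<^sub>R b)) x v = dir_deriv (\<lambda>y. r *\<^sub>R B y b) x v"
    by (subst dir_deriv_cong[OF U linear_cmul[OF lin]]) auto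
  also have "\<dots> = r *\<^sub>R dir_deriv (\<lambda>y. B y b) x v"
    by (rule dir_deriv_eqI[OF has_derivative_scaleR_right[OF Bd]])
  finally show "dir_deriv (\<lambda>y. B y (r *\<^sub>R b)) x v = r *\<^sub>R dir_deriv (\<lambda>y. B y b) x v" .
qed

section \<open>Riemannian geometry with torsion in an orthonormal frame\<close>

lemma inner_product_eqI:
  assumes "inner_product b" "\<And>u. b x u = b y u"
  shows "x = y"
proof (rule ccontr)
  assume "x \<noteq> y"
  then have "b (x - y) (x - y) > 0"
    using assms(1) by (simp add: inner_product_def)
  moreover have "b (x - y) (x - y) = 0"
  proof -
    have "b (x - y) (x - y) = b x (x - y) - b y (x - y)"
      using assms(1) by (auto simp: inner_product_def bilinear_lsub)
    then show ?thesis by (simp add: assms(2))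
  qed
  ultimately show False by simp
qed

lemma orthonormal_expansion:
  fixes E :: "'n::finite \<Rightarrow> real^'n"
  assumes ip: "inner_product b" and orth: "\<And>i j. b (E i) (E j) = (if i = j then 1 else 0)"
  shows "(\<Sum>i\<in>UNIV. b x (E i) *\<^sub>R E i) = x"
proof -
  have bil: "bilinear b" using ip by (simp add: inner_product_def)
  have lin: "linear (\<lambda>x. b x u)" for u using bil by (simp add: bilinear_def)
  define L where "L c = (\<Sum>i\<in>UNIV. (c $ i) *\<^sub>R E i)" for c :: "real^'n"
  have L_lin: "linear L"
    by (rule linearI) (simp_all add: L_def scaleR_add_left sum.distrib scaleR_sum_right)
  have coef: "b (L c) (E j) = c $ j" for c j
    by (simp add: L_def linear_sum[OF lin] linear_cmul[OF lin] orth if_distrib cong: if_cong)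
  have "inj L"
    by (rule injI) (metis coef vec_eq_iff)
  then have "surj L"
    by (rule linear_injective_imp_surjective[OF L_lin]) simp
  then obtain c where "x = L c" by (metis surjD)
  then show ?thesis
    by (simp add: coef) (simp add: L_def)
qed

text \<open>The data of the theorem transported to the image \<open>U\<close> of a chart: the metric \<open>G\<close>, the torsion form
  \<open>T\<close> and an orthonormal frame \<open>Y\<close>.\<close>

locale local_geometry =
  fixes U :: "(real^'n) set" and G :: "real^'n \<Rightarrow> real^'n \<Rightarrow> real^'n \<Rightarrow> real"
    and T :: "real^'n \<Rightarrow> real^'n \<Rightarrow> real^'n \<Rightarrow> real^'n \<Rightarrow> real"
    and Y :: "'n::finite \<Rightarrow> real^'n \<Rightarrow> real^'n"
  assumes U: "open U"
    and ip: "x \<in> U \<Longrightarrow> inner_product (G x)"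
    and G_smooth: "smooth_on U (\<lambda>x. G x v w)"
    and alt: "x \<in> U \<Longrightarrow> alternating3 (T x)"
    and T_smooth: "smooth_on U (\<lambda>x. T x u v w)"
    and Y_smooth: "smooth_on U (Y i)"
    and orth: "x \<in> U \<Longrightarrow> G x (Y i x) (Y j x) = (if i = j then 1 else 0)"
begin

text \<open>The Christoffel symbols of the first kind, obtained from the Koszul formula.\<close>

definition koszul :: "real^'n \<Rightarrow> real^'n \<Rightarrow> real^'n \<Rightarrow> real^'n \<Rightarrow> real" where
  "koszul x v w u = (dir_deriv (\<lambda>y. G y w u) x v + dir_deriv (\<lambda>y. G y v u) x w - dir_deriv (\<lambda>y. G y v w) x u) / 2"

definition christ :: "real^'n \<Rightarrow> real^'n \<Rightarrow> real^'n \<Rightarrow> real^'n" where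
  "christ x v w = sharp (G x) (koszul x v w)"

definition nabla :: "(real^'n \<Rightarrow> real^'n) \<Rightarrow> real^'n \<Rightarrow> real^'n \<Rightarrow> real^'n" where
  "nabla f x v = dir_deriv f x v + christ x v (f x)"

definition nabla_T :: "real^'n \<Rightarrow> real^'n \<Rightarrow> real^'n \<Rightarrow> real^'n \<Rightarrow> real^'n \<Rightarrow> real" where
  "nabla_T x v a b c = dir_deriv (\<lambda>y. T y a b c) x v - T x (christ x v a) b c - T x a (christ x v b) c - T x a b (christ x v c)"

text \<open>The connection forms \<open>g(\<nabla>\<^sub>v e\<^sub>i, e\<^sub>j)\<close> of the Levi-Civita connection.\<close>

definition conn_form :: "real^'n \<Rightarrow> real^'n \<Rightarrow> 'n \<Rightarrow> 'n \<Rightarrow> real" where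
  "conn_form x v i j = G x (nabla (Y i) x v) (Y j x)"

definition curv :: "real^'n \<Rightarrow> real^'n \<Rightarrow> real^'n \<Rightarrow> real^'n \<Rightarrow> real^'n" where
  "curv x v w z = dir_deriv (\<lambda>y. christ y w z) x v - dir_deriv (\<lambda>y. christ y v z) x w
     + christ x v (christ x w z) - christ x w (christ x v z)"

lemma G_bil: "x \<in> U \<Longrightarrow> bilinear (G x)"
  and G_sym: "x \<in> U \<Longrightarrow> G x v w = G x w v"
  using ip by (auto simp: inner_product_def)

lemma G_lin1: "x \<in> U \<Longrightarrow> linear (\<lambda>v. G x v w)"
  and G_lin2: "x \<in> U \<Longrightarrow> linear (G x v)"
  using G_bil by (auto simp: bilinear_def)

lemma T_lin1: "x \<in> U \<Longrightarrow> linear (\<lambda>u. T x u v w)"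
  and T_lin2: "x \<in> U \<Longrightarrow> linear (\<lambda>u. T x v u w)"
  and T_lin3: "x \<in> U \<Longrightarrow> linear (\<lambda>u. T x v w u)"
  using alt by (auto simp: alternating3_def)

lemma T_skew:
  assumes "x \<in> U"
  shows "T x u v w = - T x v u w" "T x u v w = - T x u w v"
proof -
  have *: "T x a a w = 0" "T x w a a = 0" for a w
    using alt[OF assms] by (auto simp: alternating3_def)
  have "T x (u + v) (u + v) w = T x u u w + T x v u w + (T x u v w + T x v v w)"
    by (simp only: linear_add[OF T_lin1[OF assms]] linear_add[OF T_lin2[OF assms]])
  then show "T x u v w = - T x v u w"
    by (simp add: *)
  have "T x u (v + w) (v + w) = T x u v v + T x u w v + (T x u v w + T x u w w)"
    by (simp only: linear_add[OF T_lin2[OF assms]] linear_add[OF T_lin3[OF assms]])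
  then show "T x u v w = - T x u w v"
    by (simp add: *)
qed

lemma G_differentiable: "x \<in> U \<Longrightarrow> (\<lambda>y. G y v w) differentiable (at x)"
  by (rule smooth_on_differentiable[OF G_smooth])

lemma T_differentiable: "x \<in> U \<Longrightarrow> (\<lambda>y. T y u v w) differentiable (at x)"
  by (rule smooth_on_differentiable[OF T_smooth])

lemma Y_differentiable: "x \<in> U \<Longrightarrow> Y i differentiable (at x)"
  by (rule smooth_on_differentiable[OF Y_smooth])

lemma dir_deriv_Y_differentiable: "x \<in> U \<Longrightarrow> (\<lambda>y. dir_deriv (Y i) y v) differentiable (at x)"
  by (rule smooth_on_differentiable[OF smooth_on_dir_deriv[OF Y_smooth]])

lemma has_derivative_G:
  assumes x: "x \<in> U" and f: "f differentiable (at x)" and h: "h differentiable (at x)"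
  shows "((\<lambda>y. G y (f y) (h y)) has_derivative
    (\<lambda>v. dir_deriv (\<lambda>y. G y (f x) (h x)) x v + G x (dir_deriv f x v) (h x) + G x (f x) (dir_deriv h x v))) (at x)"
proof -
  have 1: "((\<lambda>y. G y u (h y)) has_derivative (\<lambda>v. dir_deriv (\<lambda>y. G y u (h x)) x v + G x u (dir_deriv h x v))) (at x)" for u
    by (rule has_derivative_linear_apply[OF U x G_lin2 G_differentiable[OF x] h])
  have "((\<lambda>y. (\<lambda>u. G y u (h y)) (f y)) has_derivative
      (\<lambda>v. dir_deriv (\<lambda>y. G y (f x) (h y)) x v + G x (dir_deriv f x v) (h x))) (at x)"
    by (rule has_derivative_linear_apply[OF U x G_lin1 _ f]) (use 1 in \<open>auto simp: differentiable_def\<close>)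
  then show ?thesis
    by (simp add: dir_deriv_eqI[OF 1] algebra_simps)
qed

lemma has_derivative_T:
  assumes x: "x \<in> U" and f: "f differentiable (at x)" and h: "h differentiable (at x)" and k: "k differentiable (at x)"
  shows "((\<lambda>y. T y (f y) (h y) (k y)) has_derivative
    (\<lambda>v. dir_deriv (\<lambda>y. T y (f x) (h x) (k x)) x v + T x (dir_deriv f x v) (h x) (k x)
      + T x (f x) (dir_deriv h x v) (k x) + T x (f x) (h x) (dir_deriv k x v))) (at x)"
proof -
  have 1: "((\<lambda>y. T y u w (k y)) has_derivative (\<lambda>v. dir_deriv (\<lambda>y. T y u w (k x)) x v + T x u w (dir_deriv k x v))) (at x)" for u w
    by (rule has_derivative_linear_apply[OF U x T_lin3 T_differentiable[OF x] k])
  have 2: "((\<lambda>y. (\<lambda>w. T y u w (k y)) (h y)) has_derivative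
      (\<lambda>v. dir_deriv (\<lambda>y. T y u (h x) (k y)) x v + T x u (dir_deriv h x v) (k x))) (at x)" for u
    by (rule has_derivative_linear_apply[OF U x T_lin2 _ h]) (use 1 in \<open>auto simp: differentiable_def\<close>)
  have "((\<lambda>y. (\<lambda>u. T y u (h y) (k y)) (f y)) has_derivative
      (\<lambda>v. dir_deriv (\<lambda>y. T y (f x) (h y) (k y)) x v + T x (dir_deriv f x v) (h x) (k x))) (at x)"
    by (rule has_derivative_linear_apply[OF U x T_lin1 _ f]) (use 2 in \<open>auto simp: differentiable_def\<close>)
  then show ?thesis
    by (simp add: dir_deriv_eqI[OF 1] dir_deriv_eqI[OF 2] algebra_simps)
qed

lemma koszul_linear_right:
  assumes x: "x \<in> U" shows "linear (koszul x v w)"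
proof -
  have a: "linear (\<lambda>u. dir_deriv (\<lambda>y. G y a u) x b)" for a b
    by (rule linear_dir_deriv_param[OF U x G_lin2 G_differentiable[OF x]])
  have b: "linear (dir_deriv (\<lambda>y. G y v w) x)"
    by (rule has_derivative_linear[OF has_derivative_dir_deriv[OF G_differentiable[OF x]]])
  show ?thesis
    by (rule linearI) (simp_all add: koszul_def linear_add[OF a] linear_add[OF b] linear_cmul[OF a] linear_cmul[OF b] field_simps)
qed

lemma koszul_linear_mid:
  assumes x: "x \<in> U" shows "linear (\<lambda>w. koszul x v w u)"
proof -
  have a: "linear (\<lambda>w. dir_deriv (\<lambda>y. G y w u) x b)" for b
    by (rule linear_dir_deriv_param[OF U x G_lin1 G_differentiable[OF x]])
  have c: "linear (\<lambda>w. dir_deriv (\<lambda>y. G y v w) x b)" for b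
    by (rule linear_dir_deriv_param[OF U x G_lin2 G_differentiable[OF x]])
  have b: "linear (dir_deriv (\<lambda>y. G y v u) x)"
    by (rule has_derivative_linear[OF has_derivative_dir_deriv[OF G_differentiable[OF x]]])
  show ?thesis
    by (rule linearI) (simp_all add: koszul_def linear_add[OF a] linear_add[OF b] linear_add[OF c]
        linear_cmul[OF a] linear_cmul[OF b] linear_cmul[OF c] field_simps)
qed

lemma dir_deriv_G_sym: "x \<in> U \<Longrightarrow> dir_deriv (\<lambda>y. G y v w) x = dir_deriv (\<lambda>y. G y w v) x"
  by (rule dir_deriv_cong[OF U _ G_sym])

lemma koszul_sym: "x \<in> U \<Longrightarrow> koszul x v w u = koszul x w v u"
  using dir_deriv_G_sym[of x v w] by (simp add: koszul_def)

lemma G_christ: "x \<in> U \<Longrightarrow> G x (christ x v w) u = koszul x v w u"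
  unfolding christ_def by (rule sharp_eq[OF ip koszul_linear_right])

lemma christ_sym: "x \<in> U \<Longrightarrow> christ x v w = christ x w v"
  by (rule inner_product_eqI[OF ip]) (auto simp: G_christ koszul_sym)

lemma christ_linear_right: assumes x: "x \<in> U" shows "linear (christ x v)"
proof (rule linearI)
  fix a b r
  show "christ x v (a + b) = christ x v a + christ x v b"
    by (rule inner_product_eqI[OF ip[OF x]])
      (simp add: G_christ[OF x] linear_add[OF G_lin1[OF x]] linear_add[OF koszul_linear_mid[OF x]])
  show "christ x v (r *\<^sub>R b) = r *\<^sub>R christ x v b"
    by (rule inner_product_eqI[OF ip[OF x]])
      (simp add: G_christ[OF x] linear_cmul[OF G_lin1[OF x]] linear_cmul[OF koszul_linear_mid[OF x]])
qed

lemma frame_expansion: "x \<in> U \<Longrightarrow> (\<Sum>i\<in>UNIV. G x v (Y i x) *\<^sub>R Y i x) = v"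
  by (rule orthonormal_expansion[OF ip orth])

text \<open>Expanding in the orthonormal frame replaces the inversion of the metric by a finite sum of
  products of differentiable functions.\<close>

lemma differentiable_christ:
  assumes x: "x \<in> U" shows "(\<lambda>y. christ y v w) differentiable (at x)"
proof -
  have K: "(\<lambda>y. koszul y v w u) differentiable (at x)" for u
    unfolding koszul_def
    by (intro differentiable_divide differentiable_diff differentiable_add smooth_on_differentiable[OF smooth_on_dir_deriv[OF G_smooth] x]) auto
  have KY: "(\<lambda>y. koszul y v w (Y i y)) differentiable (at x)" for i
    using has_derivative_linear_apply[OF U x koszul_linear_right K Y_differentiable[OF x]] by (auto simp: differentiable_def)
  show ?thesis
  proof (rule differentiable_cong_open[OF U x])
    show "christ y v w = (\<Sum>i\<in>UNIV. koszul y v w (Y i y) *\<^sub>R Y i y)" if "y \<in> U" for y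
      using frame_expansion[OF that, of "christ y v w"] by (simp add: G_christ[OF that])
    show "(\<lambda>y. \<Sum>i\<in>UNIV. koszul y v w (Y i y) *\<^sub>R Y i y) differentiable (at x)"
      by (intro differentiable_sum differentiable_scaleR KY Y_differentiable[OF x] ballI finite)
  qed
qed

lemma has_derivative_christ:
  assumes x: "x \<in> U" and f: "f differentiable (at x)"
  shows "((\<lambda>y. christ y w (f y)) has_derivative (\<lambda>v. dir_deriv (\<lambda>y. christ y w (f x)) x v + christ x w (dir_deriv f x v))) (at x)"
  by (rule has_derivative_linear_apply[OF U x christ_linear_right differentiable_christ[OF x] f])

lemma metric_compatible:
  assumes x: "x \<in> U"
  shows "dir_deriv (\<lambda>y. G y w u) x v = G x (christ x v w) u + G x w (christ x v u)"
proof -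
  have s: "dir_deriv (\<lambda>y. G y u w) x v = dir_deriv (\<lambda>y. G y w u) x v"
    using dir_deriv_G_sym[OF x, of u w] by simp
  show ?thesis
    by (simp add: G_sym[OF x, of w] G_christ[OF x]) (simp add: koszul_def s field_simps)
qed

lemma dir_deriv_G:
  assumes x: "x \<in> U" and f: "f differentiable (at x)" and h: "h differentiable (at x)"
  shows "dir_deriv (\<lambda>y. G y (f y) (h y)) x v = G x (nabla f x v) (h x) + G x (f x) (nabla h x v)"
  by (subst dir_deriv_eqI[OF has_derivative_G[OF assms]])
    (simp add: metric_compatible[OF x] nabla_def linear_add[OF G_lin1[OF x]] linear_add[OF G_lin2[OF x]])

lemma dir_deriv_T:
  assumes x: "x \<in> U" and f: "f differentiable (at x)" and h: "h differentiable (at x)" and k: "k differentiable (at x)"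
  shows "dir_deriv (\<lambda>y. T y (f y) (h y) (k y)) x v = nabla_T x v (f x) (h x) (k x)
    + T x (nabla f x v) (h x) (k x) + T x (f x) (nabla h x v) (k x) + T x (f x) (h x) (nabla k x v)"
  by (subst dir_deriv_eqI[OF has_derivative_T[OF assms]])
    (simp add: nabla_def nabla_T_def linear_add[OF T_lin1[OF x]] linear_add[OF T_lin2[OF x]] linear_add[OF T_lin3[OF x]])

lemma conn_form_skew:
  assumes x: "x \<in> U" shows "conn_form x v i j = - conn_form x v j i"
proof -
  have "dir_deriv (\<lambda>y. G y (Y i y) (Y j y)) x v = dir_deriv (\<lambda>y. if i = j then 1 else 0) x v"
    by (subst dir_deriv_cong[OF U x orth]) auto
  also have "\<dots> = 0"
    by (rule dir_deriv_eqI) (rule has_derivative_const)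
  finally show ?thesis
    by (simp add: dir_deriv_G[OF x Y_differentiable[OF x] Y_differentiable[OF x]] conn_form_def G_sym[OF x, of "Y i x"])
qed

lemma nabla_frame: "x \<in> U \<Longrightarrow> nabla (Y i) x v = (\<Sum>c\<in>UNIV. conn_form x v i c *\<^sub>R Y c x)"
  using frame_expansion[of x "nabla (Y i) x v"] by (simp add: conn_form_def)

lemma differentiable_nabla_frame:
  assumes x: "x \<in> U" shows "(\<lambda>y. nabla (Y i) y w) differentiable (at x)"
  unfolding nabla_def
  using has_derivative_christ[OF x Y_differentiable[OF x]] by (intro differentiable_add dir_deriv_Y_differentiable[OF x]) (auto simp: differentiable_def)

lemma differentiable_conn_form: assumes x: "x \<in> U" shows "(\<lambda>y. conn_form y w i j) differentiable (at x)"
  unfolding conn_form_def using has_derivative_G[OF x differentiable_nabla_frame[OF x] Y_differentiable[OF x]] by (auto simp: differentiable_def)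

text \<open>The second derivatives of the frame drop out by symmetry.\<close>

lemma curv_eq_nabla_commutator:
  assumes x: "x \<in> U"
  shows "nabla (\<lambda>y. nabla (Y i) y w) x v - nabla (\<lambda>y. nabla (Y i) y v) x w = curv x v w (Y i x)"
proof -
  have "nabla (\<lambda>y. nabla (Y i) y w) x v = dir_deriv (\<lambda>y. dir_deriv (Y i) y w) x v + dir_deriv (\<lambda>y. christ y w (Y i x)) x v
      + christ x w (dir_deriv (Y i) x v) + christ x v (dir_deriv (Y i) x w) + christ x v (christ x w (Y i x))" for v w
  proof -
    have "dir_deriv (\<lambda>y. nabla (Y i) y w) x v = dir_deriv (\<lambda>y. dir_deriv (Y i) y w) x v + (dir_deriv (\<lambda>y. christ y w (Y i x)) x v + christ x w (dir_deriv (Y i) x v))"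
      unfolding nabla_def
      by (rule dir_deriv_eqI[OF has_derivative_add[OF has_derivative_dir_deriv[OF dir_deriv_Y_differentiable[OF x]] has_derivative_christ[OF x Y_differentiable[OF x]]]])
    then show ?thesis
      by (simp add: nabla_def[of _ x v] nabla_def[of "Y i" x w] linear_add[OF christ_linear_right[OF x]])
  qed
  then show ?thesis
    by (simp add: curv_def second_derivative_symmetric[OF U x Y_smooth, of i w v])
qed

text \<open>Cartan's second structure equation.  It follows by differentiating \<open>g(\<nabla>\<^sub>w e\<^sub>i, e\<^sub>j)\<close> with the compatibility of connection and metric
  and expanding \<open>\<nabla>\<^sub>v e\<^sub>j\<close> in the frame.\<close>

lemma structure_equation:
  assumes x: "x \<in> U"
  shows "dir_deriv (\<lambda>y. conn_form y w i j) x v - dir_deriv (\<lambda>y. conn_form y v i j) x w =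
    G x (curv x v w (Y i x)) (Y j x) + (\<Sum>k\<in>UNIV. conn_form x w i k * conn_form x v j k - conn_form x v i k * conn_form x w j k)"
proof -
  have 1: "dir_deriv (\<lambda>y. conn_form y w i j) x v = G x (nabla (\<lambda>y. nabla (Y i) y w) x v) (Y j x) + G x (nabla (Y i) x w) (nabla (Y j) x v)" for v w
    unfolding conn_form_def by (rule dir_deriv_G[OF x differentiable_nabla_frame[OF x] Y_differentiable[OF x]])
  have 2: "G x (nabla (Y i) x w) (nabla (Y j) x v) = (\<Sum>k\<in>UNIV. conn_form x w i k * conn_form x v j k)" for v w
    by (subst nabla_frame[OF x, of j])
      (simp add: linear_sum[OF G_lin2[OF x]] linear_cmul[OF G_lin2[OF x]] conn_form_def mult.commute)
  show ?thesis
    unfolding 1 2 curv_eq_nabla_commutator[OF x, symmetric] linear_diff[OF G_lin1[OF x]] sum_subtractf by simp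
qed

lemma curv_skew12: "curv x v w z = - curv x w v z"
  by (simp add: curv_def)

text \<open>The connection forms, their derivatives and the quadratic term of the structure equation are skew in
  the frame indices, hence so is the curvature.\<close>

lemma curv_skew34:
  assumes x: "x \<in> U"
  shows "G x (curv x v w (Y i x)) (Y j x) = - G x (curv x v w (Y j x)) (Y i x)"
proof -
  have "dir_deriv (\<lambda>y. conn_form y w i j) x v = - dir_deriv (\<lambda>y. conn_form y w j i) x v" for v w
  proof -
    have "dir_deriv (\<lambda>y. conn_form y w i j) x v = dir_deriv (\<lambda>y. - conn_form y w j i) x v"
      by (subst dir_deriv_cong[OF U x conn_form_skew]) auto
    also have "\<dots> = - dir_deriv (\<lambda>y. conn_form y w j i) x v"
      by (rule dir_deriv_eqI[OF has_derivative_minus[OF has_derivative_dir_deriv[OF differentiable_conn_form[OF x]]]])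
    finally show ?thesis .
  qed
  from this[of w v] this[of v w] show ?thesis
    using structure_equation[OF x, of w i j v] structure_equation[OF x, of w j i v]
    by (simp add: sum_subtractf mult.commute)
qed

text \<open>By the symmetry of the Christoffel symbols all terms cancel in pairs.\<close>

lemma curv_bianchi:
  assumes x: "x \<in> U"
  shows "curv x u v w + curv x v w u + curv x w u v = 0"
proof -
  have "dir_deriv (\<lambda>y. christ y a b) x = dir_deriv (\<lambda>y. christ y b a) x" for a b
    by (rule dir_deriv_cong[OF U x christ_sym])
  then show ?thesis
    by (simp add: curv_def christ_sym[OF x, of v u] christ_sym[OF x, of w v] christ_sym[OF x, of w u])
qed

definition torsion_form :: "real^'n \<Rightarrow> real^'n \<Rightarrow> 'n \<Rightarrow> 'n \<Rightarrow> real" where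
  "torsion_form x v i j = T x v (Y i x) (Y j x)"

text \<open>Connection forms of the connection with torsion; the factor \<open>1/2\<close> is that of \<open>\<nabla> = \<nabla>\<^sup>g + T/2\<close>.\<close>

definition torsion_conn_form :: "real^'n \<Rightarrow> real^'n \<Rightarrow> 'n \<Rightarrow> 'n \<Rightarrow> real" where
  "torsion_conn_form x v i j = conn_form x v i j + torsion_form x v i j / 2"

lemma torsion_form_skew: "x \<in> U \<Longrightarrow> torsion_form x v i j = - torsion_form x v j i"
  unfolding torsion_form_def by (rule T_skew)

lemma torsion_conn_form_skew: "x \<in> U \<Longrightarrow> skew (torsion_conn_form x v)"
  unfolding skew_def torsion_conn_form_def using conn_form_skew[of x v] torsion_form_skew[of x v] by (metis add_uminus_conv_diff minus_add_distrib minus_divide_left uminus_add_conv_diff add.commute)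

lemma differentiable_torsion_form:
  assumes x: "x \<in> U" shows "(\<lambda>y. torsion_form y w i j) differentiable (at x)"
  unfolding torsion_form_def by (rule differentiableI[OF has_derivative_T[OF x differentiable_const Y_differentiable[OF x] Y_differentiable[OF x]]])

text \<open>The direction \<open>w\<close> is a constant vector, not a parallel one; this is the origin of the term with the Christoffel symbol, which is symmetric
  in \<open>v\<close> and \<open>w\<close> and disappears from the curvature.\<close>

lemma dir_deriv_torsion_form:
  assumes x: "x \<in> U"
  shows "dir_deriv (\<lambda>y. torsion_form y w i j) x v = nabla_T x v w (Y i x) (Y j x) + T x (christ x v w) (Y i x) (Y j x)
    + (\<Sum>c\<in>UNIV. conn_form x v i c * torsion_form x w c j + conn_form x v j c * torsion_form x w i c)"
proof -
  have "dir_deriv (\<lambda>y. w) x v = 0"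
    by (rule dir_deriv_eqI) (rule has_derivative_const)
  then have c: "nabla (\<lambda>y. w) x v = christ x v w"
    by (simp add: nabla_def)
  have "dir_deriv (\<lambda>y. T y w (Y i y) (Y j y)) x v = nabla_T x v w (Y i x) (Y j x) + T x (christ x v w) (Y i x) (Y j x)
    + T x w (nabla (Y i) x v) (Y j x) + T x w (Y i x) (nabla (Y j) x v)"
    by (subst dir_deriv_T[OF x differentiable_const Y_differentiable[OF x] Y_differentiable[OF x]]) (simp add: c)
  then show ?thesis
    by (simp add: torsion_form_def nabla_frame[OF x] linear_sum[OF T_lin2[OF x]] linear_sum[OF T_lin3[OF x]]
        linear_cmul[OF T_lin2[OF x]] linear_cmul[OF T_lin3[OF x]] sum.distrib)
qed

text \<open>Curvature forms of the connection with torsion, \<open>dm + m \<and> m\<close>.\<close>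

definition torsion_curv_form :: "real^'n \<Rightarrow> real^'n \<Rightarrow> real^'n \<Rightarrow> 'n \<Rightarrow> 'n \<Rightarrow> real" where
  "torsion_curv_form x v w i j = dir_deriv (\<lambda>y. torsion_conn_form y w i j) x v - dir_deriv (\<lambda>y. torsion_conn_form y v i j) x w
    + (\<Sum>k\<in>UNIV. torsion_conn_form x v i k * torsion_conn_form x w j k - torsion_conn_form x w i k * torsion_conn_form x v j k)"

lemma dir_deriv_torsion_conn_form:
  assumes x: "x \<in> U"
  shows "dir_deriv (\<lambda>y. torsion_conn_form y w i j) x v = dir_deriv (\<lambda>y. conn_form y w i j) x v + dir_deriv (\<lambda>y. torsion_form y w i j) x v / 2"
  unfolding torsion_conn_form_def
  by (rule dir_deriv_eqI[OF has_derivative_add[OF has_derivative_dir_deriv[OF differentiable_conn_form[OF x]]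
        bounded_linear.has_derivative[OF bounded_linear_divide has_derivative_dir_deriv[OF differentiable_torsion_form[OF x]]]]])

lemma differentiable_torsion_conn_form: "x \<in> U \<Longrightarrow> (\<lambda>y. torsion_conn_form y w i j) differentiable (at x)"
  unfolding torsion_conn_form_def by (intro differentiable_add differentiable_divide differentiable_conn_form differentiable_torsion_form) auto

text \<open>Substituting \<open>m = \<omega> + T/2\<close>, the terms of \<open>m \<and> m\<close> that are linear in the torsion are exactly those that turn
  the derivatives of its components into covariant derivatives.\<close>

lemma curvature_with_torsion:
  assumes x: "x \<in> U"
  shows "torsion_curv_form x v w i j = G x (curv x v w (Y i x)) (Y j x)
    + (nabla_T x v w (Y i x) (Y j x) - nabla_T x w v (Y i x) (Y j x)) / 2
    + (\<Sum>k\<in>UNIV. torsion_form x v i k * torsion_form x w j k - torsion_form x w i k * torsion_form x v j k) / 4"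
proof -
  have pt: "(conn_form x w i k * conn_form x v j k - conn_form x v i k * conn_form x w j k)
      + (conn_form x v i k * torsion_form x w k j + conn_form x v j k * torsion_form x w i k) / 2
      - (conn_form x w i k * torsion_form x v k j + conn_form x w j k * torsion_form x v i k) / 2
      + (torsion_conn_form x v i k * torsion_conn_form x w j k - torsion_conn_form x w i k * torsion_conn_form x v j k)
      = (torsion_form x v i k * torsion_form x w j k - torsion_form x w i k * torsion_form x v j k) / 4" for k
    by (simp add: torsion_conn_form_def torsion_form_skew[OF x, of _ k j] field_simps)
  have "torsion_curv_form x v w i j = (dir_deriv (\<lambda>y. conn_form y w i j) x v - dir_deriv (\<lambda>y. conn_form y v i j) x w)
     + (dir_deriv (\<lambda>y. torsion_form y w i j) x v - dir_deriv (\<lambda>y. torsion_form y v i j) x w) / 2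
     + (\<Sum>k\<in>UNIV. torsion_conn_form x v i k * torsion_conn_form x w j k - torsion_conn_form x w i k * torsion_conn_form x v j k)"
    by (simp add: torsion_curv_form_def dir_deriv_torsion_conn_form[OF x] field_simps)
  also have "\<dots> = G x (curv x v w (Y i x)) (Y j x)
    + (nabla_T x v w (Y i x) (Y j x) - nabla_T x w v (Y i x) (Y j x)) / 2
    + (\<Sum>k\<in>UNIV. (conn_form x w i k * conn_form x v j k - conn_form x v i k * conn_form x w j k)
      + (conn_form x v i k * torsion_form x w k j + conn_form x v j k * torsion_form x w i k) / 2
      - (conn_form x w i k * torsion_form x v k j + conn_form x w j k * torsion_form x v i k) / 2
      + (torsion_conn_form x v i k * torsion_conn_form x w j k - torsion_conn_form x w i k * torsion_conn_form x v j k))"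
  proof -
    have "(\<Sum>k\<in>UNIV. (conn_form x w i k * conn_form x v j k - conn_form x v i k * conn_form x w j k)
      + (conn_form x v i k * torsion_form x w k j + conn_form x v j k * torsion_form x w i k) / 2
      - (conn_form x w i k * torsion_form x v k j + conn_form x w j k * torsion_form x v i k) / 2
      + (torsion_conn_form x v i k * torsion_conn_form x w j k - torsion_conn_form x w i k * torsion_conn_form x v j k)) =
      (\<Sum>k\<in>UNIV. conn_form x w i k * conn_form x v j k - conn_form x v i k * conn_form x w j k)
      + (\<Sum>k\<in>UNIV. conn_form x v i k * torsion_form x w k j + conn_form x v j k * torsion_form x w i k) / 2
      - (\<Sum>k\<in>UNIV. conn_form x w i k * torsion_form x v k j + conn_form x w j k * torsion_form x v i k) / 2
      + (\<Sum>k\<in>UNIV. torsion_conn_form x v i k * torsion_conn_form x w j k - torsion_conn_form x w i k * torsion_conn_form x v j k)"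
      by (simp only: sum.distrib[symmetric] sum_subtractf[symmetric] sum_divide_distrib)
    then show ?thesis
      unfolding structure_equation[OF x] dir_deriv_torsion_form[OF x] christ_sym[OF x, of v w]
      by (simp add: diff_divide_distrib add_divide_distrib)
  qed
  finally show ?thesis
    unfolding pt by (simp add: sum_divide_distrib)
qed

definition torsion_coeff :: "real^'n \<Rightarrow> 'n \<Rightarrow> 'n \<Rightarrow> 'n \<Rightarrow> real" where
  "torsion_coeff x i j k = T x (Y i x) (Y j x) (Y k x)"

lemma differentiable_torsion_coeff:
  assumes x: "x \<in> U" shows "(\<lambda>y. torsion_coeff y i j k) differentiable (at x)"
  unfolding torsion_coeff_def by (rule differentiableI[OF has_derivative_T[OF x Y_differentiable[OF x] Y_differentiable[OF x] Y_differentiable[OF x]]])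

lemma dir_deriv_torsion_coeff:
  assumes x: "x \<in> U"
  shows "dir_deriv (\<lambda>y. torsion_coeff y i j k) x v = nabla_T x v (Y i x) (Y j x) (Y k x)
    + (\<Sum>c\<in>UNIV. conn_form x v i c * torsion_coeff x c j k + conn_form x v j c * torsion_coeff x i c k + conn_form x v k c * torsion_coeff x i j c)"
  unfolding torsion_coeff_def
  by (subst dir_deriv_T[OF x Y_differentiable[OF x] Y_differentiable[OF x] Y_differentiable[OF x]])
    (simp add: nabla_frame[OF x] linear_sum[OF T_lin1[OF x]] linear_sum[OF T_lin2[OF x]] linear_sum[OF T_lin3[OF x]]
        linear_cmul[OF T_lin1[OF x]] linear_cmul[OF T_lin2[OF x]] linear_cmul[OF T_lin3[OF x]] sum.distrib)

lemma skew3_torsion_coeff: "x \<in> U \<Longrightarrow> skew3 (torsion_coeff x)"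
  unfolding skew3_def torsion_coeff_def using T_skew by blast

lemma nabla_T_skew:
  assumes x: "x \<in> U"
  shows "nabla_T x v a b c = - nabla_T x v b a c" "nabla_T x v a b c = - nabla_T x v a c b"
proof -
  have m: "dir_deriv (\<lambda>y. - T y a b c) x v = - dir_deriv (\<lambda>y. T y a b c) x v" for a b c
    by (rule dir_deriv_eqI[OF has_derivative_minus[OF has_derivative_dir_deriv[OF T_differentiable[OF x]]]])
  have 1: "dir_deriv (\<lambda>y. T y a b c) x v = - dir_deriv (\<lambda>y. T y b a c) x v" for a b c
    unfolding m[symmetric] by (subst dir_deriv_cong[OF U x T_skew(1)]) auto
  have 2: "dir_deriv (\<lambda>y. T y a b c) x v = - dir_deriv (\<lambda>y. T y a c b) x v" for a b c
    unfolding m[symmetric] by (subst dir_deriv_cong[OF U x T_skew(2)]) auto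
  show "nabla_T x v a b c = - nabla_T x v b a c"
    unfolding nabla_T_def using 1[of a b c] T_skew(1)[OF x, of "christ x v a" b c] T_skew(1)[OF x, of a "christ x v b" c]
      T_skew(1)[OF x, of a b "christ x v c"] by simp
  show "nabla_T x v a b c = - nabla_T x v a c b"
    unfolding nabla_T_def using 2[of a b c] T_skew(2)[OF x, of "christ x v a" b c] T_skew(2)[OF x, of a "christ x v b" c]
      T_skew(2)[OF x, of a b "christ x v c"] by simp
qed

text \<open>Antisymmetrisation removes the Christoffel symbols because they are symmetric.\<close>

lemma ext_deriv_eq_nabla_T:
  assumes x: "x \<in> U"
  shows "dir_deriv (\<lambda>y. T y b c d) x a - dir_deriv (\<lambda>y. T y a c d) x b + dir_deriv (\<lambda>y. T y a b d) x c - dir_deriv (\<lambda>y. T y a b c) x d =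
    nabla_T x a b c d - nabla_T x b a c d + nabla_T x c a b d - nabla_T x d a b c"
proof -
  note s = christ_sym[OF x]
  show ?thesis
    unfolding nabla_T_def
    using T_skew[OF x, of a "christ x b c" d] T_skew[OF x, of a b "christ x c d"] T_skew[OF x, of a "christ x b d" c]
      T_skew[OF x, of "christ x a d" b c] T_skew[OF x, of "christ x a c" b d] T_skew[OF x, of b "christ x a d" c] T_skew[OF x, of b "christ x a c" d]
      T_skew[OF x, of "christ x c d" a b] T_skew[OF x, of a c "christ x b d"]  T_skew[OF x, of b c "christ x a d"]
    by (simp add: s[of b a] s[of c a] s[of d a] s[of c b] s[of d b] s[of d c])
qed

end

section \<open>Complex matrices as a real algebra\<close>

text \<open>The type of matrices already has the componentwise product as its multiplication.  A copy of it
  carries the matrix product, so that the identities in a real algebra apply.\<close>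

typedef 'd cmat = "UNIV :: (complex^'d^'d) set"
  morphisms mat_of Cmat ..

setup_lifting type_definition_cmat

lemma scaleR_matrix_mult: "(r *\<^sub>R A) ** B = r *\<^sub>R (A ** B)" "A ** (r *\<^sub>R B) = r *\<^sub>R (A ** B)"
  for A :: "complex^'m^'n" and B :: "complex^'k^'m"
  by (simp_all add: vec_eq_iff matrix_matrix_mult_def scaleR_sum_right)

lemma matrix_mult_distrib_right: "(A + B) ** C = A ** C + B ** C"
  for A B :: "complex^'m^'n" and C :: "complex^'k^'m"
  by (simp add: vec_eq_iff matrix_matrix_mult_def sum.distrib distrib_right)

lemma zero_neq_mat_1: "(0 :: complex^'n^'n) \<noteq> mat 1"
proof
  assume "(0 :: complex^'n^'n) = mat 1"
  moreover have "(mat 1 :: complex^'n^'n) $ undefined $ undefined = 1"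
    by (simp add: mat_def)
  ultimately show False
    by (metis zero_index zero_neq_one)
qed

instantiation cmat :: (finite) real_algebra_1
begin

lift_definition zero_cmat :: "'a cmat" is 0 .
lift_definition one_cmat :: "'a cmat" is "mat 1" .
lift_definition plus_cmat :: "'a cmat \<Rightarrow> 'a cmat \<Rightarrow> 'a cmat" is "(+)" .
lift_definition minus_cmat :: "'a cmat \<Rightarrow> 'a cmat \<Rightarrow> 'a cmat" is "(-)" .
lift_definition uminus_cmat :: "'a cmat \<Rightarrow> 'a cmat" is uminus .
lift_definition times_cmat :: "'a cmat \<Rightarrow> 'a cmat \<Rightarrow> 'a cmat" is "(**)" .
lift_definition scaleR_cmat :: "real \<Rightarrow> 'a cmat \<Rightarrow> 'a cmat" is scaleR .

instance
  by (standard; transfer)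
    (simp_all add: matrix_mul_assoc matrix_add_ldistrib matrix_mult_distrib_right scaleR_matrix_mult
      zero_neq_mat_1 scaleR_add_right scaleR_add_left ac_simps)

end

definition act :: "'d::finite cmat \<Rightarrow> complex^'d \<Rightarrow> complex^'d" where
  "act M x = mat_of M *v x"

lemma act_mult: "act (M * N) x = act M (act N x)"
  by (simp add: act_def times_cmat.rep_eq matrix_vector_mul_assoc)

lemma act_one: "act 1 x = x"
  by (simp add: act_def one_cmat.rep_eq)

lemma act_add: "act (M + N) x = act M x + act N x"
  by (simp add: act_def plus_cmat.rep_eq matrix_vector_mult_add_rdistrib)

lemma act_scaleR: "act (r *\<^sub>R M) x = r *\<^sub>R act M x"
  by (simp add: act_def scaleR_cmat.rep_eq scaleR_matrix_vector)

lemma act_linear1: "linear (\<lambda>M. act M x)"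
  by (rule linearI) (simp_all add: act_add act_scaleR)

lemma act_linear2: "linear (act M)"
  by (rule linearI) (simp_all add: act_def matrix_vector_right_distrib vec_eq_iff matrix_vector_mult_def
      scaleR_sum_right sum.distrib distrib_left)

lemma act_bounded_linear: "bounded_linear (act M)"
  using act_linear2 linear_conv_bounded_linear by blast

lemmas act_simps = linear_add[OF act_linear1] linear_diff[OF act_linear1] linear_neg[OF act_linear1]
  linear_cmul[OF act_linear1] linear_0[OF act_linear1] linear_sum[OF act_linear1]
  linear_add[OF act_linear2] linear_diff[OF act_linear2] linear_neg[OF act_linear2]
  linear_cmul[OF act_linear2] linear_0[OF act_linear2] linear_sum[OF act_linear2] act_mult act_one

lemma mat_of_add: "mat_of (M + N) = mat_of M + mat_of N"
  and mat_of_scaleR: "mat_of (r *\<^sub>R M) = r *\<^sub>R mat_of M"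
  and mat_of_mult: "mat_of (M * N) = mat_of M ** mat_of N"
  and mat_of_uminus: "mat_of (- M) = - mat_of M"
  and mat_of_zero: "mat_of 0 = 0"
  by (simp_all add: uminus_cmat.rep_eq plus_cmat.rep_eq scaleR_cmat.rep_eq times_cmat.rep_eq zero_cmat.rep_eq)

lemma mat_of_sum: "mat_of (\<Sum>i\<in>S. M i) = (\<Sum>i\<in>S. mat_of (M i))"
  by (induction S rule: infinite_finite_induct) (simp_all add: mat_of_add mat_of_zero)

lemma act_gamma: "act (Cmat M) z = M *v z"
  by (simp add: act_def Cmat_inverse)

lemma cliff2_eq: "cliff2 \<gamma> E w *v z = act (cl2 (\<lambda>i. Cmat (\<gamma> i)) (\<lambda>i j. w (E i) (E j))) z"
  by (simp add: act_def cl2_def cliff2_def mat_of_scaleR mat_of_sum mat_of_mult Cmat_inverse)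

lemma cliff3_eq: "cliff3 \<gamma> E w *v z = act (cl3 (\<lambda>i. Cmat (\<gamma> i)) (\<lambda>i j k. w (E i) (E j) (E k))) z"
  by (simp add: act_def cl3_def cliff3_def mat_of_scaleR mat_of_sum mat_of_mult Cmat_inverse)

lemma cliff4_eq: "cliff4 \<gamma> E w *v z = act (cl4 (\<lambda>i. Cmat (\<gamma> i)) (\<lambda>i j k l. w (E i) (E j) (E k) (E l))) z"
  by (simp add: act_def cl4_def cliff4_def mat_of_scaleR mat_of_sum mat_of_mult Cmat_inverse)

lemma clifford_family_Cmat:
  assumes "spinor_module \<gamma>"
  shows "clifford_family (\<lambda>i. Cmat (\<gamma> i))"
proof
  fix i j
  have "\<gamma> i ** \<gamma> j + \<gamma> j ** \<gamma> i = (if i = j then - 2 *\<^sub>R mat 1 else 0)"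
    using assms by (simp add: spinor_module_def)
  then have "mat_of (Cmat (\<gamma> i) * Cmat (\<gamma> j) + Cmat (\<gamma> j) * Cmat (\<gamma> i)) = mat_of (if i = j then - 2 *\<^sub>R 1 else 0)"
    by (auto simp: mat_of_add mat_of_mult Cmat_inverse mat_of_scaleR mat_of_uminus mat_of_zero one_cmat.rep_eq)
  then show "Cmat (\<gamma> i) * Cmat (\<gamma> j) + Cmat (\<gamma> j) * Cmat (\<gamma> i) = (if i = j then - 2 *\<^sub>R 1 else 0)"
    by (simp only: mat_of_inject)
qed

section \<open>Parallel spinors in a chart\<close>

lemma has_derivative_act_cl2:
  assumes w: "\<And>i j. (\<lambda>y. w y i j) differentiable (at x)" and f: "f differentiable (at x)"
  shows "((\<lambda>y. act (cl2 \<gamma> (w y)) (f y)) has_derivative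
    (\<lambda>v. act (cl2 \<gamma> (\<lambda>i j. dir_deriv (\<lambda>y. w y i j) x v)) (f x) + act (cl2 \<gamma> (w x)) (dir_deriv f x v))) (at x)"
proof -
  have "((\<lambda>y. (1/2) *\<^sub>R (\<Sum>i\<in>UNIV. \<Sum>j\<in>UNIV. w y i j *\<^sub>R act (\<gamma> i * \<gamma> j) (f y))) has_derivative
    (\<lambda>v. (1/2) *\<^sub>R (\<Sum>i\<in>UNIV. \<Sum>j\<in>UNIV. w x i j *\<^sub>R act (\<gamma> i * \<gamma> j) (dir_deriv f x v)
        + dir_deriv (\<lambda>y. w y i j) x v *\<^sub>R act (\<gamma> i * \<gamma> j) (f x)))) (at x)"
    by (intro has_derivative_scaleR_right has_derivative_sum has_derivative_scaleR
        has_derivative_dir_deriv[OF w] bounded_linear.has_derivative[OF act_bounded_linear] has_derivative_dir_deriv[OF f])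
  then show ?thesis
    by (simp add: cl2_def act_simps sum.distrib scaleR_add_right add.commute del: act_mult)
qed

lemma has_derivative_act_cl3:
  assumes w: "\<And>i j k. (\<lambda>y. w y i j k) differentiable (at x)" and f: "f differentiable (at x)"
  shows "((\<lambda>y. act (cl3 \<gamma> (w y)) (f y)) has_derivative
    (\<lambda>v. act (cl3 \<gamma> (\<lambda>i j k. dir_deriv (\<lambda>y. w y i j k) x v)) (f x) + act (cl3 \<gamma> (w x)) (dir_deriv f x v))) (at x)"
proof -
  have "((\<lambda>y. (1/6) *\<^sub>R (\<Sum>i\<in>UNIV. \<Sum>j\<in>UNIV. \<Sum>k\<in>UNIV. w y i j k *\<^sub>R act (\<gamma> i * \<gamma> j * \<gamma> k) (f y))) has_derivative
    (\<lambda>v. (1/6) *\<^sub>R (\<Sum>i\<in>UNIV. \<Sum>j\<in>UNIV. \<Sum>k\<in>UNIV. w x i j k *\<^sub>R act (\<gamma> i * \<gamma> j * \<gamma> k) (dir_deriv f x v)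
        + dir_deriv (\<lambda>y. w y i j k) x v *\<^sub>R act (\<gamma> i * \<gamma> j * \<gamma> k) (f x)))) (at x)"
    by (intro has_derivative_scaleR_right has_derivative_sum has_derivative_scaleR
        has_derivative_dir_deriv[OF w] bounded_linear.has_derivative[OF act_bounded_linear] has_derivative_dir_deriv[OF f])
  then show ?thesis
    by (simp add: cl3_def act_simps sum.distrib scaleR_add_right add.commute)
qed

text \<open>The factor \<open>1/2\<close> in the parallelism condition is the \<open>1/4\<close> of the spinor lift, because \<open>cl2\<close> counts every pair of indices once.\<close>

locale local_spinor = local_geometry U G T Y + clifford_family \<gamma>
  for U :: "(real^'n::finite) set" and G T Y and \<gamma> :: "'n \<Rightarrow> 'd::finite cmat" +
  fixes \<psi> :: "real^'n \<Rightarrow> complex^'d"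
  assumes psi_smooth: "smooth_on U \<psi>"
    and parallel: "x \<in> U \<Longrightarrow> dir_deriv \<psi> x v = - (1/2) *\<^sub>R act (cl2 \<gamma> (torsion_conn_form x v)) (\<psi> x)"
begin

definition dirac :: "(real^'n \<Rightarrow> complex^'d) \<Rightarrow> real^'n \<Rightarrow> complex^'d" where
  "dirac f x = (\<Sum>a\<in>UNIV. act (\<gamma> a) (dir_deriv f x (Y a x) + (1/2) *\<^sub>R act (cl2 \<gamma> (conn_form x (Y a x))) (f x)))"

text \<open>The operator \<open>D\<^sup>1\<^sup>/\<^sup>3 = D\<^sup>g + T/4\<close>.\<close>

definition dirac_one_third :: "(real^'n \<Rightarrow> complex^'d) \<Rightarrow> real^'n \<Rightarrow> complex^'d" where
  "dirac_one_third f x = dirac f x + (1/4) *\<^sub>R act (cl3 \<gamma> (torsion_coeff x)) (f x)"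

lemma psi_differentiable: "x \<in> U \<Longrightarrow> \<psi> differentiable (at x)"
  by (rule smooth_on_differentiable[OF psi_smooth])

text \<open>The integrability condition: substituting \<open>\<partial>\<^sub>v \<psi> = -(1/2) m\<^sub>v \<psi>\<close> twice into the symmetry of the
  second derivatives of \<open>\<psi>\<close> leaves the curvature acting on \<open>\<psi>\<close>.\<close>

lemma curvature_annihilates:
  assumes x: "x \<in> U" shows "act (cl2 \<gamma> (torsion_curv_form x v w)) (\<psi> x) = 0"
proof -
  let ?m = "\<lambda>v. cl2 \<gamma> (torsion_conn_form x v)" and ?d = "\<lambda>v w. cl2 \<gamma> (\<lambda>i j. dir_deriv (\<lambda>y. torsion_conn_form y w i j) x v)"
  have dd2: "dir_deriv (\<lambda>y. dir_deriv \<psi> y w) x v = act (- (1/2) *\<^sub>R ?d v w + (1/4) *\<^sub>R (?m w * ?m v)) (\<psi> x)" for v w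
  proof -
    have "dir_deriv (\<lambda>y. dir_deriv \<psi> y w) x v = dir_deriv (\<lambda>y. - (1/2) *\<^sub>R act (cl2 \<gamma> (torsion_conn_form y w)) (\<psi> y)) x v"
      by (subst dir_deriv_cong[OF U x parallel]) auto
    also have "\<dots> = - (1/2) *\<^sub>R (act (?d v w) (\<psi> x) + act (?m w) (dir_deriv \<psi> x v))"
      by (rule dir_deriv_eqI[OF has_derivative_scaleR_right[OF has_derivative_act_cl2[OF differentiable_torsion_conn_form[OF x] psi_differentiable[OF x]]]])
    finally show ?thesis
      by (simp add: parallel[OF x] act_simps scaleR_add_right scaleR_diff_right)
  qed
  have "cl2 \<gamma> (torsion_curv_form x v w) = ?d v w - ?d w v
      + cl2 \<gamma> (\<lambda>i j. \<Sum>k\<in>UNIV. torsion_conn_form x v i k * torsion_conn_form x w j k - torsion_conn_form x w i k * torsion_conn_form x v j k)"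
    unfolding torsion_curv_form_def[abs_def] cl2_add cl2_diff ..
  also have "\<dots> = ?d v w - ?d w v + (1/2) *\<^sub>R (?m v * ?m w - ?m w * ?m v)"
    by (simp add: cl2_commutator[OF torsion_conn_form_skew[OF x] torsion_conn_form_skew[OF x]])
  also have "\<dots> = - 2 *\<^sub>R ((- (1/2) *\<^sub>R ?d v w + (1/4) *\<^sub>R (?m w * ?m v))
      - (- (1/2) *\<^sub>R ?d w v + (1/4) *\<^sub>R (?m v * ?m w)))"
    by (simp add: algebra_simps)
  finally have "act (cl2 \<gamma> (torsion_curv_form x v w)) (\<psi> x) =
      - 2 *\<^sub>R (dir_deriv (\<lambda>y. dir_deriv \<psi> y w) x v - dir_deriv (\<lambda>y. dir_deriv \<psi> y v) x w)"
    unfolding dd2 by (simp only: linear_diff[OF act_linear1] linear_cmul[OF act_linear1])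
  then show ?thesis
    by (simp add: second_derivative_symmetric[OF U x psi_smooth, of w v])
qed

lemma cl2_torsion_conn_form: "cl2 \<gamma> (torsion_conn_form x (Y a x)) = cl2 \<gamma> (conn_form x (Y a x)) + (1/2) *\<^sub>R cl2 \<gamma> (torsion_coeff x a)"
proof -
  have "torsion_conn_form x (Y a x) = (\<lambda>i j. conn_form x (Y a x) i j + (1/2) * torsion_coeff x a i j)"
    by (simp add: torsion_conn_form_def torsion_form_def torsion_coeff_def fun_eq_iff)
  then show ?thesis by (simp only: cl2_add cl2_scale)
qed

text \<open>On a parallel spinor \<open>\<nabla>\<^sup>g\<^sub>a \<psi> = -(1/4) \<omega>\<^sub>a \<psi>\<close>, so \<open>D\<^sup>g \<psi> = -(3/4) T \<psi>\<close>, since \<open>\<Sum>\<^sub>a \<gamma>\<^sub>a \<omega>\<^sub>a = 3T\<close>.\<close>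

lemma dirac_one_third_psi: assumes x: "x \<in> U" shows "dirac_one_third \<psi> x = - (1/2) *\<^sub>R act (cl3 \<gamma> (torsion_coeff x)) (\<psi> x)"
proof -
  have "dir_deriv \<psi> x (Y a x) + (1/2) *\<^sub>R act (cl2 \<gamma> (conn_form x (Y a x))) (\<psi> x) = - (1/4) *\<^sub>R act (cl2 \<gamma> (torsion_coeff x a)) (\<psi> x)" for a
    by (simp add: parallel[OF x] cl2_torsion_conn_form act_simps scaleR_add_right)
  then have "dirac \<psi> x = - (1/4) *\<^sub>R act (\<Sum>a\<in>UNIV. \<gamma> a * cl2 \<gamma> (torsion_coeff x a)) (\<psi> x)"
    unfolding dirac_def by (simp add: act_simps scaleR_sum_right sum_negf)
  then show ?thesis
    unfolding dirac_one_third_def sum_gamma_cl2 by (simp add: act_simps flip: scaleR_left_distrib scaleR_left_diff_distrib)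
qed

lemma dirac_one_third_cong:
  assumes x: "x \<in> U" and "\<And>y. y \<in> U \<Longrightarrow> f y = h y"
  shows "dirac_one_third f x = dirac_one_third h x"
  using dir_deriv_cong[OF U x assms(2)] assms(2)[OF x] by (simp add: dirac_one_third_def dirac_def)

text \<open>Since \<open>D\<^sup>1\<^sup>/\<^sup>3 \<psi> = -(1/2) T \<psi>\<close> holds in a neighbourhood, the operator can be applied again.  The product rule
  produces \<open>\<nabla>T\<close>, and \<open>\<nabla>\<^sup>g \<psi>\<close> is once more replaced by \<open>-(1/4) \<omega>\<^sub>a \<psi>\<close>: no derivative of \<open>\<psi>\<close> is left.\<close>

lemma dirac_one_third_squared_psi:
  assumes x: "x \<in> U"
  shows "dirac_one_third (dirac_one_third \<psi>) x = act (- (1/2) *\<^sub>R (\<Sum>a\<in>UNIV. \<gamma> a * cl3 \<gamma> (\<lambda>i j k. nabla_T x (Y a x) (Y i x) (Y j x) (Y k x)))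
      + (1/8) *\<^sub>R (\<Sum>a\<in>UNIV. \<gamma> a * (cl3 \<gamma> (torsion_coeff x) * cl2 \<gamma> (torsion_coeff x a)))
      - (1/8) *\<^sub>R (cl3 \<gamma> (torsion_coeff x) * cl3 \<gamma> (torsion_coeff x))) (\<psi> x)"
proof -
  let ?T = "cl3 \<gamma> (torsion_coeff x)" and ?\<phi> = "\<lambda>y. - (1/2) *\<^sub>R act (cl3 \<gamma> (torsion_coeff y)) (\<psi> y)"
  let ?N = "\<lambda>a. cl3 \<gamma> (\<lambda>i j k. nabla_T x (Y a x) (Y i x) (Y j x) (Y k x))"
  have d: "dir_deriv ?\<phi> x v = - (1/2) *\<^sub>R (act (cl3 \<gamma> (\<lambda>i j k. dir_deriv (\<lambda>y. torsion_coeff y i j k) x v)) (\<psi> x) + act ?T (dir_deriv \<psi> x v))" for v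
    by (rule dir_deriv_eqI[OF has_derivative_scaleR_right[OF has_derivative_act_cl3[OF differentiable_torsion_coeff[OF x] psi_differentiable[OF x]]]])
  \<comment> \<open>The commutator of the connection form with T completes the derivative of its components to the covariant derivative.\<close>
  have bracket: "dir_deriv ?\<phi> x (Y a x) + (1/2) *\<^sub>R act (cl2 \<gamma> (conn_form x (Y a x))) (?\<phi> x) =
      act (- (1/2) *\<^sub>R ?N a + (1/8) *\<^sub>R (?T * cl2 \<gamma> (torsion_coeff x a))) (\<psi> x)" for a
  proof -
    let ?w = "cl2 \<gamma> (conn_form x (Y a x))"
    let ?c = "cl3 \<gamma> (\<lambda>i j k. \<Sum>c\<in>UNIV. conn_form x (Y a x) i c * torsion_coeff x c j k + conn_form x (Y a x) j c * torsion_coeff x i c k + conn_form x (Y a x) k c * torsion_coeff x i j c)"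
    have s: "skew (conn_form x (Y a x))"
      unfolding skew_def using conn_form_skew[OF x] by blast
    have "dir_deriv ?\<phi> x (Y a x) + (1/2) *\<^sub>R act ?w (?\<phi> x) =
      act (- (1/2) *\<^sub>R (?N a + ?c) + (1/4) *\<^sub>R (?T * (?w + (1/2) *\<^sub>R cl2 \<gamma> (torsion_coeff x a))) - (1/4) *\<^sub>R (?w * ?T)) (\<psi> x)"
      unfolding d dir_deriv_torsion_coeff[OF x] cl3_add parallel[OF x] cl2_torsion_conn_form
      by (simp add: act_simps scaleR_add_right scaleR_diff_right)
    also have "- (1/2) *\<^sub>R (?N a + ?c) + (1/4) *\<^sub>R (?T * (?w + (1/2) *\<^sub>R cl2 \<gamma> (torsion_coeff x a))) - (1/4) *\<^sub>R (?w * ?T) =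
        - (1/2) *\<^sub>R ?N a + (1/8) *\<^sub>R (?T * cl2 \<gamma> (torsion_coeff x a))"
      unfolding cl2_cl3_commutator[OF s]
      by (simp add: algebra_simps)
    finally show ?thesis .
  qed
  have "dirac_one_third (dirac_one_third \<psi>) x = dirac_one_third ?\<phi> x"
    by (rule dirac_one_third_cong[OF x dirac_one_third_psi])
  also have "\<dots> = (\<Sum>a\<in>UNIV. act (\<gamma> a) (act (- (1/2) *\<^sub>R ?N a + (1/8) *\<^sub>R (?T * cl2 \<gamma> (torsion_coeff x a))) (\<psi> x)))
      + (1/4) *\<^sub>R act ?T (?\<phi> x)"
    unfolding dirac_one_third_def dirac_def bracket ..
  also have "\<dots> = act ((\<Sum>a\<in>UNIV. \<gamma> a * (- (1/2) *\<^sub>R ?N a + (1/8) *\<^sub>R (?T * cl2 \<gamma> (torsion_coeff x a))))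
      - (1/8) *\<^sub>R (?T * ?T)) (\<psi> x)"
    by (simp add: act_simps)
  also have "(\<Sum>a\<in>UNIV. \<gamma> a * (- (1/2) *\<^sub>R ?N a + (1/8) *\<^sub>R (?T * cl2 \<gamma> (torsion_coeff x a)))) =
      - (1/2) *\<^sub>R (\<Sum>a\<in>UNIV. \<gamma> a * ?N a) + (1/8) *\<^sub>R (\<Sum>a\<in>UNIV. \<gamma> a * (?T * cl2 \<gamma> (torsion_coeff x a)))"
    by (simp add: distrib_left right_diff_distrib sum.distrib sum_subtractf scaleR_sum_right sum_negf)
  finally show ?thesis .
qed

definition scal :: "real^'n \<Rightarrow> real" where
  "scal x = (\<Sum>k\<in>UNIV. \<Sum>l\<in>UNIV. G x (curv x (Y k x) (Y l x) (Y l x)) (Y k x))"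

definition nabla_T_coeff :: "real^'n \<Rightarrow> 'n \<Rightarrow> 'n \<Rightarrow> 'n \<Rightarrow> 'n \<Rightarrow> real" where
  "nabla_T_coeff x a i j k = nabla_T x (Y a x) (Y i x) (Y j x) (Y k x)"

text \<open>The Casimir operator acts on the parallel spinor through an element of the Clifford algebra, and this
  element is a combination of curvature operators, each of which annihilates the spinor.\<close>

theorem casimir_psi_eq_0:
  assumes x: "x \<in> U"
  shows "dirac_one_third (dirac_one_third \<psi>) x
    + (1/8) *\<^sub>R act (cl4 \<gamma> (\<lambda>i j k l. (nabla_T_coeff x i j k l - nabla_T_coeff x j i k l + nabla_T_coeff x k i j l - nabla_T_coeff x l i j k) - 2 * sigma_T id (torsion_coeff x) i j k l)) (\<psi> x)
    + (1/4) *\<^sub>R act (cl2 \<gamma> (\<lambda>i j. - (\<Sum>a\<in>UNIV. nabla_T_coeff x a a i j))) (\<psi> x)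
    - (1/8 * scal x) *\<^sub>R \<psi> x - (1/16 * norm_T_sq id (torsion_coeff x)) *\<^sub>R \<psi> x = 0" (is "?L = 0")
proof -
  let ?R = "\<lambda>k l i j. G x (curv x (Y k x) (Y l x) (Y i x)) (Y j x)"
  let ?F = "\<lambda>a b. torsion_curv_form x (Y a x) (Y b x)"
  have skew12: "?R k l i j = - ?R l k i j" for k l i j
    using curv_skew12[of x "Y k x" "Y l x" "Y i x"] by (simp add: linear_neg[OF G_lin1[OF x]])
  have skew34: "?R k l i j = - ?R k l j i" for k l i j
    by (rule curv_skew34[OF x])
  have bianchi: "?R k l i j + ?R l i k j + ?R i k l j = 0" for k l i j
    unfolding linear_add[OF G_lin1[OF x], symmetric] curv_bianchi[OF x] by (simp add: linear_0[OF G_lin1[OF x]])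
  have D: "skew3 (nabla_T_coeff x a)" for a
    unfolding skew3_def nabla_T_coeff_def using nabla_T_skew[OF x] by blast
  have F: "?F a b i j = ?R a b i j + (nabla_T_coeff x a b i j - nabla_T_coeff x b a i j) / 2
      + (\<Sum>k\<in>UNIV. torsion_coeff x a i k * torsion_coeff x b j k - torsion_coeff x b i k * torsion_coeff x a j k) / 4" for a b i j
    unfolding curvature_with_torsion[OF x] by (simp add: nabla_T_coeff_def torsion_form_def torsion_coeff_def)
  have "?L = act (- (1/2) *\<^sub>R (\<Sum>a\<in>UNIV. \<gamma> a * cl3 \<gamma> (nabla_T_coeff x a)) + (1/8) *\<^sub>R (\<Sum>a\<in>UNIV. \<gamma> a * (cl3 \<gamma> (torsion_coeff x) * cl2 \<gamma> (torsion_coeff x a)))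
      - (1/8) *\<^sub>R (cl3 \<gamma> (torsion_coeff x) * cl3 \<gamma> (torsion_coeff x))
      + (1/8) *\<^sub>R cl4 \<gamma> (\<lambda>i j k l. (nabla_T_coeff x i j k l - nabla_T_coeff x j i k l + nabla_T_coeff x k i j l - nabla_T_coeff x l i j k) - 2 * sigma_T id (torsion_coeff x) i j k l)
      + (1/4) *\<^sub>R cl2 \<gamma> (\<lambda>i j. - (\<Sum>a\<in>UNIV. nabla_T_coeff x a a i j))
      - (1/8 * (\<Sum>k\<in>UNIV. \<Sum>l\<in>UNIV. ?R k l l k)) *\<^sub>R 1 - (1/16 * norm_T_sq id (torsion_coeff x)) *\<^sub>R 1) (\<psi> x)"
    unfolding dirac_one_third_squared_psi[OF x] scal_def
    by (simp only: linear_add[OF act_linear1] linear_diff[OF act_linear1] linear_cmul[OF act_linear1] act_one nabla_T_coeff_def[abs_def])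
  also have "\<dots> = act (- (1/8) *\<^sub>R (\<Sum>a\<in>UNIV. \<Sum>b\<in>UNIV. \<gamma> a * \<gamma> b * cl2 \<gamma> (?F a b))) (\<psi> x)"
    by (subst casimir_eq_curvature_contraction[OF skew3_torsion_coeff[OF x] D skew12 skew34 bianchi F]) (rule refl)
  also have "\<dots> = 0"
    by (simp add: act_simps curvature_annihilates[OF x])
  finally show ?thesis .
qed

end

section \<open>From the manifold to a chart\<close>

lemma open_chart_image:
  assumes mfd: "smooth_manifold X A" and c: "c \<in> A" and W: "openin X W"
  shows "open (snd c ` (fst c \<inter> W))" and "inj_on (snd c) (fst c)"
proof -
  have o: "openin X (fst c)" "open (snd c ` fst c)"
    and h: "homeomorphic_map (subtopology X (fst c)) (top_of_set (snd c ` fst c)) (snd c)"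
    using mfd c unfolding smooth_manifold_def by blast+
  have ts: "topspace (subtopology X (fst c)) = fst c"
    using openin_subset[OF o(1)] by (simp add: topspace_subtopology Int_absorb1)
  show "inj_on (snd c) (fst c)"
    using homeomorphic_imp_injective_map[OF h] ts by simp
  have "openin (subtopology X (fst c)) (fst c \<inter> W)"
    using W by (rule openin_subtopology_Int2)
  then have "openin (top_of_set (snd c ` fst c)) (snd c ` (fst c \<inter> W))"
    using homeomorphic_imp_open_map[OF h] unfolding open_map_def by blast
  then show "open (snd c ` (fst c \<inter> W))"
    using o(2) openin_open_trans by blast
qed

theorem proposition3p1:
  fixes X :: "'a topology" and A :: "('a, 'n::finite) chart set"
    and g :: "('a, 'n) bilinear_field" and \<gamma> :: "'n \<Rightarrow> complex^'d^'d"
    and J :: "'j set" and W :: "'j \<Rightarrow> 'a set" and e :: "'j \<Rightarrow> 'n \<Rightarrow> ('a, 'n) vector_field"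
    and s :: "'j \<Rightarrow> 'j \<Rightarrow> 'a \<Rightarrow> complex^'d^'d"
    and T :: "('a, 'n) trilinear_field" and \<psi> :: "'j \<Rightarrow> 'a \<Rightarrow> complex^'d"
  assumes "smooth_manifold X A"
    and "riemannian_metric A g"
    and "spinor_module \<gamma>"
    and "spin_structure X A g \<gamma> J W e s"
    and "three_form A T"
    and "spinor_field A J W s \<psi>"
    and "\<forall>c\<in>A. \<forall>j\<in>J. \<forall>p\<in>fst c \<inter> W j. \<forall>v. spin_torsion c g T \<gamma> (e j) (\<psi> j) p v = 0"
  shows "\<forall>c\<in>A. \<forall>j\<in>J. \<forall>p\<in>fst c \<inter> W j. casimir c g T \<gamma> (e j) (\<psi> j) p = 0"
proof (intro ballI)
  fix c j p
  assume c: "c \<in> A" and j: "j \<in> J" and p: "p \<in> fst c \<inter> W j"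
  define h where "h = chart_inv c"
  define U where "U = snd c ` (fst c \<inter> W j)"
  define G where "G y = g c (h y)" for y
  define t where "t y = T c (h y)" for y
  define Y where "Y i y = e j i c (h y)" for i y
  define P where "P y = \<psi> j (h y)" for y
  define \<Gamma> where "\<Gamma> i = Cmat (\<gamma> i)" for i
  have "\<forall>j\<in>J. openin X (W j)" and "\<forall>j\<in>J. \<forall>i. vector_field_on A (W j) (e j i)"
    and "\<forall>j\<in>J. \<forall>c\<in>A. \<forall>p\<in>fst c \<inter> W j. \<forall>i k.
      g c p (e j i c p) (e j k c p) = (if i = k then 1 else 0)"
    using assms(4) unfolding spin_structure_def by - (elim conjE, assumption)+
  then have Wj: "openin X (W j)" and frame: "\<forall>i. vector_field_on A (W j) (e j i)"
    and orthonormal: "\<forall>c\<in>A. \<forall>p\<in>fst c \<inter> W j. \<forall>i k.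
      g c p (e j i c p) (e j k c p) = (if i = k then 1 else 0)"
    using j by blast+
  have U: "open U"
    unfolding U_def by (rule open_chart_image[OF assms(1) c Wj])
  have inj: "inj_on (snd c) (fst c)"
    by (rule open_chart_image[OF assms(1) c Wj])
  have h_in: "h y \<in> fst c \<inter> W j" and snd_h: "snd c (h y) = y" if "y \<in> U" for y
    using that inv_into_f_f[OF inj] by (auto simp: U_def h_def)
  have Usub: "U \<subseteq> snd c ` (fst c \<inter> fst c)"
    by (auto simp: U_def)
  have metric_c: "inner_product (g c q)" if "q \<in> fst c" for q
    using assms(2) c that by (simp add: riemannian_metric_def)
  have alt_c: "alternating3 (T c q)" if "q \<in> fst c" for q
    using assms(5) c that by (simp add: three_form_def)
  interpret local_geometry U G t Y
  proof
    show "open U" by (rule U)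
    show "inner_product (G x)" "alternating3 (t x)" if "x \<in> U" for x
      using h_in[OF that] by (simp_all add: G_def t_def metric_c alt_c)
    have "smooth_in c (fst c) (\<lambda>p. g c p v w)" for v w
      using assms(2) c by (simp add: riemannian_metric_def)
    then show "smooth_on U (\<lambda>x. G x v w)" for v w
      unfolding smooth_in_def G_def h_def comp_def by (rule smooth_on_subset[OF _ Usub])
    have "smooth_in c (fst c) (\<lambda>p. T c p u v w)" for u v w
      using assms(5) c by (simp add: three_form_def)
    then show "smooth_on U (\<lambda>x. t x u v w)" for u v w
      unfolding smooth_in_def t_def h_def comp_def by (rule smooth_on_subset[OF _ Usub])
    show "smooth_on U (Y i)" for i
      using frame c by (simp add: vector_field_on_def smooth_in_def Y_def[abs_def] h_def comp_def U_def)
    show "G x (Y i x) (Y k x) = (if i = k then 1 else 0)" if "x \<in> U" for x i k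
      using orthonormal c h_in[OF that] by (simp add: G_def Y_def)
  qed
  \<comment> \<open>From here on every operator of the theorem is rewritten in terms of its counterpart in the chart.\<close>
  have pd: "pd c f (h y) v = dir_deriv (\<lambda>y. f (h y)) y v" if "y \<in> U" for f :: "'a \<Rightarrow> 'z::real_normed_vector" and y v
    unfolding pd_def snd_h[OF that] by (simp add: h_def comp_def)
  have chr: "christoffel c g (h y) v w = christ y v w" if "y \<in> U" for y v w
    unfolding christoffel_def christ_def koszul_def[abs_def] by (simp add: pd[OF that] G_def)
  have lc: "levi_civita c g (e j i) (h y) v = nabla (Y i) y v" if "y \<in> U" for i y v
    unfolding levi_civita_def nabla_def by (simp add: pd[OF that] chr[OF that] Y_def[abs_def])
  have slc: "spin_levi_civita c g \<gamma> (e j) f (h y) v =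
      dir_deriv (\<lambda>y. f (h y)) y v + (1/2) *\<^sub>R act (cl2 \<Gamma> (conn_form y v)) (f (h y))" if "y \<in> U" for f y v
    unfolding spin_levi_civita_def spin_lift_def lc[OF that] pd[OF that]
    by (simp add: conn_form_def G_def Y_def cl2_def \<Gamma>_def act_simps act_gamma matrix_vector_mul_assoc)
  have st: "spin_torsion c g T \<gamma> (e j) f (h y) v =
      dir_deriv (\<lambda>y. f (h y)) y v + (1/2) *\<^sub>R act (cl2 \<Gamma> (torsion_conn_form y v)) (f (h y))" if "y \<in> U" for f y v
  proof -
    have m: "torsion_conn_form y v = (\<lambda>i k. conn_form y v i k + (1/2) * T c (h y) v (e j i c (h y)) (e j k c (h y)))"
      by (simp add: torsion_conn_form_def torsion_form_def fun_eq_iff t_def Y_def)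
    have lift: "spin_torsion c g T \<gamma> (e j) f (h y) v = spin_levi_civita c g \<gamma> (e j) f (h y) v
        + (1/4) *\<^sub>R (cliff2 \<gamma> (\<lambda>i. e j i c (h y)) (T c (h y) v) *v f (h y))"
      by (rule spin_torsion_eq) (use h_in[OF that] in \<open>auto intro: metric_c alt_c\<close>)
    show ?thesis
      unfolding lift slc[OF that]
        cliff2_eq m cl2_add cl2_scale
      by (simp add: act_simps scaleR_add_right \<Gamma>_def[abs_def])
  qed
  interpret local_spinor U G t Y \<Gamma> P
  proof (intro local_spinor.intro local_spinor_axioms.intro)
    show "local_geometry U G t Y" by unfold_locales
    show "clifford_family \<Gamma>"
      unfolding \<Gamma>_def[abs_def] by (rule clifford_family_Cmat[OF assms(3)])
    have "smooth_in c (W j) (\<psi> j)"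
      using assms(6) c j by (simp add: spinor_field_def)
    then show "smooth_on U P"
      by (simp add: smooth_in_def P_def[abs_def] h_def comp_def U_def)
    show "dir_deriv P x v = - (1/2) *\<^sub>R act (cl2 \<Gamma> (torsion_conn_form x v)) (P x)" if "x \<in> U" for x v
    proof -
      have "spin_torsion c g T \<gamma> (e j) (\<psi> j) (h x) v = 0"
        using assms(7) c j h_in[OF that] by blast
      then show ?thesis
        unfolding st[OF that] P_def[abs_def] by (simp add: eq_neg_iff_add_eq_0)
    qed
  qed
  have third: "dirac_third c g T \<gamma> (e j) f (h y) = dirac_one_third (\<lambda>y. f (h y)) y" if "y \<in> U" for f y
    unfolding dirac_third_def dirac_g_def dirac_one_third_def dirac_def slc[OF that] cliff3_eq
    by (simp add: \<Gamma>_def[abs_def] act_gamma Y_def torsion_coeff_def[abs_def] t_def)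
  define x where "x = snd c p"
  have x: "x \<in> U" using p by (auto simp: x_def U_def)
  have hx: "h x = p" using p inv_into_f_f[OF inj] by (simp add: h_def x_def)
  have D: "dirac_third c g T \<gamma> (e j) (dirac_third c g T \<gamma> (e j) (\<psi> j)) p = dirac_one_third (dirac_one_third P) x"
  proof -
    have "dirac_third c g T \<gamma> (e j) (dirac_third c g T \<gamma> (e j) (\<psi> j)) (h x) =
        dirac_one_third (\<lambda>y. dirac_third c g T \<gamma> (e j) (\<psi> j) (h y)) x"
      by (rule third[OF x])
    also have "\<dots> = dirac_one_third (dirac_one_third P) x"
      by (rule dirac_one_third_cong[OF x]) (simp add: third P_def[abs_def])
    finally show ?thesis by (simp add: hx)
  qed
  have dchr: "pd c (\<lambda>q. christoffel c g q v w) p = dir_deriv (\<lambda>y. christ y v w) x" for v w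
  proof -
    have "pd c (\<lambda>q. christoffel c g q v w) (h x) = dir_deriv (\<lambda>y. christoffel c g (h y) v w) x"
      by (rule ext) (rule pd[OF x])
    also have "\<dots> = dir_deriv (\<lambda>y. christ y v w) x"
      by (rule dir_deriv_cong[OF U x chr])
    finally show ?thesis by (simp add: hx)
  qed
  have chr_p: "christoffel c g p v w = christ x v w" for v w
    using chr[OF x] by (simp add: hx)
  have R: "riemann c g p u v w = curv x u v w" for u v w
    unfolding riemann_def curv_def dchr chr_p ..
  have pd_T: "pd c (\<lambda>q. T c q u v w) p z = dir_deriv (\<lambda>y. t y u v w) x z" for u v w z
    using pd[OF x, of "\<lambda>q. T c q u v w" z] by (simp add: hx t_def)
  have tp: "T c p = t x" and gp: "g c p = G x" and ep: "e j i c p = Y i x" and Pp: "\<psi> j p = P x" for i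
    by (simp_all add: t_def G_def Y_def P_def hx)
  have cov: "cov_deriv3 c g T p v u w z = nabla_T x v u w z" for u v w z
    unfolding cov_deriv3_def nabla_T_def pd_T chr_p tp ..
  have ext: "ext_deriv c T p (Y i x) (Y k x) (Y l x) (Y m x) =
      nabla_T_coeff x i k l m - nabla_T_coeff x k i l m + nabla_T_coeff x l i k m - nabla_T_coeff x m i k l" for i k l m
    unfolding ext_deriv_def pd_T ext_deriv_eq_nabla_T[OF x] nabla_T_coeff_def ..
  have sigma: "sigma_T (\<lambda>i. Y i x) (t x) (Y i x) (Y k x) (Y l x) (Y m x) = sigma_T id (torsion_coeff x) i k l m" for i k l m
    by (simp add: sigma_T_def wedge22_def torsion_coeff_def)
  have norm: "norm_T_sq (\<lambda>i. Y i x) (t x) = norm_T_sq id (torsion_coeff x)"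
    by (simp add: norm_T_sq_def torsion_coeff_def)
  have scal: "scal_g c g (\<lambda>i. Y i x) p = scal x"
    by (simp add: scal_g_def scal_def R gp)
  have cod: "codiff c g T (\<lambda>i. Y i x) p (Y i x) (Y k x) = - (\<Sum>a\<in>UNIV. nabla_T_coeff x a a i k)" for i k
    by (simp add: codiff_def cov nabla_T_coeff_def)
  show "casimir c g T \<gamma> (e j) (\<psi> j) p = 0"
    unfolding casimir_def Let_def D cliff4_eq cliff2_eq tp ep Pp
    using casimir_psi_eq_0[OF x]
    by (simp only: ext sigma norm scal cod \<Gamma>_def[abs_def])
qed

end
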